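(* Let $n\in\{2,3\}$ and let the tensor $\mathbb A$ satisfy the relaxed ellipticity condition. (i) If $\mathbf f\in\dot{\mathbf H}_\#^{s-2}$, $s\ge1$, then the anisotropic Navier-Stokes equation $$-\boldsymbol{\mathfrak L}\mathbf u+\nabla p+(\mathbf u\cdot\nabla)\mathbf u=\mathbf f$$ has a solution $(\mathbf u,p)\in\dot{\mathbf H}_{\#\sigma}^s\times\dot H_\#^{s-1}$. (ii) Moreover, if $\mathbf f\in\dot{\mathbf C}_\#^\infty$ then this equation has a solution $(\mathbf u,p)\in\dot{\mathbf C}_\#^\infty\times\dot{\mathcal C}^\infty_\#$ (with $\mathrm{div}\,\mathbf u=0$).
   Context: Repeated indices are summed from $1$ to $n$; $\partial_j=\partial/\partial x_j$. All functions and distributions are real-valued. $\mathbb A=(a_{kj}^{\alpha\beta})_{1\le k,j,\alpha,\beta\le n}$ is a tensor of real constants with the symmetry $a_{kj}^{\alpha\beta}=a_{\alpha j}^{k\beta}=a_{k\beta}^{\alpha j}$ (standing assumption). Relaxed ellipticity condition: there is a constant $C_{\mathbb A}>0$ such that $C_{\mathbb A}a_{kj}^{\alpha\beta}\zeta_{k\alpha}\zeta_{j\beta}\ge|\boldsymbol\zeta|^2:=\zeta_{k\alpha}\zeta_{k\alpha}$ for all $\boldsymbol\zeta\in\mathbb R^{n\times n}$ with $\boldsymbol\zeta=\boldsymbol\zeta^\top$ and $\sum_k\zeta_{kk}=0$. $(\boldsymbol{\mathfrak L}\mathbf u)_k:=\partial_\alpha(a_{kj}^{\alpha\beta}E_{j\beta}(\mathbf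 u))=\partial_\alpha(a_{kj}^{\alpha\beta}\partial_\beta u_j)$ with $E_{j\beta}(\mathbf u)=\frac12(\partial_ju_\beta+\partial_\beta u_j)$. $((\mathbf u\cdot\nabla)\mathbf u)_k=u_j\partial_ju_k$. The Navier-Stokes equation is considered for incompressible (divergence-free) $\mathbf u$ and is understood in the sense of (periodic) distributions. $\mathbb T=[0,1)^n$ is the flat torus; functions/distributions on it are identified with $1$-periodic ones on $\mathbb R^n$. $\mathcal C^\infty_\#$ denotes the $1$-periodic functions in $\mathcal C^\infty(\mathbb R^n)$. Fourier coefficients: $\hat g(\boldsymbol\xi)=\int_{\mathbb T}e^{-2\pi i\mathbf x\cdot\boldsymbol\xi}g(\mathbf x)d\mathbf x$, $\boldsymbol\xi\in\mathbb Z^n$, extended to periodic distributions. For $s\in\mathbb R$, $H^s_\#$ is the space of periodic distributions with finite norm $\|g\|_{H^s_\#}=\big(\sum_{\boldsymbol\xi\in\mathbb Z^n}(1+|\boldsymbol\xi|^2)^s|\hat g(\boldsymbol\xi)|^2\big)^{1/2}$; $\dot H^s_\#=\{g\in H^s_\#:\hat g(\mathbf 0)=0\}$; $\dot{\mathcal C}^\infty_\#=\{g\in\mathcal C^\infty_\#:\int_{\mathbb T}g=0\}$. Bold symbols denote $n$-component vector versions; $\dot{\mathbf H}^s_{\#\sigma}=\{\mathbf w\in\dot{\mathbf H}^s_\#:\mathrm{div}\,\mathbf w=0\}$. *)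

theory Defs
  imports "HOL-Analysis.Analysis"
begin

text \<open>
  Functions on the flat torus are 1-periodic functions on \<open>real^'n\<close>, with \<open>n = CARD('n)\<close>.
  Vector fields (of functions or of distributions) are families of components indexed by \<open>'n\<close>.
\<close>

type_synonym 'n scalar = "real^'n \<Rightarrow> real"

definition torus :: "(real^'n) set" where
  "torus = {x. \<forall>i. 0 \<le> x $ i \<and> x $ i < 1}"

definition periodic :: "'n::finite scalar \<Rightarrow> bool" where
  "periodic f \<longleftrightarrow> (\<forall>x i. f (x + axis i 1) = f x)"

definition partial_derivative :: "'n::finite \<Rightarrow> 'n scalar \<Rightarrow> 'n scalar" where
  "partial_derivative j f = (\<lambda>x. frechet_derivative f (at x) (axis j 1))"

definition iterated_partial :: "'n::finite list \<Rightarrow> 'n scalar \<Rightarrow> 'n scalar" where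
  "iterated_partial js f = foldr partial_derivative js f"

definition smooth :: "'n::finite scalar \<Rightarrow> bool" where
  "smooth f \<longleftrightarrow> (\<forall>js. iterated_partial js f differentiable_on UNIV)"

definition C_per :: "'n::finite scalar set" where
  "C_per = {f. smooth f \<and> periodic f}"

definition C_per_dot :: "'n::finite scalar set" where
  "C_per_dot = {f \<in> C_per. (LINT x:torus|lebesgue. f x) = 0}"


text \<open>
  Periodic distributions are the continuous linear functionals on \<open>C_per\<close> with the topology
  given by the norms \<open>C_norm m\<close>, \<open>m = 0, 1, 2, \<dots>\<close>. They are represented by functions on all scalar
  fields whose values outside \<open>C_per\<close> are irrelevant; accordingly, identities between distributions
  are always stated on \<open>C_per\<close> only.
\<close>

type_synonym 'n functional = "'n scalar \<Rightarrow> real"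

definition C_norm :: "nat \<Rightarrow> 'n::finite scalar \<Rightarrow> real" where
  "C_norm m \<phi> = (SUP (js, x) \<in> {js. length js \<le> m} \<times> UNIV. \<bar>iterated_partial js \<phi> x\<bar>)"

definition distributions :: "'n::finite functional set" where
  "distributions = {g.
     (\<forall>\<phi>\<in>C_per. \<forall>\<psi>\<in>C_per. g (\<lambda>x. \<phi> x + \<psi> x) = g \<phi> + g \<psi>) \<and>
     (\<forall>\<phi>\<in>C_per. \<forall>c. g (\<lambda>x. c * \<phi> x) = c * g \<phi>) \<and>
     (\<exists>C m. \<forall>\<phi>\<in>C_per. \<bar>g \<phi>\<bar> \<le> C * C_norm m \<phi>)}"

definition dist_eq :: "'n::finite functional \<Rightarrow> 'n functional \<Rightarrow> bool" where
  "dist_eq g h \<longleftrightarrow> (\<forall>\<phi>\<in>C_per. g \<phi> = h \<phi>)"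

definition dist_deriv :: "'n::finite \<Rightarrow> 'n functional \<Rightarrow> 'n functional" where
  "dist_deriv j g = (\<lambda>\<phi>. - g (partial_derivative j \<phi>))"

definition dist_of :: "'n::finite scalar \<Rightarrow> 'n functional" where
  "dist_of a = (\<lambda>\<phi>. LINT x:torus|lebesgue. a x * \<phi> x)"

definition represents :: "'n::finite scalar \<Rightarrow> 'n functional \<Rightarrow> bool" where
  "represents a g \<longleftrightarrow> periodic a \<and> set_integrable lebesgue torus a \<and> dist_eq g (dist_of a)"

text \<open>
  The product of two regular distributions is the regular distribution of the pointwise product of
  their densities, provided that this product is integrable. Densities are unique almost everywhere,
  so \<open>w\<close> is determined on \<open>C_per\<close> by \<open>g\<close> and \<open>h\<close>.
\<close>

definition is_product :: "'n::finite functional \<Rightarrow> 'n functional \<Rightarrow> 'n functional \<Rightarrow> bool" where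
  "is_product g h w \<longleftrightarrow>
     (\<exists>a b. represents a g \<and> represents b h \<and> represents (\<lambda>x. a x * b x) w)"


definition lattice_vec :: "int^'n::finite \<Rightarrow> real^'n" where
  "lattice_vec \<xi> = (\<chi> i. real_of_int (\<xi> $ i))"

text \<open>
  The pairing of a real distribution with \<open>exp (- 2 * pi * \<i> * (x \<bullet> \<xi>))\<close>, split into its real and
  imaginary parts.
\<close>

definition fourier_coeff :: "'n::finite functional \<Rightarrow> int^'n \<Rightarrow> complex" where
  "fourier_coeff g \<xi> =
     Complex (g (\<lambda>x. cos (2 * pi * (x \<bullet> lattice_vec \<xi>))))
             (- g (\<lambda>x. sin (2 * pi * (x \<bullet> lattice_vec \<xi>))))"

definition H_per :: "real \<Rightarrow> 'n::finite functional set" where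
  "H_per s = {g \<in> distributions.
     (\<lambda>\<xi>. (1 + (norm (lattice_vec \<xi>))\<^sup>2) powr s * (cmod (fourier_coeff g \<xi>))\<^sup>2) summable_on UNIV}"

definition H_per_dot :: "real \<Rightarrow> 'n::finite functional set" where
  "H_per_dot s = {g \<in> H_per s. fourier_coeff g 0 = 0}"

definition divergence :: "('n::finite \<Rightarrow> 'n functional) \<Rightarrow> 'n functional" where
  "divergence u = (\<lambda>\<phi>. \<Sum>j\<in>UNIV. dist_deriv j (u j) \<phi>)"

definition H_per_dot_sol :: "real \<Rightarrow> ('n::finite \<Rightarrow> 'n functional) set" where
  "H_per_dot_sol s = {u. (\<forall>k. u k \<in> H_per_dot s) \<and> dist_eq (divergence u) (\<lambda>\<phi>. 0)}"


text \<open>The argument order is \<open>A k j \<alpha> \<beta>\<close> for the coefficient with lower indices \<open>k, j\<close> and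
  upper indices \<open>\<alpha>, \<beta>\<close>.\<close>

type_synonym 'n tensor4 = "'n \<Rightarrow> 'n \<Rightarrow> 'n \<Rightarrow> 'n \<Rightarrow> real"

definition tensor_symmetric :: "'n tensor4 \<Rightarrow> bool" where
  "tensor_symmetric A \<longleftrightarrow>
     (\<forall>k j \<alpha> \<beta>. A k j \<alpha> \<beta> = A \<alpha> j k \<beta> \<and> A k j \<alpha> \<beta> = A k \<beta> \<alpha> j)"

definition relaxed_elliptic :: "'n::finite tensor4 \<Rightarrow> bool" where
  "relaxed_elliptic A \<longleftrightarrow>
     (\<exists>C>0. \<forall>\<zeta>::real^'n^'n. transpose \<zeta> = \<zeta> \<and> trace \<zeta> = 0 \<longrightarrow>
        C * (\<Sum>k\<in>UNIV. \<Sum>j\<in>UNIV. \<Sum>\<alpha>\<in>UNIV. \<Sum>\<beta>\<in>UNIV. A k j \<alpha> \<beta> * \<zeta> $ k $ \<alpha> * \<zeta> $ j $ \<beta>)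
          \<ge> (\<Sum>k\<in>UNIV. \<Sum>\<alpha>\<in>UNIV. \<zeta> $ k $ \<alpha> * \<zeta> $ k $ \<alpha>))"

definition strain :: "('n::finite \<Rightarrow> 'n functional) \<Rightarrow> 'n \<Rightarrow> 'n \<Rightarrow> 'n functional" where
  "strain u j \<beta> = (\<lambda>\<phi>. (dist_deriv j (u \<beta>) \<phi> + dist_deriv \<beta> (u j) \<phi>) / 2)"

definition elliptic_operator ::
  "'n::finite tensor4 \<Rightarrow> ('n \<Rightarrow> 'n functional) \<Rightarrow> 'n \<Rightarrow> 'n functional" where
  "elliptic_operator A u k = (\<lambda>\<phi>. \<Sum>\<alpha>\<in>UNIV.
     dist_deriv \<alpha> (\<lambda>\<psi>. \<Sum>j\<in>UNIV. \<Sum>\<beta>\<in>UNIV. A k j \<alpha> \<beta> * strain u j \<beta> \<psi>) \<phi>)"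

text \<open>\<open>N j k\<close> is the distribution \<open>u\<^sub>j \<partial>\<^sub>j u\<^sub>k\<close>; being a solution includes that these products exist.\<close>

definition navier_stokes_solution ::
  "'n::finite tensor4 \<Rightarrow> ('n \<Rightarrow> 'n functional) \<Rightarrow> ('n \<Rightarrow> 'n functional) \<Rightarrow> 'n functional \<Rightarrow> bool" where
  "navier_stokes_solution A f u p \<longleftrightarrow>
     (\<exists>N. (\<forall>j k. is_product (u j) (dist_deriv j (u k)) (N j k)) \<and>
          (\<forall>k. dist_eq
             (\<lambda>\<phi>. - elliptic_operator A u k \<phi> + dist_deriv k p \<phi> + (\<Sum>j\<in>UNIV. N j k \<phi>))
             (f k)))"

end

theory Submission
  imports Defs "HOL-Homology.Brouwer_Degree"
begin

text \<open>
  In terms of Fourier coefficients the equation reads, for each frequency \<open>\<xi>\<close>,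
  \<open>4 \<pi>\<^sup>2 (\<Sum>j. symbol A k j \<xi> u\<^sub>j) + 2 \<pi> \<i> \<xi>\<^sub>k p + (advection) = f\<^sub>k\<close>.
  On vectors orthogonal to \<open>\<xi>\<close> the relaxed ellipticity condition, applied to the symmetrized and
  trace-free matrix of \<open>\<xi>\<^sub>\<alpha> v\<^sub>k\<close>, makes the symbol coercive, and the advection term does not contribute
  to the energy. Hence every finite system obtained by truncating the frequencies has a solution with
  uniformly bounded \<open>H\<^sup>1\<close> norm; this is where a topological argument (the sphere is not contractible)
  enters. Coefficientwise limits of these solutions solve the full system, because an \<open>H\<^sup>1\<close> bound makes
  the tails of the convolution uniformly small; the pressure is read off from the component of the
  residual along \<open>\<xi>\<close>.

  Regularity is a bootstrap based on the weighted Cauchy--Schwarz inequality for convolutions and the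
  summability of \<open>(1 + |\<xi>|\<^sup>2)\<close> to the power \<open>- r\<close> for \<open>r > n / 2\<close>. The coefficients are finally
  turned into distributions by the Riesz--Fischer theorem, and identities between distributions are
  checked on Fourier coefficients only, since trigonometric polynomials are dense in the smooth periodic
  functions.
\<close>

subsection \<open>Vector fields pointing outward on a sphere\<close>

text \<open>The force is not assumed small, so contraction arguments are out: existence rests on the
  energy identity and a degree argument, and no uniqueness is claimed. Working with coefficients
  replaces compactness in function spaces: bounded coefficients have a convergent subsequence, and
  at a fixed frequency \<open>\<xi>\<close> the equation contains one convolution sum. The advection
  is kept in conservative form so that its derivative is the fixed factor \<open>\<xi>\<close>; the
  convective form demanded by \<open>navier_stokes_solution\<close> returns only at the end, through
  solenoidality. The pressure is absent from the truncated systems because they are tested with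
  solenoidal waves only. The bound on the dimension is spent in the bootstrap: two families of order
  \<open>\<sigma>\<close> convolve to order \<open>t\<close> if
  \<open>n / 2 < 2 * \<sigma> - t\<close>, and at the starting order \<open>\<sigma> = 1\<close>
  this estimate yields a gain only for \<open>n < 4\<close>. One solution is built from the weakest
  hypothesis \<open>s = 1\<close> and then shown to be as regular as the force permits, which serves
  both parts of the theorem at once.\<close>

definition unit_vectors :: "nat \<Rightarrow> (nat \<Rightarrow> real) set" where
  "unit_vectors d = {x. (\<forall>i\<ge>d. x i = 0) \<and> (\<Sum>i<d. (x i)\<^sup>2) = 1}"

text \<open>Sequences supported on the first \<open>Suc n\<close> coordinates are the encoding of
  the \<open>n\<close>-sphere in homology, so the noncontractibility of \<open>nsphere\<close>
  carries over verbatim.\<close>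

lemma not_contractible_unit_vectors: "\<not> contractible (unit_vectors (Suc n))"
proof -
  have "nsphere n = top_of_set (unit_vectors (Suc n))"
    unfolding nsphere_def Euclidean_space_def unit_vectors_def
    by (simp add: subtopology_subtopology euclidean_product_topology[symmetric] lessThan_Suc_atMost Int_def)
  then show ?thesis
    using non_contractible_space_nsphere[of n] contractible_space_top_of_set by metis
qed

definition normalized :: "nat \<Rightarrow> (nat \<Rightarrow> real) \<Rightarrow> nat \<Rightarrow> real" where
  "normalized d v = (\<lambda>i. if i < d then v i / sqrt (\<Sum>j<d. (v j)\<^sup>2) else 0)"

lemma normalized_mem:
  assumes "\<exists>i<d. v i \<noteq> 0"
  shows "normalized d v \<in> unit_vectors d"
proof -
  obtain i where i: "i < d" "v i \<noteq> 0" using assms by blast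
  have pos: "(\<Sum>j<d. (v j)\<^sup>2) > 0"
    by (rule sum_pos2[of _ i]) (use i in auto)
  have "(\<Sum>i<d. (v i / sqrt (\<Sum>j<d. (v j)\<^sup>2))\<^sup>2) = (\<Sum>i<d. (v i)\<^sup>2) / (\<Sum>j<d. (v j)\<^sup>2)"
    using pos by (simp add: power_divide flip: sum_divide_distrib)
  then show ?thesis
    using pos by (simp add: unit_vectors_def normalized_def)
qed

lemma normalized_unit: "x \<in> unit_vectors d \<Longrightarrow> normalized d x = x"
  by (auto simp: unit_vectors_def normalized_def)

text \<open>Radial projection turns a family of vector fields without zeros into a homotopy of
  self-maps of the sphere.\<close>

lemma homotopic_normalized:
  fixes v :: "real \<times> (nat \<Rightarrow> real) \<Rightarrow> nat \<Rightarrow> real"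
  assumes cont: "\<And>i. i < d \<Longrightarrow> continuous_on ({0..1} \<times> unit_vectors d) (\<lambda>z. v z i)"
    and nz: "\<And>z. z \<in> {0..1} \<times> unit_vectors d \<Longrightarrow> \<exists>i<d. v z i \<noteq> 0"
  shows "homotopic_with_canon (\<lambda>_. True) (unit_vectors d) (unit_vectors d)
           (\<lambda>x. normalized d (v (0, x))) (\<lambda>x. normalized d (v (1, x)))"
proof -
  have pos: "sqrt (\<Sum>j<d. (v z j)\<^sup>2) \<noteq> 0" if z: "z \<in> {0..1} \<times> unit_vectors d" for z
  proof -
    obtain i where i: "i < d" "v z i \<noteq> 0" using nz[OF z] by blast
    have "(\<Sum>j<d. (v z j)\<^sup>2) > 0"
      by (rule sum_pos2[of _ i]) (use i in auto)
    then show ?thesis by simp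
  qed
  have "continuous_on ({0..1} \<times> unit_vectors d) (\<lambda>z. normalized d (v z))"
  proof (rule continuous_on_coordinatewise_then_product)
    fix i
    show "continuous_on ({0..1} \<times> unit_vectors d) (\<lambda>z. normalized d (v z) i)"
    proof (cases "i < d")
      case True
      then show ?thesis
        unfolding normalized_def using pos cont
        by (auto intro!: continuous_intros)
    qed (simp add: normalized_def)
  qed
  moreover have "(\<lambda>z. normalized d (v z)) ` ({0..1} \<times> unit_vectors d) \<subseteq> unit_vectors d"
    using nz normalized_mem by blast
  ultimately show ?thesis
    unfolding homotopic_with_def
    by (intro exI[of _ "\<lambda>z. normalized d (v z)"])
       (auto simp: continuous_map_in_subtopology continuous_map_subtopology_eu prod_topology_subtopology
          subtopology_subtopology Times_Int_Times image_subset_iff)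
qed

text \<open>If \<open>F\<close> had no zero in the ball, the sphere would be contractible: normalized, \<open>F\<close> is homotopic
  to the identity along segments, and to a constant by shrinking the radius to zero.\<close>
lemma acute_angle_nat:
  fixes F :: "(nat \<Rightarrow> real) \<Rightarrow> nat \<Rightarrow> real"
  assumes cont: "\<And>i. continuous_on UNIV (\<lambda>x. F x i)" and "R > 0"
    and acute: "\<And>x. (\<Sum>i<d. (x i)\<^sup>2) = R\<^sup>2 \<Longrightarrow> (\<Sum>i<d. F x i * x i) > 0"
  shows "\<exists>x. (\<Sum>i<d. (x i)\<^sup>2) \<le> R\<^sup>2 \<and> (\<forall>i<d. F x i = 0)"
\<comment> \<open>Dimension zero is split off because \<open>unit_vectors 0\<close> is empty; there
  every point is a zero.\<close>
proof (cases d)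
  case 0
  then show ?thesis by auto
next
  case (Suc n)
  show ?thesis
  proof (rule ccontr)
    assume "\<not> ?thesis"
    then have nz: "\<exists>i<d. F x i \<noteq> 0" if "(\<Sum>i<d. (x i)\<^sup>2) \<le> R\<^sup>2" for x
      using that by blast
    have cF: "continuous_on S (\<lambda>z. F (\<lambda>i. g z i) i)"
      if "\<And>i. continuous_on S (\<lambda>z. g z i)" for S :: "(real \<times> (nat \<Rightarrow> real)) set" and g i
      using continuous_on_compose2[OF cont[of i] continuous_on_coordinatewise_then_product[OF that]]
      by simp
    have coord: "continuous_on S (\<lambda>z::real \<times> (nat \<Rightarrow> real). snd z i)" for S i
      by (rule continuous_on_product_then_coordinatewise) (intro continuous_intros)
    define v1 :: "real \<times> (nat \<Rightarrow> real) \<Rightarrow> nat \<Rightarrow> real" where "v1 = (\<lambda>z i. (1 - fst z) * snd z i + fst z * F (\<lambda>i. R * snd z i) i)"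
    define v2 :: "real \<times> (nat \<Rightarrow> real) \<Rightarrow> nat \<Rightarrow> real" where "v2 = (\<lambda>z. F (\<lambda>i. (1 - fst z) * R * snd z i))"
    have 1: "homotopic_with_canon (\<lambda>_. True) (unit_vectors d) (unit_vectors d)
           (\<lambda>x. normalized d (v1 (0, x))) (\<lambda>x. normalized d (v1 (1, x)))"
    proof (rule homotopic_normalized)
      show "continuous_on ({0..1} \<times> unit_vectors d) (\<lambda>z. v1 z i)" for i
        unfolding v1_def by (intro continuous_intros coord cF)
      fix z :: "real \<times> (nat \<Rightarrow> real)" assume z: "z \<in> {0..1} \<times> unit_vectors d"
      obtain t x where tx: "z = (t, x)" by fastforce
      have t: "0 \<le> t" "t \<le> 1" and x: "(\<Sum>i<d. (x i)\<^sup>2) = 1"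
        using z tx by (auto simp: unit_vectors_def)
      have "(\<Sum>i<d. (R * x i)\<^sup>2) = R\<^sup>2"
        by (simp add: power_mult_distrib flip: sum_distrib_left) (simp add: x)
      then have "(\<Sum>i<d. F (\<lambda>i. R * x i) i * (R * x i)) > 0"
        using acute[of "\<lambda>i. R * x i"] by simp
      moreover have "(\<Sum>i<d. F (\<lambda>i. R * x i) i * (R * x i)) = R * (\<Sum>i<d. F (\<lambda>i. R * x i) i * x i)"
        by (simp add: sum_distrib_left mult_ac)
      ultimately have pos: "(\<Sum>i<d. F (\<lambda>i. R * x i) i * x i) > 0"
        using \<open>R > 0\<close> by (simp add: zero_less_mult_iff)
      \<comment> \<open>Pairing with \<open>x\<close> detects nonvanishing: the identity contributes
        \<open>1 - t\<close> and the outward field a positive multiple of \<open>t\<close>.\<close>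
      have "(\<Sum>i<d. v1 z i * x i) = (1 - t) + t * (\<Sum>i<d. F (\<lambda>i. R * x i) i * x i)"
        using x unfolding v1_def tx
        by (simp add: algebra_simps sum.distrib sum_subtractf power2_eq_square flip: sum_distrib_left)
      also have "\<dots> > 0"
        using t pos by (cases "t = 0") (auto intro: add_nonneg_pos)
      finally show "\<exists>i<d. v1 z i \<noteq> 0"
        by (metis (no_types, lifting) lessThan_iff mult_zero_left order_less_irrefl sum.neutral)
    qed
    have 2: "homotopic_with_canon (\<lambda>_. True) (unit_vectors d) (unit_vectors d)
           (\<lambda>x. normalized d (v2 (0, x))) (\<lambda>x. normalized d (v2 (1, x)))"
    proof (rule homotopic_normalized)
      show "continuous_on ({0..1} \<times> unit_vectors d) (\<lambda>z. v2 z i)" for i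
        unfolding v2_def by (intro cF continuous_intros coord)
      fix z :: "real \<times> (nat \<Rightarrow> real)" assume z: "z \<in> {0..1} \<times> unit_vectors d"
      obtain t x where tx: "z = (t, x)" by fastforce
      have t: "0 \<le> t" "t \<le> 1" and x: "(\<Sum>i<d. (x i)\<^sup>2) = 1"
        using z tx by (auto simp: unit_vectors_def)
      have "(\<Sum>i<d. ((1 - t) * R * x i)\<^sup>2) = ((1 - t) * R)\<^sup>2"
        by (simp add: power_mult_distrib flip: sum_distrib_left) (simp add: x)
      also have "\<dots> \<le> R\<^sup>2"
        using t \<open>R > 0\<close> by (intro power_mono) (auto simp: mult_left_le_one_le)
      finally show "\<exists>i<d. v2 z i \<noteq> 0"
        using nz by (simp add: v2_def tx)
    qed
    have "v1 (1, x) = v2 (0, x)" and "v2 (1, x) = F (\<lambda>_. 0)" for x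
      by (auto simp: v1_def v2_def)
    then have "homotopic_with_canon (\<lambda>_. True) (unit_vectors d) (unit_vectors d)
           (\<lambda>x. normalized d (v1 (0, x))) (\<lambda>_. normalized d (F (\<lambda>_. 0)))"
      using homotopic_with_trans 1 2 by fastforce
    then have "homotopic_with_canon (\<lambda>_. True) (unit_vectors d) (unit_vectors d)
           id (\<lambda>_. normalized d (F (\<lambda>_. 0)))"
      by (rule homotopic_with_eq) (auto simp: v1_def normalized_unit)
    then have "contractible (unit_vectors d)"
      unfolding contractible_def by blast
    then show False
      using not_contractible_unit_vectors Suc by blast
  qed
qed

lemma acute_angle:
  fixes F :: "('i \<Rightarrow> real) \<Rightarrow> 'i \<Rightarrow> real"
  assumes "finite I" and cont: "\<And>i. i \<in> I \<Longrightarrow> continuous_on UNIV (\<lambda>x. F x i)" and "R > 0"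
    and acute: "\<And>x. (\<Sum>i\<in>I. (x i)\<^sup>2) = R\<^sup>2 \<Longrightarrow> (\<Sum>i\<in>I. F x i * x i) > 0"
  shows "\<exists>x. (\<Sum>i\<in>I. (x i)\<^sup>2) \<le> R\<^sup>2 \<and> (\<forall>i\<in>I. F x i = 0)"
proof -
  obtain e where e: "bij_betw e {..<card I} I"
    using ex_bij_betw_nat_finite[OF \<open>finite I\<close>] atLeast0LessThan by metis
  let ?g = "the_inv_into {..<card I} e"
  have ge: "?g (e i) = i" if "i < card I" for i
    using e that by (simp add: bij_betw_def the_inv_into_f_f)
  have sum_e: "(\<Sum>i\<in>I. h i) = (\<Sum>i<card I. h (e i))" for h :: "'i \<Rightarrow> real"
    using sum.reindex_bij_betw[OF e] by metis
  \<comment> \<open>Off \<open>I\<close> the inverse \<open>?g\<close> has no specified value. This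
    is harmless, since continuity and \<open>acute\<close> are assumed for all \<open>x\<close>,
    whatever its values outside \<open>I\<close>.\<close>
  define F' where "F' = (\<lambda>x i. if i < card I then F (\<lambda>k. x (?g k)) (e i) else 0)"
  have "\<exists>x. (\<Sum>i<card I. (x i)\<^sup>2) \<le> R\<^sup>2 \<and> (\<forall>i<card I. F' x i = 0)"
  proof (rule acute_angle_nat[OF _ \<open>R > 0\<close>])
    show "continuous_on UNIV (\<lambda>x. F' x i)" for i
    proof (cases "i < card I")
      case True
      then have "e i \<in> I" using e by (auto simp: bij_betw_def)
      have "continuous_on UNIV (\<lambda>(x::nat\<Rightarrow>real) k. x (?g k))"
        by (intro continuous_on_coordinatewise_then_product continuous_on_product_coordinates)
      then show ?thesis
        using True continuous_on_compose2[OF cont[OF \<open>e i \<in> I\<close>]] by (simp add: F'_def)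
    qed (simp add: F'_def)
    fix x :: "nat \<Rightarrow> real" assume x: "(\<Sum>i<card I. (x i)\<^sup>2) = R\<^sup>2"
    have "(\<Sum>i\<in>I. (x (?g i))\<^sup>2) = R\<^sup>2"
      using x by (simp add: sum_e ge)
    from acute[OF this] show "0 < (\<Sum>i<card I. F' x i * x i)"
      by (simp add: sum_e ge F'_def)
  qed
  then obtain x where x: "(\<Sum>i<card I. (x i)\<^sup>2) \<le> R\<^sup>2" "\<And>i. i < card I \<Longrightarrow> F' x i = 0"
    by blast
  show ?thesis
  proof (intro exI[of _ "\<lambda>k. x (?g k)"] conjI ballI)
    show "(\<Sum>i\<in>I. (x (?g i))\<^sup>2) \<le> R\<^sup>2"
      using x by (simp add: sum_e ge)
    fix i assume "i \<in> I"
    then obtain j where "j < card I" "i = e j"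
      using e by (auto simp: bij_betw_def)
    then show "F (\<lambda>k. x (?g k)) i = 0"
      using x(2)[of j] by (simp add: F'_def)
  qed
qed

subsection \<open>Sobolev weights and convolutions on the integer lattice\<close>

definition weight :: "int^'n::finite \<Rightarrow> real" where
  "weight \<xi> = 1 + (norm (lattice_vec \<xi>))\<^sup>2"

lemma weight_ge_1: "1 \<le> weight \<xi>"
  by (simp add: weight_def)

lemma weight_pos [simp]: "0 < weight \<xi>" "weight \<xi> \<noteq> 0" "0 \<le> weight \<xi>"
  using weight_ge_1[of \<xi>] by linarith+

lemma norm_lattice_vec_power2: "(norm (lattice_vec \<xi>))\<^sup>2 = (\<Sum>i\<in>UNIV. (real_of_int (\<xi> $ i))\<^sup>2)"
  by (simp add: norm_vec_def L2_set_def lattice_vec_def sum_nonneg)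

lemma lattice_vec_minus [simp]: "lattice_vec (- \<xi>) = - lattice_vec \<xi>"
  and lattice_vec_add: "lattice_vec (\<xi> + \<eta>) = lattice_vec \<xi> + lattice_vec \<eta>"
  and lattice_vec_diff: "lattice_vec (\<xi> - \<eta>) = lattice_vec \<xi> - lattice_vec \<eta>"
  and lattice_vec_0 [simp]: "lattice_vec 0 = 0"
  by (auto simp: lattice_vec_def vec_eq_iff)

text \<open>The spectral gap of the torus. It plays the part of the Poincare inequality: for
  mean-free fields the gradient norm controls the full \<open>H\<^sup>1\<close> norm.\<close>

lemma norm_lattice_vec_ge_1:
  assumes "\<xi> \<noteq> 0"
  shows "1 \<le> norm (lattice_vec \<xi>)"
proof -
  obtain i where "\<xi> $ i \<noteq> 0" using assms by (auto simp: vec_eq_iff)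
  then have "1 \<le> \<bar>lattice_vec \<xi> $ i\<bar>" by (simp add: lattice_vec_def)
  also have "\<dots> \<le> norm (lattice_vec \<xi>)" by (rule component_le_norm_cart)
  finally show ?thesis .
qed

lemma weight_le_2_norm: "\<xi> \<noteq> 0 \<Longrightarrow> weight \<xi> \<le> 2 * (norm (lattice_vec \<xi>))\<^sup>2"
  using norm_lattice_vec_ge_1[of \<xi>] by (simp add: weight_def)

definition box_freqs :: "nat \<Rightarrow> (int^'n::finite) set" where
  "box_freqs N = {\<xi>. \<forall>i. \<bar>\<xi> $ i\<bar> \<le> int N}"

lemma finite_box_freqs: "finite (box_freqs N)"
proof (rule finite_subset)
  show "box_freqs N \<subseteq> vec_lambda ` (Pi\<^sub>E UNIV (\<lambda>_. {- int N..int N}))"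
  proof
    fix \<xi> :: "int^'n" assume "\<xi> \<in> box_freqs N"
    then have "\<xi> = vec_lambda (vec_nth \<xi>)" "vec_nth \<xi> \<in> Pi\<^sub>E UNIV (\<lambda>_. {- int N..int N})"
      by (auto simp: box_freqs_def abs_le_iff minus_le_iff)
    then show "\<xi> \<in> vec_lambda ` (Pi\<^sub>E UNIV (\<lambda>_. {- int N..int N}))" by blast
  qed
qed (auto intro!: finite_imageI finite_PiE)

lemma box_freqs_mono: "N \<le> M \<Longrightarrow> box_freqs N \<subseteq> box_freqs M"
proof
  fix \<xi> :: "int^'a" assume "N \<le> M" "\<xi> \<in> box_freqs N"
  then have "\<bar>\<xi> $ i\<bar> \<le> int N" "int N \<le> int M" for i by (simp_all add: box_freqs_def)
  then have "\<bar>\<xi> $ i\<bar> \<le> int M" for i by (rule order_trans)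
  then show "\<xi> \<in> box_freqs M" by (simp add: box_freqs_def)
qed

lemma not_in_box_freqs_norm: "\<xi> \<notin> box_freqs N \<Longrightarrow> real N \<le> norm (lattice_vec \<xi>)"
proof -
  assume "\<xi> \<notin> box_freqs N"
  then obtain i where "int N < \<bar>\<xi> $ i\<bar>" by (auto simp: box_freqs_def not_le)
  then have "real N \<le> \<bar>lattice_vec \<xi> $ i\<bar>" by (simp add: lattice_vec_def)
  also have "\<dots> \<le> norm (lattice_vec \<xi>)" by (rule component_le_norm_cart)
  finally show ?thesis .
qed

lemma uminus_box_freqs: "\<xi> \<in> box_freqs N \<Longrightarrow> - \<xi> \<in> box_freqs N"
  by (simp add: box_freqs_def)

lemma eventually_in_box_freqs: "eventually (\<lambda>N. \<xi> \<in> box_freqs N) sequentially"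
proof -
  define M where "M = (\<Sum>i\<in>UNIV. nat \<bar>\<xi> $ i\<bar>)"
  have M: "\<bar>\<xi> $ i\<bar> \<le> int M" for i
    using member_le_sum[of i UNIV "\<lambda>i. \<bar>\<xi> $ i\<bar>"] by (simp add: M_def)
  show ?thesis
    using M by (intro eventually_sequentiallyI[of M]) (force simp: box_freqs_def intro: order_trans)
qed

lemma norm_lattice_vec_le_weight: "norm (lattice_vec \<xi>) \<le> weight \<xi> powr (1/2)"
  by (simp add: powr_half_sqrt weight_def real_le_rsqrt)

lemma weight_triangle: "weight (\<xi> + \<eta>) \<le> 2 * (weight \<xi> + weight \<eta>)"
proof -
  have "(norm (lattice_vec (\<xi> + \<eta>)))\<^sup>2 \<le> (norm (lattice_vec \<xi>) + norm (lattice_vec \<eta>))\<^sup>2"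
    unfolding lattice_vec_add by (intro power_mono norm_triangle_ineq) simp
  also have "\<dots> \<le> 2 * ((norm (lattice_vec \<xi>))\<^sup>2 + (norm (lattice_vec \<eta>))\<^sup>2)"
    by (smt (verit) sum_squares_bound power2_sum)
  finally show ?thesis by (simp add: weight_def)
qed

lemma summable_on_int_powr:
  assumes "q > 1/2"
  shows "(\<lambda>m::int. (1 + (real_of_int m)\<^sup>2) powr - q) summable_on UNIV"
proof -
  let ?f = "\<lambda>m::int. (1 + (real_of_int m)\<^sup>2) powr - q"
  have nat: "(\<lambda>n::nat. (1 + (real n)\<^sup>2) powr - q) summable_on UNIV"
  proof -
    have "summable (\<lambda>n::nat. (1 + (real n)\<^sup>2) powr - q)"
    proof (rule summable_comparison_test')
      show "summable (\<lambda>n::nat. real n powr (- 2 * q))"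
        using assms by (subst summable_real_powr_iff) auto
      fix n :: nat assume n: "n \<ge> 1"
      have "(1 + (real n)\<^sup>2) powr - q \<le> ((real n)\<^sup>2) powr - q"
        using assms n by (intro powr_mono2') auto
      also have "\<dots> = real n powr (- 2 * q)"
        using n by (simp add: powr_powr flip: powr_numeral)
      finally show "norm ((1 + (real n)\<^sup>2) powr - q) \<le> real n powr (- 2 * q)"
        by simp
    qed
    then show ?thesis by (subst summable_on_UNIV_nonneg_real_iff) auto
  qed
  have 1: "?f summable_on range int"
    using nat by (subst summable_on_reindex) (auto simp: o_def)
  have 2: "?f summable_on range (\<lambda>n. - int n)"
    using nat by (subst summable_on_reindex) (auto simp: o_def inj_on_def)
  have "range int \<union> range (\<lambda>n. - int n) = UNIV"
  proof -
    have "m \<in> range int \<union> range (\<lambda>n. - int n)" for m :: int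
      by (cases "m \<ge> 0") (metis UnI1 rangeI int_nat_eq, metis UnI2 rangeI add.inverse_inverse int_nat_eq linorder_not_le neg_0_less_iff_less order_less_imp_le)
    then show ?thesis by blast
  qed
  then show ?thesis
    using summable_on_union[OF 1 2] by simp
qed

text \<open>\<open>weight \<xi>\<close> dominates every \<open>1 + \<xi>\<^sub>i\<^sup>2\<close>.
  Splitting the power into \<open>n\<close> equal factors of exponent \<open>r / n > 1/2\<close>
  bounds it by a product of one-dimensional terms, whose sum is a power of a convergent
  series.\<close>

lemma summable_on_weight:
  assumes "r > real CARD('n::finite) / 2"
  shows "(\<lambda>\<xi>::int^'n. weight \<xi> powr - r) summable_on UNIV"
proof -
  define q where "q = r / real CARD('n)"
  have q: "q > 1/2" using assms by (simp add: q_def field_simps)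
  let ?f = "\<lambda>m::int. (1 + (real_of_int m)\<^sup>2) powr - q"
  define S where "S = infsum ?f UNIV"
  have "S > 0"
  proof -
    have "sum ?f {0} \<le> S"
      unfolding S_def using summable_on_int_powr[OF q] by (intro finite_sum_le_infsum) auto
    then show ?thesis by simp
  qed
  have "infsum (\<lambda>g. \<Prod>i\<in>UNIV. ?f (g i)) (Pi\<^sub>E (UNIV::'n set) (\<lambda>_. UNIV)) = (\<Prod>i\<in>(UNIV::'n set). S)"
    unfolding S_def using summable_on_int_powr[OF q]
    by (intro infsum_prod_PiE_abs) auto
  \<comment> \<open>An \<open>infsum\<close> over a family that is not summable is 0 by default, so
    a positive value proves summability.\<close>
  then have "infsum (\<lambda>g. \<Prod>i\<in>(UNIV::'n set). ?f (g i)) UNIV > 0"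
    using \<open>S > 0\<close> by (simp add: PiE_UNIV_domain)
  then have "(\<lambda>g. \<Prod>i\<in>(UNIV::'n set). ?f (g i)) summable_on UNIV"
    using infsum_not_exists by fastforce
  then have prod: "(\<lambda>\<xi>::int^'n. \<Prod>i\<in>UNIV. ?f (\<xi> $ i)) summable_on UNIV"
  proof (subst (asm) summable_on_reindex_bij_betw[symmetric])
    show "bij_betw vec_nth (UNIV :: (int^'n) set) UNIV"
      by (rule bij_betwI[of _ _ _ vec_lambda]) auto
  qed
  show ?thesis
  proof (rule summable_on_comparison_test[OF prod])
    fix \<xi> :: "int^'n"
    have "weight \<xi> powr - r = (\<Prod>i\<in>(UNIV::'n set). weight \<xi> powr - q)"
      by (simp add: q_def powr_power)
    also have "\<dots> \<le> (\<Prod>i\<in>(UNIV::'n set). ?f (\<xi> $ i))"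
    proof (intro prod_mono conjI powr_mono2')
      fix i
      show "1 + (real_of_int (\<xi> $ i))\<^sup>2 \<le> weight \<xi>"
        unfolding weight_def norm_lattice_vec_power2
        by (intro add_left_mono member_le_sum) auto
    qed (use q in \<open>auto intro: add_pos_nonneg\<close>)
    finally show "weight \<xi> powr - r \<le> (\<Prod>i\<in>UNIV. ?f (\<xi> $ i))" .
  qed simp
qed

section \<open>Weighted square-summable coefficient families\<close>

definition sobolev :: "real \<Rightarrow> (int^'n::finite \<Rightarrow> 'b::real_normed_vector) \<Rightarrow> bool" where
  "sobolev s c \<longleftrightarrow> (\<lambda>\<xi>. weight \<xi> powr s * (norm (c \<xi>))\<^sup>2) summable_on UNIV"

lemma sobolev_dominated:
  assumes "sobolev s d" "\<And>\<xi>. weight \<xi> powr t * (norm (c \<xi>))\<^sup>2 \<le> K * (weight \<xi> powr s * (norm (d \<xi>))\<^sup>2)"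
  shows "sobolev t c"
  unfolding sobolev_def
  by (rule summable_on_comparison_test[OF summable_on_cmult_right[OF assms(1)[unfolded sobolev_def]]])
     (use assms(2) in auto)

lemma sobolev_mono:
  assumes "sobolev s c" "t \<le> s"
  shows "sobolev t c"
  by (rule sobolev_dominated[OF assms(1), of _ _ 1])
     (use assms(2) weight_ge_1 in \<open>auto intro!: mult_right_mono powr_mono\<close>)

lemma sobolev_add:
  assumes "sobolev s c" "sobolev s d"
  shows "sobolev s (\<lambda>\<xi>. c \<xi> + d \<xi>)"
  unfolding sobolev_def
proof (rule summable_on_comparison_test)
  show "(\<lambda>\<xi>. 2 * (weight \<xi> powr s * (norm (c \<xi>))\<^sup>2) + 2 * (weight \<xi> powr s * (norm (d \<xi>))\<^sup>2)) summable_on UNIV"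
    using assms unfolding sobolev_def by (intro summable_on_add summable_on_cmult_right)
  fix \<xi>
  have "(norm (c \<xi> + d \<xi>))\<^sup>2 \<le> (norm (c \<xi>) + norm (d \<xi>))\<^sup>2"
    by (intro power_mono norm_triangle_ineq) simp
  also have "\<dots> \<le> 2 * (norm (c \<xi>))\<^sup>2 + 2 * (norm (d \<xi>))\<^sup>2"
    by (smt (verit) sum_squares_bound power2_sum)
  finally have "weight \<xi> powr s * (norm (c \<xi> + d \<xi>))\<^sup>2
      \<le> weight \<xi> powr s * (2 * (norm (c \<xi>))\<^sup>2 + 2 * (norm (d \<xi>))\<^sup>2)"
    by (intro mult_left_mono) auto
  then show "weight \<xi> powr s * (norm (c \<xi> + d \<xi>))\<^sup>2 \<le> 2 * (weight \<xi> powr s * (norm (c \<xi>))\<^sup>2) + 2 * (weight \<xi> powr s * (norm (d \<xi>))\<^sup>2)"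
    by (simp add: algebra_simps)
qed simp

lemma sobolev_sum:
  assumes "finite I" "\<And>i. i \<in> I \<Longrightarrow> sobolev s (c i)"
  shows "sobolev s (\<lambda>\<xi>. \<Sum>i\<in>I. c i \<xi>)"
  using assms by (induction I rule: finite_induct) (auto intro: sobolev_add simp: sobolev_def[of _ "\<lambda>_. 0"])

text \<open>\<open>weight\<close> is quadratic in the frequency, so the multiplier
  \<open>weight \<xi> powr a\<close> has order \<open>2 * a\<close>.\<close>

lemma sobolev_weight_mult:
  fixes c :: "int^'n::finite \<Rightarrow> 'b::real_normed_vector"
  assumes "sobolev s c" "t = s - 2 * a"
  shows "sobolev t (\<lambda>\<xi>. weight \<xi> powr a * norm (c \<xi>))"
proof (rule sobolev_dominated[OF assms(1), of _ _ 1])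
  fix \<xi> :: "int^'n"
  show "weight \<xi> powr t * (norm (weight \<xi> powr a * norm (c \<xi>)))\<^sup>2 \<le> 1 * (weight \<xi> powr s * (norm (c \<xi>))\<^sup>2)"
    by (simp add: assms(2) power_mult_distrib powr_power powr_diff)
qed

lemma sobolev_bound:
  fixes c :: "int^'n::finite \<Rightarrow> 'b::real_normed_vector" and D :: "int^'n \<Rightarrow> real"
  assumes "sobolev s D" "\<And>\<xi>. norm (c \<xi>) \<le> K * D \<xi>"
  shows "sobolev s c"
proof (rule sobolev_dominated[OF assms(1), where K="K\<^sup>2"])
  fix \<xi>
  have "(norm (c \<xi>))\<^sup>2 \<le> (K * D \<xi>)\<^sup>2"
    by (intro power_mono assms) simp
  then have "weight \<xi> powr s * (norm (c \<xi>))\<^sup>2 \<le> weight \<xi> powr s * (K * D \<xi>)\<^sup>2"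
    by (rule mult_left_mono) simp
  then show "weight \<xi> powr s * (norm (c \<xi>))\<^sup>2 \<le> K\<^sup>2 * (weight \<xi> powr s * (norm (D \<xi>))\<^sup>2)"
    by (simp add: power_mult_distrib mult_ac)
qed

lemma has_sum_sum:
  fixes f :: "'a \<Rightarrow> 'i \<Rightarrow> 'b::topological_comm_monoid_add"
  assumes "finite A" "\<And>a. a \<in> A \<Longrightarrow> (f a has_sum S a) I"
  shows "((\<lambda>i. \<Sum>a\<in>A. f a i) has_sum (\<Sum>a\<in>A. S a)) I"
  using assms by (induction A rule: finite_induct) (auto intro: has_sum_add)

section \<open>Convolution estimates\<close>

text \<open>Tonelli for the product family, transported by the shear that takes
  \<open>(\<xi>, \<eta>)\<close> to \<open>(\<eta>, \<xi> - \<eta>)\<close>.\<close>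

lemma summable_on_convolution:
  fixes G K :: "int^'n::finite \<Rightarrow> real"
  assumes "G summable_on UNIV" "K summable_on UNIV" "\<And>\<xi>. 0 \<le> G \<xi>" "\<And>\<xi>. 0 \<le> K \<xi>"
  shows "(\<lambda>\<eta>. G \<eta> * K (\<xi> - \<eta>)) summable_on UNIV"
    and "(\<lambda>\<xi>. \<Sum>\<^sub>\<infinity>\<eta>. G \<eta> * K (\<xi> - \<eta>)) summable_on UNIV"
proof -
  have "(\<lambda>(\<eta>, \<zeta>). G \<eta> * K \<zeta>) summable_on UNIV \<times> UNIV"
    by (rule summable_on_SigmaI[where g="\<lambda>\<eta>. G \<eta> * infsum K UNIV"])
       (use assms in \<open>auto intro!: has_sum_cmult_right summable_on_cmult_left\<close>)
  then have "(\<lambda>(\<eta>, \<zeta>). G \<eta> * K \<zeta>) summable_on UNIV"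
    by simp
  moreover have "bij_betw (\<lambda>(\<xi>, \<eta>). (\<eta>, \<xi> - \<eta>)) (UNIV :: ((int^'n) \<times> (int^'n)) set) UNIV"
    by (rule bij_betwI[of _ _ _ "\<lambda>(\<eta>, \<zeta>). (\<eta> + \<zeta>, \<eta>)"]) auto
  ultimately have "(\<lambda>z. (\<lambda>(\<eta>, \<zeta>). G \<eta> * K \<zeta>) ((\<lambda>(\<xi>, \<eta>). (\<eta>, \<xi> - \<eta>)) z)) summable_on UNIV"
    using summable_on_reindex_bij_betw by blast
  then have *: "(\<lambda>(\<xi>, \<eta>). G \<eta> * K (\<xi> - \<eta>)) summable_on UNIV \<times> UNIV"
    by (simp add: case_prod_unfold)
  show "(\<lambda>\<xi>. \<Sum>\<^sub>\<infinity>\<eta>. G \<eta> * K (\<xi> - \<eta>)) summable_on UNIV"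
    using summable_on_Sigma_banach[OF *] by simp
  show "(\<lambda>\<eta>. G \<eta> * K (\<xi> - \<eta>)) summable_on UNIV"
    using summable_on_SigmaD1[OF *, of \<xi>] by simp
qed

definition abs_conv :: "(int^'n::finite \<Rightarrow> 'b::real_normed_vector) \<Rightarrow> (int^'n \<Rightarrow> 'c::real_normed_vector) \<Rightarrow> int^'n \<Rightarrow> real" where
  "abs_conv g h \<xi> = (\<Sum>\<^sub>\<infinity>\<eta>. norm (g \<eta>) * norm (h (\<xi> - \<eta>)))"

lemma abs_conv_nonneg: "0 \<le> abs_conv g h \<xi>"
  unfolding abs_conv_def by (intro infsum_nonneg) auto

text \<open>Cauchy--Schwarz against the weight \<open>weight \<eta> powr - a * weight (\<xi> - \<eta>) powr - b\<close>, whose sum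
  over \<open>\<eta>\<close> is bounded uniformly in \<open>\<xi>\<close> because the smaller of the two weights dominates.\<close>
lemma sobolev_convolution_0:
  fixes g :: "int^'n::finite \<Rightarrow> 'b::real_normed_vector" and h :: "int^'n \<Rightarrow> 'c::real_normed_vector"
  assumes g: "sobolev a g" and h: "sobolev b h"
    and "0 \<le> a" "0 \<le> b" "real CARD('n) / 2 < a + b"
  shows "(\<lambda>\<eta>. norm (g \<eta>) * norm (h (\<xi> - \<eta>))) summable_on UNIV" and "sobolev 0 (abs_conv g h)"
proof -
  define S where "S = (\<Sum>\<^sub>\<infinity>\<xi>::int^'n. weight \<xi> powr - (a + b))"
  note sW = summable_on_weight[OF assms(5)]
  define G where "G = (\<lambda>\<xi>. weight \<xi> powr a * (norm (g \<xi>))\<^sup>2)"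
  define K where "K = (\<lambda>\<xi>. weight \<xi> powr b * (norm (h \<xi>))\<^sup>2)"
  define T where "T = (\<lambda>\<xi>. \<Sum>\<^sub>\<infinity>\<eta>. G \<eta> * K (\<xi> - \<eta>))"
  have GK: "G summable_on UNIV" "K summable_on UNIV" "\<And>\<xi>. 0 \<le> G \<xi>" "\<And>\<xi>. 0 \<le> K \<xi>"
    using g h by (auto simp: sobolev_def G_def K_def)
  note T1 = summable_on_convolution(1)[OF GK] and T2 = summable_on_convolution(2)[OF GK, folded T_def]
  have S0: "S \<ge> 0" unfolding S_def by (intro infsum_nonneg) auto
  have T0: "T \<xi> \<ge> 0" for \<xi> unfolding T_def by (intro infsum_nonneg) (simp add: GK)
  have min_weight: "weight \<eta> powr - a * weight \<zeta> powr - b \<le> weight \<eta> powr - (a + b) + weight \<zeta> powr - (a + b)"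
    for \<eta> \<zeta> :: "int^'n"
  proof (cases "weight \<eta> \<le> weight \<zeta>")
    case True
    then have "weight \<zeta> powr - b \<le> weight \<eta> powr - b"
      using assms by (intro powr_mono2') auto
    then have "weight \<eta> powr - a * weight \<zeta> powr - b \<le> weight \<eta> powr - a * weight \<eta> powr - b"
      by (intro mult_left_mono) auto
    then show ?thesis by (simp add: add_increasing2 flip: powr_add)
  next
    case False
    then have "weight \<eta> powr - a \<le> weight \<zeta> powr - a"
      using assms by (intro powr_mono2') auto
    then have "weight \<eta> powr - a * weight \<zeta> powr - b \<le> weight \<zeta> powr - a * weight \<zeta> powr - b"
      by (intro mult_right_mono) auto
    then show ?thesis by (simp add: add_increasing flip: powr_add)
  qed
  \<comment> \<open>A bound on all finite partial sums yields both the summability of the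
    convolution and the bound on its value. The factor 2 counts the two terms of
    \<open>min_weight\<close>, each summing to at most \<open>S\<close>.\<close>
  have fin: "(\<Sum>\<eta>\<in>F. norm (g \<eta>) * norm (h (\<xi> - \<eta>))) \<le> sqrt (2 * S * T \<xi>)" if F: "finite F" for F \<xi>
  proof -
    have "(\<Sum>\<eta>\<in>F. norm (g \<eta>) * norm (h (\<xi> - \<eta>)))
      = (\<Sum>\<eta>\<in>F. sqrt (weight \<eta> powr - a * weight (\<xi> - \<eta>) powr - b) * sqrt (G \<eta> * K (\<xi> - \<eta>)))"
      by (intro sum.cong refl) (simp add: G_def K_def powr_minus divide_simps flip: real_sqrt_mult; simp add: real_sqrt_mult)
    also have "\<dots> \<le> sqrt ((\<Sum>\<eta>\<in>F. (sqrt (weight \<eta> powr - a * weight (\<xi> - \<eta>) powr - b))\<^sup>2) * (\<Sum>\<eta>\<in>F. (sqrt (G \<eta> * K (\<xi> - \<eta>)))\<^sup>2))"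
      by (rule real_le_rsqrt, rule Cauchy_Schwarz_ineq_sum)
    also have "\<dots> = sqrt ((\<Sum>\<eta>\<in>F. weight \<eta> powr - a * weight (\<xi> - \<eta>) powr - b) * (\<Sum>\<eta>\<in>F. G \<eta> * K (\<xi> - \<eta>)))"
      by (simp add: GK)
    also have "\<dots> \<le> sqrt (2 * S * T \<xi>)"
    proof (intro real_sqrt_le_mono mult_mono sum_nonneg)
      have "(\<Sum>\<eta>\<in>F. weight \<eta> powr - a * weight (\<xi> - \<eta>) powr - b)
        \<le> (\<Sum>\<eta>\<in>F. weight \<eta> powr - (a + b)) + (\<Sum>\<eta>\<in>F. weight (\<xi> - \<eta>) powr - (a + b))"
        unfolding sum.distrib[symmetric] by (intro sum_mono min_weight)
      also have "(\<Sum>\<eta>\<in>F. weight (\<xi> - \<eta>) powr - (a + b)) = (\<Sum>\<eta>\<in>(\<lambda>\<eta>. \<xi> - \<eta>) ` F. weight \<eta> powr - (a + b))"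
        by (subst sum.reindex) (auto simp: inj_on_def)
      also have "(\<Sum>\<eta>\<in>F. weight \<eta> powr - (a + b)) + \<dots> \<le> S + S"
        unfolding S_def using sW F by (intro add_mono finite_sum_le_infsum) auto
      finally show "(\<Sum>\<eta>\<in>F. weight \<eta> powr - a * weight (\<xi> - \<eta>) powr - b) \<le> 2 * S"
        by simp
      show "(\<Sum>\<eta>\<in>F. G \<eta> * K (\<xi> - \<eta>)) \<le> T \<xi>"
        unfolding T_def using T1 F by (intro finite_sum_le_infsum) (auto simp: GK)
    qed (use S0 GK in auto)
    finally show ?thesis .
  qed
  show sm: "(\<lambda>\<eta>. norm (g \<eta>) * norm (h (\<xi> - \<eta>))) summable_on UNIV" for \<xi>
    by (rule nonneg_bdd_above_summable_on) (auto intro!: bdd_aboveI[of _ "sqrt (2 * S * T \<xi>)"] fin)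
  have le: "abs_conv g h \<xi> \<le> sqrt (2 * S * T \<xi>)" for \<xi>
    unfolding abs_conv_def by (rule infsum_le_finite_sums[OF sm fin])
  show "sobolev 0 (abs_conv g h)"
    unfolding sobolev_def
  proof (rule summable_on_comparison_test[OF summable_on_cmult_right[OF T2, of "2 * S"]])
    fix \<xi>
    show "weight \<xi> powr 0 * (norm (abs_conv g h \<xi>))\<^sup>2 \<le> 2 * S * T \<xi>"
      using sqrt_ge_absD[of "abs_conv g h \<xi>"] le[of \<xi>] abs_conv_nonneg[of g h \<xi>] by simp
  qed simp
qed

text \<open>A fractional Leibniz rule: \<open>weight \<xi> powr (t / 2)\<close> is bounded by the
  sum of the same powers at \<open>\<eta>\<close> and \<open>\<xi> - \<eta>\<close>, so the
  \<open>t\<close> derivatives fall on one factor at a time. What remains is an order 0 estimate for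
  families of orders \<open>\<sigma> - t\<close> and \<open>\<sigma>\<close>, whence the condition
  on \<open>2 * \<sigma> - t\<close>.\<close>

lemma sobolev_convolution:
  fixes g :: "int^'n::finite \<Rightarrow> 'b::real_normed_vector" and h :: "int^'n \<Rightarrow> 'c::real_normed_vector"
  assumes g: "sobolev \<sigma> g" and h: "sobolev \<sigma> h"
    and t: "0 \<le> t" "t \<le> \<sigma>" "real CARD('n) / 2 < 2 * \<sigma> - t"
  shows "sobolev t (abs_conv g h)"
proof -
  define g' where "g' = (\<lambda>\<xi>. weight \<xi> powr (t / 2) * norm (g \<xi>))"
  define h' where "h' = (\<lambda>\<xi>. weight \<xi> powr (t / 2) * norm (h \<xi>))"
  have g': "sobolev (\<sigma> - t) g'" and h': "sobolev (\<sigma> - t) h'"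
    unfolding g'_def h'_def by (rule sobolev_weight_mult[OF g] sobolev_weight_mult[OF h]; simp)+
  have 1: "(\<lambda>\<eta>. norm (g' \<eta>) * norm (h (\<xi> - \<eta>))) summable_on UNIV" "sobolev 0 (abs_conv g' h)" for \<xi>
    using sobolev_convolution_0[OF g' h] t by auto
  have 2: "(\<lambda>\<eta>. norm (g \<eta>) * norm (h' (\<xi> - \<eta>))) summable_on UNIV" "sobolev 0 (abs_conv g h')" for \<xi>
    using sobolev_convolution_0[OF g h'] t by auto
  have 3: "(\<lambda>\<eta>. norm (g \<eta>) * norm (h (\<xi> - \<eta>))) summable_on UNIV" for \<xi>
    using sobolev_convolution_0(1)[OF g h] t by auto
  \<comment> \<open>The 4 comes from \<open>weight_triangle\<close>: twice a sum of two weights is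
    at most four times the larger one.\<close>
  define C where "C = (4::real) powr (t / 2)"
  have sub: "weight \<xi> powr (t / 2) \<le> C * (weight \<eta> powr (t / 2) + weight (\<xi> - \<eta>) powr (t / 2))" for \<xi> \<eta> :: "int^'n"
  proof -
    have "weight \<xi> \<le> 4 * max (weight \<eta>) (weight (\<xi> - \<eta>))"
      using weight_triangle[of \<eta> "\<xi> - \<eta>"] by (simp add: max_def split: if_splits)
    then have "weight \<xi> powr (t / 2) \<le> (4 * max (weight \<eta>) (weight (\<xi> - \<eta>))) powr (t / 2)"
      using t by (intro powr_mono2) auto
    also have "\<dots> = C * max (weight \<eta>) (weight (\<xi> - \<eta>)) powr (t / 2)"
      by (simp add: C_def powr_mult max_def)
    also have "\<dots> \<le> C * (weight \<eta> powr (t / 2) + weight (\<xi> - \<eta>) powr (t / 2))"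
      by (intro mult_left_mono) (auto simp: max_def C_def)
    finally show ?thesis .
  qed
  have le: "weight \<xi> powr (t / 2) * abs_conv g h \<xi> \<le> C * (abs_conv g' h \<xi> + abs_conv g h' \<xi>)" for \<xi>
  proof -
    have "weight \<xi> powr (t / 2) * abs_conv g h \<xi> = (\<Sum>\<^sub>\<infinity>\<eta>. weight \<xi> powr (t / 2) * (norm (g \<eta>) * norm (h (\<xi> - \<eta>))))"
      unfolding abs_conv_def by (rule infsum_cmult_right'[symmetric])
    also have "\<dots> \<le> (\<Sum>\<^sub>\<infinity>\<eta>. C * (norm (g' \<eta>) * norm (h (\<xi> - \<eta>)) + norm (g \<eta>) * norm (h' (\<xi> - \<eta>))))"
    proof (rule infsum_mono)
      fix \<eta>
      have "weight \<xi> powr (t / 2) * (norm (g \<eta>) * norm (h (\<xi> - \<eta>))) \<le>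
        (C * (weight \<eta> powr (t / 2) + weight (\<xi> - \<eta>) powr (t / 2))) * (norm (g \<eta>) * norm (h (\<xi> - \<eta>)))"
        by (intro mult_right_mono sub) auto
      then show "weight \<xi> powr (t / 2) * (norm (g \<eta>) * norm (h (\<xi> - \<eta>)))
        \<le> C * (norm (g' \<eta>) * norm (h (\<xi> - \<eta>)) + norm (g \<eta>) * norm (h' (\<xi> - \<eta>)))"
        by (simp add: g'_def h'_def algebra_simps)
    qed (intro summable_on_cmult_right summable_on_add 1 2 3)+
    also have "\<dots> = C * (abs_conv g' h \<xi> + abs_conv g h' \<xi>)"
      unfolding abs_conv_def infsum_cmult_right' infsum_add[OF 1(1) 2(1)] ..
    finally show ?thesis .
  qed
  show ?thesis
  proof (rule sobolev_dominated[OF sobolev_add[OF 1(2) 2(2)], where K="C\<^sup>2"])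
    fix \<xi>
    have "(weight \<xi> powr (t / 2) * abs_conv g h \<xi>)\<^sup>2 \<le> (C * (abs_conv g' h \<xi> + abs_conv g h' \<xi>))\<^sup>2"
      by (intro power_mono le) (auto simp: abs_conv_nonneg)
    then show "weight \<xi> powr t * (norm (abs_conv g h \<xi>))\<^sup>2
         \<le> C\<^sup>2 * (weight \<xi> powr 0 * (norm (abs_conv g' h \<xi> + abs_conv g h' \<xi>))\<^sup>2)"
      by (simp add: power_mult_distrib powr_power)
  qed
qed

subsection \<open>The Navier--Stokes system for Fourier coefficients\<close>

text \<open>Up to the factor \<open>4 * pi\<^sup>2\<close> this is the Fourier symbol of minus the
  elliptic operator, written with the full gradient; the symmetries of \<open>A\<close> make this
  agree with the strain form.\<close>

definition symbol :: "'n::finite tensor4 \<Rightarrow> 'n \<Rightarrow> 'n \<Rightarrow> int^'n \<Rightarrow> real" where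
  "symbol A k j \<xi> = (\<Sum>\<alpha>\<in>UNIV. \<Sum>\<beta>\<in>UNIV. A k j \<alpha> \<beta> * lattice_vec \<xi> $ \<alpha> * lattice_vec \<xi> $ \<beta>)"

lemma elliptic_symbol_real:
  fixes A :: "'n::finite tensor4"
  assumes "tensor_symmetric A" "relaxed_elliptic A"
  obtains c where "c > 0"
    "\<And>\<xi> (v::'n \<Rightarrow> real). (\<Sum>k\<in>UNIV. lattice_vec \<xi> $ k * v k) = 0 \<Longrightarrow>
      c * ((norm (lattice_vec \<xi>))\<^sup>2 * (\<Sum>k\<in>UNIV. (v k)\<^sup>2)) \<le> (\<Sum>k\<in>UNIV. \<Sum>j\<in>UNIV. symbol A k j \<xi> * v k * v j)"
proof -
  obtain C where C: "C > 0" and ell: "\<And>\<zeta>::real^'n^'n. transpose \<zeta> = \<zeta> \<Longrightarrow> trace \<zeta> = 0 \<Longrightarrow>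
        (\<Sum>k\<in>UNIV. \<Sum>\<alpha>\<in>UNIV. \<zeta> $ k $ \<alpha> * \<zeta> $ k $ \<alpha>) \<le>
        C * (\<Sum>k\<in>UNIV. \<Sum>j\<in>UNIV. \<Sum>\<alpha>\<in>UNIV. \<Sum>\<beta>\<in>UNIV. A k j \<alpha> \<beta> * \<zeta> $ k $ \<alpha> * \<zeta> $ j $ \<beta>)"
    using assms(2) unfolding relaxed_elliptic_def by blast
  have sym1: "A k j \<alpha> \<beta> = A \<alpha> j k \<beta>" and sym2: "A k j \<alpha> \<beta> = A k \<beta> \<alpha> j" for k j \<alpha> \<beta>
    using assms(1) unfolding tensor_symmetric_def by blast+
  show ?thesis
  proof
    \<comment> \<open>The 2 is the loss from symmetrization: the symmetric part of the rank-one
      matrix has half its squared norm when \<open>v\<close> is orthogonal to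
      \<open>\<xi>\<close>.\<close>
    show "1 / (2 * C) > 0" using C by simp
    fix \<xi> :: "int^'n" and v :: "'n \<Rightarrow> real"
    let ?L = "lattice_vec \<xi>"
    assume div: "(\<Sum>k\<in>UNIV. ?L $ k * v k) = 0"
    define Z where "Z = (\<lambda>k \<alpha>. (?L $ \<alpha> * v k + ?L $ k * v \<alpha>) / 2)"
    define \<zeta> :: "real^'n^'n" where "\<zeta> = (\<chi> k \<alpha>. Z k \<alpha>)"
    have 1: "transpose \<zeta> = \<zeta>"
      by (simp add: \<zeta>_def Z_def transpose_def vec_eq_iff)
    have 2: "trace \<zeta> = 0"
      using div by (simp add: \<zeta>_def Z_def trace_def mult.commute)
    \<comment> \<open>Expanding the square leaves two equal diagonal parts and a cross term
      proportional to the square of the scalar product of \<open>\<xi>\<close> and \<open>v\<close>,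
      which \<open>div\<close> kills.\<close>
    have sq: "(\<Sum>k\<in>UNIV. \<Sum>\<alpha>\<in>UNIV. Z k \<alpha> * Z k \<alpha>) = (norm ?L)\<^sup>2 * (\<Sum>k\<in>UNIV. (v k)\<^sup>2) / 2"
    proof -
      have "(\<Sum>k\<in>UNIV. \<Sum>\<alpha>\<in>UNIV. Z k \<alpha> * Z k \<alpha>) =
          (\<Sum>k\<in>UNIV. \<Sum>\<alpha>\<in>UNIV. (?L $ \<alpha>)\<^sup>2 * (v k)\<^sup>2 / 4) + (\<Sum>k\<in>UNIV. \<Sum>\<alpha>\<in>UNIV. (?L $ k)\<^sup>2 * (v \<alpha>)\<^sup>2 / 4)
          + (\<Sum>k\<in>UNIV. \<Sum>\<alpha>\<in>UNIV. (?L $ k * v k) * (?L $ \<alpha> * v \<alpha>) / 2)"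
        unfolding sum.distrib[symmetric]
        by (intro sum.cong refl) (simp add: Z_def power2_eq_square field_simps)
      also have "(\<Sum>k\<in>UNIV. \<Sum>\<alpha>\<in>UNIV. (?L $ \<alpha>)\<^sup>2 * (v k)\<^sup>2 / 4) = (\<Sum>k\<in>UNIV. \<Sum>\<alpha>\<in>UNIV. (?L $ k)\<^sup>2 * (v \<alpha>)\<^sup>2 / 4)"
        by (rule sum.swap)
      also have "(\<Sum>k\<in>UNIV. \<Sum>\<alpha>\<in>UNIV. (?L $ k * v k) * (?L $ \<alpha> * v \<alpha>) / 2)
          = (\<Sum>k\<in>UNIV. ?L $ k * v k) * (\<Sum>k\<in>UNIV. ?L $ k * v k) / 2"
        by (simp add: sum_product sum_divide_distrib)
      also have "(\<Sum>k\<in>UNIV. \<Sum>\<alpha>\<in>UNIV. (?L $ k)\<^sup>2 * (v \<alpha>)\<^sup>2 / 4) = (\<Sum>k\<in>UNIV. (?L $ k)\<^sup>2) * (\<Sum>k\<in>UNIV. (v k)\<^sup>2) / 4"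
        by (simp add: sum_product sum_divide_distrib)
      also have "(\<Sum>k\<in>UNIV. (?L $ k)\<^sup>2) = (norm ?L)\<^sup>2"
        by (simp add: norm_vec_def L2_set_def sum_nonneg)
      finally show ?thesis using div by simp
    qed
    \<comment> \<open>Each symmetry of \<open>A\<close> removes one symmetrization: exchanging
      \<open>j\<close> and \<open>\<beta>\<close> undoes it in the right factor, exchanging
      \<open>k\<close> and \<open>\<alpha>\<close> in the left one.\<close>
    have quad: "(\<Sum>k\<in>UNIV. \<Sum>j\<in>UNIV. \<Sum>\<alpha>\<in>UNIV. \<Sum>\<beta>\<in>UNIV. A k j \<alpha> \<beta> * Z k \<alpha> * Z j \<beta>)
      = (\<Sum>k\<in>UNIV. \<Sum>j\<in>UNIV. symbol A k j \<xi> * v k * v j)"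
    proof -
      have right: "(\<Sum>j\<in>UNIV. \<Sum>\<beta>\<in>UNIV. A k j \<alpha> \<beta> * Z j \<beta>) = (\<Sum>j\<in>UNIV. \<Sum>\<beta>\<in>UNIV. A k j \<alpha> \<beta> * (?L $ \<beta> * v j))"
        for k \<alpha>
      proof -
        have "(\<Sum>j\<in>UNIV. \<Sum>\<beta>\<in>UNIV. A k j \<alpha> \<beta> * (?L $ j * v \<beta>)) = (\<Sum>j\<in>UNIV. \<Sum>\<beta>\<in>UNIV. A k j \<alpha> \<beta> * (?L $ \<beta> * v j))"
          by (subst sum.swap) (intro sum.cong refl, metis sym2)
        moreover have "(\<Sum>j\<in>UNIV. \<Sum>\<beta>\<in>UNIV. A k j \<alpha> \<beta> * Z j \<beta>) =
          (\<Sum>j\<in>UNIV. \<Sum>\<beta>\<in>UNIV. A k j \<alpha> \<beta> * (?L $ \<beta> * v j)) / 2 + (\<Sum>j\<in>UNIV. \<Sum>\<beta>\<in>UNIV. A k j \<alpha> \<beta> * (?L $ j * v \<beta>)) / 2"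
          unfolding sum_divide_distrib sum.distrib[symmetric]
          by (intro sum.cong refl) (simp add: Z_def field_simps)
        ultimately show ?thesis by simp
      qed
      define B where "B = (\<lambda>k \<alpha>. \<Sum>j\<in>UNIV. \<Sum>\<beta>\<in>UNIV. A k j \<alpha> \<beta> * (?L $ \<beta> * v j))"
      have Bsym: "B k \<alpha> = B \<alpha> k" for k \<alpha>
        unfolding B_def by (intro sum.cong refl) (metis sym1)
      have "(\<Sum>k\<in>UNIV. \<Sum>j\<in>UNIV. \<Sum>\<alpha>\<in>UNIV. \<Sum>\<beta>\<in>UNIV. A k j \<alpha> \<beta> * Z k \<alpha> * Z j \<beta>)
        = (\<Sum>k\<in>UNIV. \<Sum>\<alpha>\<in>UNIV. \<Sum>j\<in>UNIV. \<Sum>\<beta>\<in>UNIV. A k j \<alpha> \<beta> * Z k \<alpha> * Z j \<beta>)"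
        by (intro sum.cong refl sum.swap)
      also have "\<dots> = (\<Sum>k\<in>UNIV. \<Sum>\<alpha>\<in>UNIV. Z k \<alpha> * (\<Sum>j\<in>UNIV. \<Sum>\<beta>\<in>UNIV. A k j \<alpha> \<beta> * Z j \<beta>))"
        by (simp add: sum_distrib_left mult_ac)
      also have "\<dots> = (\<Sum>k\<in>UNIV. \<Sum>\<alpha>\<in>UNIV. Z k \<alpha> * B k \<alpha>)"
        by (simp add: right B_def)
      also have "\<dots> = (\<Sum>k\<in>UNIV. \<Sum>\<alpha>\<in>UNIV. (?L $ \<alpha> * v k) * B k \<alpha>) / 2 + (\<Sum>k\<in>UNIV. \<Sum>\<alpha>\<in>UNIV. (?L $ k * v \<alpha>) * B k \<alpha>) / 2"
        unfolding sum_divide_distrib sum.distrib[symmetric]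
        by (intro sum.cong refl) (simp add: Z_def field_simps)
      also have "(\<Sum>k\<in>UNIV. \<Sum>\<alpha>\<in>UNIV. (?L $ k * v \<alpha>) * B k \<alpha>) = (\<Sum>k\<in>UNIV. \<Sum>\<alpha>\<in>UNIV. (?L $ \<alpha> * v k) * B k \<alpha>)"
        by (subst sum.swap) (intro sum.cong refl, metis Bsym)
      also have "(\<Sum>k\<in>UNIV. \<Sum>\<alpha>\<in>UNIV. (?L $ \<alpha> * v k) * B k \<alpha>) / 2 + (\<Sum>k\<in>UNIV. \<Sum>\<alpha>\<in>UNIV. (?L $ \<alpha> * v k) * B k \<alpha>) / 2
          = (\<Sum>k\<in>UNIV. \<Sum>\<alpha>\<in>UNIV. \<Sum>j\<in>UNIV. \<Sum>\<beta>\<in>UNIV. A k j \<alpha> \<beta> * ?L $ \<alpha> * ?L $ \<beta> * v k * v j)"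
        by (simp add: B_def sum_distrib_left mult_ac)
      also have "\<dots> = (\<Sum>k\<in>UNIV. \<Sum>j\<in>UNIV. \<Sum>\<alpha>\<in>UNIV. \<Sum>\<beta>\<in>UNIV. A k j \<alpha> \<beta> * ?L $ \<alpha> * ?L $ \<beta> * v k * v j)"
        by (intro sum.cong refl sum.swap)
      also have "\<dots> = (\<Sum>k\<in>UNIV. \<Sum>j\<in>UNIV. symbol A k j \<xi> * v k * v j)"
        by (simp add: symbol_def sum_distrib_right)
      finally show ?thesis .
    qed
    have "(norm ?L)\<^sup>2 * (\<Sum>k\<in>UNIV. (v k)\<^sup>2) / 2 \<le> C * (\<Sum>k\<in>UNIV. \<Sum>j\<in>UNIV. symbol A k j \<xi> * v k * v j)"
      using ell[OF 1 2] by (simp add: \<zeta>_def sq quad)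
    then show "1 / (2 * C) * ((norm ?L)\<^sup>2 * (\<Sum>k\<in>UNIV. (v k)\<^sup>2)) \<le> (\<Sum>k\<in>UNIV. \<Sum>j\<in>UNIV. symbol A k j \<xi> * v k * v j)"
      using C by (simp add: field_simps)
  qed
qed

text \<open>The symbol is real, so the real and imaginary parts of \<open>v\<close> decouple in the
  real part of the sesquilinear form.\<close>

lemma elliptic_symbol:
  fixes A :: "'n::finite tensor4"
  assumes "tensor_symmetric A" "relaxed_elliptic A"
  obtains c where "c > 0"
    "\<And>\<xi> (v::'n \<Rightarrow> complex). (\<Sum>k\<in>UNIV. of_real (lattice_vec \<xi> $ k) * v k) = 0 \<Longrightarrow>
      c * ((norm (lattice_vec \<xi>))\<^sup>2 * (\<Sum>k\<in>UNIV. (cmod (v k))\<^sup>2))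
        \<le> Re (\<Sum>k\<in>UNIV. cnj (v k) * (\<Sum>j\<in>UNIV. of_real (symbol A k j \<xi>) * v j))"
proof -
  obtain c where c: "c > 0" and ell: "\<And>\<xi> (v::'n \<Rightarrow> real). (\<Sum>k\<in>UNIV. lattice_vec \<xi> $ k * v k) = 0 \<Longrightarrow>
      c * ((norm (lattice_vec \<xi>))\<^sup>2 * (\<Sum>k\<in>UNIV. (v k)\<^sup>2)) \<le> (\<Sum>k\<in>UNIV. \<Sum>j\<in>UNIV. symbol A k j \<xi> * v k * v j)"
    using elliptic_symbol_real[OF assms] by blast
  show ?thesis
  proof (rule that[OF c])
    fix \<xi> and v :: "'n \<Rightarrow> complex"
    assume "(\<Sum>k\<in>UNIV. of_real (lattice_vec \<xi> $ k) * v k) = 0"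
    then have "(\<Sum>k\<in>UNIV. lattice_vec \<xi> $ k * Re (v k)) = 0" "(\<Sum>k\<in>UNIV. lattice_vec \<xi> $ k * Im (v k)) = 0"
      by (simp_all add: complex_eq_iff)
    from this[THEN ell]
    have "c * ((norm (lattice_vec \<xi>))\<^sup>2 * (\<Sum>k\<in>UNIV. (Re (v k))\<^sup>2)) + c * ((norm (lattice_vec \<xi>))\<^sup>2 * (\<Sum>k\<in>UNIV. (Im (v k))\<^sup>2))
      \<le> (\<Sum>k\<in>UNIV. \<Sum>j\<in>UNIV. symbol A k j \<xi> * Re (v k) * Re (v j)) + (\<Sum>k\<in>UNIV. \<Sum>j\<in>UNIV. symbol A k j \<xi> * Im (v k) * Im (v j))"
      by (rule add_mono)
    also have "\<dots> = Re (\<Sum>k\<in>UNIV. cnj (v k) * (\<Sum>j\<in>UNIV. of_real (symbol A k j \<xi>) * v j))"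
      by (simp add: sum_distrib_left mult_ac sum.distrib[symmetric])
    finally show "c * ((norm (lattice_vec \<xi>))\<^sup>2 * (\<Sum>k\<in>UNIV. (cmod (v k))\<^sup>2))
        \<le> Re (\<Sum>k\<in>UNIV. cnj (v k) * (\<Sum>j\<in>UNIV. of_real (symbol A k j \<xi>) * v j))"
      by (simp add: cmod_power2 sum.distrib distrib_left)
  qed
qed

section \<open>Advection and the energy balance\<close>

text \<open>The reality condition for Fourier coefficients.\<close>

definition hermitian :: "(int^'n::finite \<Rightarrow> complex) \<Rightarrow> bool" where
  "hermitian c \<longleftrightarrow> (\<forall>\<xi>. c (- \<xi>) = cnj (c \<xi>))"

definition solenoidal :: "('n::finite \<Rightarrow> int^'n \<Rightarrow> complex) \<Rightarrow> bool" where
  "solenoidal u \<longleftrightarrow> (\<forall>\<xi>. (\<Sum>k\<in>UNIV. of_real (lattice_vec \<xi> $ k) * u k \<xi>) = 0)"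

text \<open>Summed over \<open>\<zeta>\<close>, this is the Fourier coefficient at \<open>\<xi>\<close> of \<open>\<partial>\<^sub>j (u\<^sub>j u\<^sub>k)\<close>, which is
  \<open>u\<^sub>j \<partial>\<^sub>j u\<^sub>k\<close> for solenoidal \<open>u\<close>.\<close>
definition advection :: "('n::finite \<Rightarrow> int^'n \<Rightarrow> complex) \<Rightarrow> 'n \<Rightarrow> int^'n \<Rightarrow> int^'n \<Rightarrow> complex" where
  "advection u k \<xi> \<zeta> = 2 * of_real pi * \<i> * (\<Sum>j\<in>UNIV. of_real (lattice_vec \<xi> $ j) * u j (\<xi> - \<zeta>)) * u k \<zeta>"

text \<open>The passage from the conservative to the convective form: replacing \<open>\<xi>\<close>
  by \<open>\<zeta>\<close> changes the inner sum by the divergence of \<open>u\<close> at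
  \<open>\<xi> - \<zeta>\<close>.\<close>

lemma advection_solenoidal:
  assumes "solenoidal u"
  shows "advection u k \<xi> \<zeta> = 2 * of_real pi * \<i> * (\<Sum>j\<in>UNIV. of_real (lattice_vec \<zeta> $ j) * u j (\<xi> - \<zeta>)) * u k \<zeta>"
proof -
  have "(\<Sum>j\<in>UNIV. of_real (lattice_vec (\<xi> - \<zeta>) $ j) * u j (\<xi> - \<zeta>)) = 0"
    using assms by (simp add: solenoidal_def)
  then have "(\<Sum>j\<in>UNIV. of_real (lattice_vec \<xi> $ j) * u j (\<xi> - \<zeta>)) = (\<Sum>j\<in>UNIV. of_real (lattice_vec \<zeta> $ j) * u j (\<xi> - \<zeta>))"
    by (simp add: lattice_vec_diff left_diff_distrib sum_subtractf)
  then show ?thesis by (simp add: advection_def)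
qed

text \<open>Complex conjugation, by the reality condition, followed by the exchange of
  \<open>\<xi>\<close> and \<open>\<zeta>\<close> only replaces the factor \<open>\<xi>\<close> by
  \<open>\<zeta>\<close>, and solenoidality makes the two agree. So the triple sum \<open>T\<close>
  is real, and the energy is an imaginary multiple of it. The cancellation survives truncation
  because both frequencies range over the same \<open>\<Lambda>\<close>.\<close>

lemma advection_energy:
  assumes u: "solenoidal u" "\<And>k. hermitian (u k)"
  shows "Re (\<Sum>\<xi>\<in>\<Lambda>. \<Sum>k\<in>UNIV. cnj (u k \<xi>) * (\<Sum>\<zeta>\<in>\<Lambda>. advection u k \<xi> \<zeta>)) = 0"
proof -
  define T where "T = (\<Sum>\<xi>\<in>\<Lambda>. \<Sum>\<zeta>\<in>\<Lambda>. \<Sum>k\<in>UNIV. cnj (u k \<xi>) * (\<Sum>j\<in>UNIV. of_real (lattice_vec \<xi> $ j) * u j (\<xi> - \<zeta>)) * u k \<zeta>)"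
  have "cnj T = (\<Sum>\<xi>\<in>\<Lambda>. \<Sum>\<zeta>\<in>\<Lambda>. \<Sum>k\<in>UNIV. u k \<xi> * (\<Sum>j\<in>UNIV. of_real (lattice_vec \<xi> $ j) * u j (\<zeta> - \<xi>)) * cnj (u k \<zeta>))"
  proof -
    have "cnj (u j (\<xi> - \<zeta>)) = u j (\<zeta> - \<xi>)" for j \<xi> \<zeta>
      using u(2)[of j] unfolding hermitian_def by (metis minus_diff_eq)
    then show ?thesis by (simp add: T_def)
  qed
  also have "\<dots> = (\<Sum>\<xi>\<in>\<Lambda>. \<Sum>\<zeta>\<in>\<Lambda>. \<Sum>k\<in>UNIV. u k \<zeta> * (\<Sum>j\<in>UNIV. of_real (lattice_vec \<zeta> $ j) * u j (\<xi> - \<zeta>)) * cnj (u k \<xi>))"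
    by (rule sum.swap)
  also have "\<dots> = T"
    unfolding T_def
  proof (intro sum.cong refl)
    fix \<xi> \<zeta> k
    have "2 * of_real pi * \<i> * ((\<Sum>j\<in>UNIV. of_real (lattice_vec \<xi> $ j) * u j (\<xi> - \<zeta>)) * u k \<zeta>) =
       2 * of_real pi * \<i> * ((\<Sum>j\<in>UNIV. of_real (lattice_vec \<zeta> $ j) * u j (\<xi> - \<zeta>)) * u k \<zeta>)"
      using advection_solenoidal[OF u(1), of k \<xi> \<zeta>] by (simp add: advection_def mult_ac)
    then have e: "(\<Sum>j\<in>UNIV. of_real (lattice_vec \<xi> $ j) * u j (\<xi> - \<zeta>)) * u k \<zeta> =
       (\<Sum>j\<in>UNIV. of_real (lattice_vec \<zeta> $ j) * u j (\<xi> - \<zeta>)) * u k \<zeta>"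
      by (subst (asm) mult_cancel_left) simp
    show "u k \<zeta> * (\<Sum>j\<in>UNIV. of_real (lattice_vec \<zeta> $ j) * u j (\<xi> - \<zeta>)) * cnj (u k \<xi>) =
       cnj (u k \<xi>) * (\<Sum>j\<in>UNIV. of_real (lattice_vec \<xi> $ j) * u j (\<xi> - \<zeta>)) * u k \<zeta>"
      unfolding mult.assoc e by (simp only: mult_ac)
  qed
  finally have "Im T = 0"
    by (metis Reals_cnj_iff complex_is_Real_iff)
  have "(\<Sum>\<xi>\<in>\<Lambda>. \<Sum>k\<in>UNIV. cnj (u k \<xi>) * (\<Sum>\<zeta>\<in>\<Lambda>. advection u k \<xi> \<zeta>))
    = (\<Sum>\<xi>\<in>\<Lambda>. \<Sum>k\<in>UNIV. \<Sum>\<zeta>\<in>\<Lambda>. cnj (u k \<xi>) * advection u k \<xi> \<zeta>)"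
    by (simp add: sum_distrib_left)
  also have "\<dots> = (\<Sum>\<xi>\<in>\<Lambda>. \<Sum>\<zeta>\<in>\<Lambda>. \<Sum>k\<in>UNIV. cnj (u k \<xi>) * advection u k \<xi> \<zeta>)"
    by (intro sum.cong refl sum.swap)
  also have "\<dots> = 2 * of_real pi * \<i> * T"
    unfolding T_def sum_distrib_left[of _ _ \<Lambda>] sum_distrib_left[of "2 * of_real pi * \<i>" _ UNIV]
    by (intro sum.cong refl) (simp add: advection_def mult_ac)
  finally show ?thesis using \<open>Im T = 0\<close> by simp
qed

text \<open>There is no pressure term: the residual is tested against solenoidal fields only, to
  which a gradient is invisible.\<close>

definition galerkin_residual ::
  "'n::finite tensor4 \<Rightarrow> ('n \<Rightarrow> int^'n \<Rightarrow> complex) \<Rightarrow> (int^'n) set \<Rightarrow> ('n \<Rightarrow> int^'n \<Rightarrow> complex) \<Rightarrow> 'n \<Rightarrow> int^'n \<Rightarrow> complex" where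
  "galerkin_residual A f \<Lambda> u k \<xi> =
     4 * (of_real pi)\<^sup>2 * (\<Sum>j\<in>UNIV. of_real (symbol A k j \<xi>) * u j \<xi>) + (\<Sum>\<zeta>\<in>\<Lambda>. advection u k \<xi> \<zeta>) - f k \<xi>"

lemma one_le_4_pi_squared: "1 \<le> 4 * pi\<^sup>2"
proof -
  have "1 * 1 \<le> pi * pi" using pi_ge_two by (intro mult_mono) auto
  then show ?thesis by (simp add: power2_eq_square)
qed

text \<open>Coercivity provides \<open>c\<close> times the gradient energy, the advection drops out,
  and Young's inequality spends half of it on the force. \<open>K\<close> bounds the squared dual
  norm of the force divided by \<open>2 * c\<close>.\<close>

lemma galerkin_energy:
  fixes u f :: "'n::finite \<Rightarrow> int^'n \<Rightarrow> complex"
  assumes c: "c > 0" and ell: "\<And>\<xi> (v::'n \<Rightarrow> complex). (\<Sum>k\<in>UNIV. of_real (lattice_vec \<xi> $ k) * v k) = 0 \<Longrightarrow>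
      c * ((norm (lattice_vec \<xi>))\<^sup>2 * (\<Sum>k\<in>UNIV. (cmod (v k))\<^sup>2))
        \<le> Re (\<Sum>k\<in>UNIV. cnj (v k) * (\<Sum>j\<in>UNIV. of_real (symbol A k j \<xi>) * v j))"
    and \<Lambda>: "finite \<Lambda>" "0 \<notin> \<Lambda>"
    and u: "solenoidal u" "\<And>k. hermitian (u k)"
    and K: "(\<Sum>\<xi>\<in>\<Lambda>. \<Sum>k\<in>UNIV. (cmod (f k \<xi>))\<^sup>2 / (norm (lattice_vec \<xi>))\<^sup>2) \<le> 2 * c * K"
  shows "c / 2 * (\<Sum>\<xi>\<in>\<Lambda>. \<Sum>k\<in>UNIV. (norm (lattice_vec \<xi>))\<^sup>2 * (cmod (u k \<xi>))\<^sup>2) - K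
    \<le> Re (\<Sum>\<xi>\<in>\<Lambda>. \<Sum>k\<in>UNIV. cnj (u k \<xi>) * galerkin_residual A f \<Lambda> u k \<xi>)"
proof -
  define E where "E = (\<Sum>\<xi>\<in>\<Lambda>. \<Sum>k\<in>UNIV. (norm (lattice_vec \<xi>))\<^sup>2 * (cmod (u k \<xi>))\<^sup>2)"
  have E0: "E \<ge> 0" unfolding E_def by (intro sum_nonneg) auto
  have nz: "norm (lattice_vec \<xi>) > 0" if "\<xi> \<in> \<Lambda>" for \<xi> :: "int^'n"
  proof -
    have "weight \<xi> \<le> 2 * (norm (lattice_vec \<xi>))\<^sup>2"
      using that \<Lambda> by (intro weight_le_2_norm) auto
    then show ?thesis using weight_ge_1[of \<xi>] by (cases "norm (lattice_vec \<xi>) = 0") auto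
  qed
  have "Re (\<Sum>\<xi>\<in>\<Lambda>. \<Sum>k\<in>UNIV. cnj (u k \<xi>) * galerkin_residual A f \<Lambda> u k \<xi>)
    = 4 * pi\<^sup>2 * (\<Sum>\<xi>\<in>\<Lambda>. Re (\<Sum>k\<in>UNIV. cnj (u k \<xi>) * (\<Sum>j\<in>UNIV. of_real (symbol A k j \<xi>) * u j \<xi>)))
      + Re (\<Sum>\<xi>\<in>\<Lambda>. \<Sum>k\<in>UNIV. cnj (u k \<xi>) * (\<Sum>\<zeta>\<in>\<Lambda>. advection u k \<xi> \<zeta>))
      - (\<Sum>\<xi>\<in>\<Lambda>. \<Sum>k\<in>UNIV. Re (cnj (u k \<xi>) * f k \<xi>))"
  proof -
    have "(\<Sum>\<xi>\<in>\<Lambda>. \<Sum>k\<in>UNIV. cnj (u k \<xi>) * galerkin_residual A f \<Lambda> u k \<xi>) =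
      of_real (4 * pi\<^sup>2) * (\<Sum>\<xi>\<in>\<Lambda>. \<Sum>k\<in>UNIV. cnj (u k \<xi>) * (\<Sum>j\<in>UNIV. of_real (symbol A k j \<xi>) * u j \<xi>))
      + (\<Sum>\<xi>\<in>\<Lambda>. \<Sum>k\<in>UNIV. cnj (u k \<xi>) * (\<Sum>\<zeta>\<in>\<Lambda>. advection u k \<xi> \<zeta>))
      - (\<Sum>\<xi>\<in>\<Lambda>. \<Sum>k\<in>UNIV. cnj (u k \<xi>) * f k \<xi>)"
      unfolding sum_distrib_left[of "of_real (4 * pi\<^sup>2)"] sum.distrib[symmetric] sum_subtractf[symmetric]
      by (intro sum.cong refl) (simp add: galerkin_residual_def algebra_simps)
    from arg_cong[OF this, of Re] show ?thesis by simp
  qed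
  also have "Re (\<Sum>\<xi>\<in>\<Lambda>. \<Sum>k\<in>UNIV. cnj (u k \<xi>) * (\<Sum>\<zeta>\<in>\<Lambda>. advection u k \<xi> \<zeta>)) = 0"
    by (rule advection_energy[OF u])
  finally have eq: "Re (\<Sum>\<xi>\<in>\<Lambda>. \<Sum>k\<in>UNIV. cnj (u k \<xi>) * galerkin_residual A f \<Lambda> u k \<xi>)
    = 4 * pi\<^sup>2 * (\<Sum>\<xi>\<in>\<Lambda>. Re (\<Sum>k\<in>UNIV. cnj (u k \<xi>) * (\<Sum>j\<in>UNIV. of_real (symbol A k j \<xi>) * u j \<xi>)))
      - (\<Sum>\<xi>\<in>\<Lambda>. \<Sum>k\<in>UNIV. Re (cnj (u k \<xi>) * f k \<xi>))" by simp
  have "c * E \<le> (\<Sum>\<xi>\<in>\<Lambda>. Re (\<Sum>k\<in>UNIV. cnj (u k \<xi>) * (\<Sum>j\<in>UNIV. of_real (symbol A k j \<xi>) * u j \<xi>)))"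
    unfolding E_def sum_distrib_left[of c]
  proof (rule sum_mono)
    fix \<xi>
    show "(\<Sum>k\<in>UNIV. c * ((norm (lattice_vec \<xi>))\<^sup>2 * (cmod (u k \<xi>))\<^sup>2))
        \<le> Re (\<Sum>k\<in>UNIV. cnj (u k \<xi>) * (\<Sum>j\<in>UNIV. of_real (symbol A k j \<xi>) * u j \<xi>))"
      using ell[of \<xi> "\<lambda>k. u k \<xi>"] u(1) by (simp add: solenoidal_def sum_distrib_left)
  qed
  moreover have "1 * (c * E) \<le> 4 * pi\<^sup>2 * (c * E)"
    by (rule mult_right_mono[OF one_le_4_pi_squared]) (use c E0 in simp)
  ultimately have 1: "c * E \<le> 4 * pi\<^sup>2 * (\<Sum>\<xi>\<in>\<Lambda>. Re (\<Sum>k\<in>UNIV. cnj (u k \<xi>) * (\<Sum>j\<in>UNIV. of_real (symbol A k j \<xi>) * u j \<xi>)))"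
    by (smt (verit) mult_left_mono zero_le_power2)
  have "(\<Sum>\<xi>\<in>\<Lambda>. \<Sum>k\<in>UNIV. Re (cnj (u k \<xi>) * f k \<xi>)) \<le>
      (\<Sum>\<xi>\<in>\<Lambda>. \<Sum>k\<in>UNIV. c / 2 * ((norm (lattice_vec \<xi>))\<^sup>2 * (cmod (u k \<xi>))\<^sup>2) + (cmod (f k \<xi>))\<^sup>2 / (norm (lattice_vec \<xi>))\<^sup>2 / (2 * c))"
  proof (intro sum_mono)
    fix \<xi> k assume "\<xi> \<in> \<Lambda>"
    define l where "l = norm (lattice_vec \<xi>)"
    have l: "l > 0" using nz[OF \<open>\<xi> \<in> \<Lambda>\<close>] by (simp add: l_def)
    have "Re (cnj (u k \<xi>) * f k \<xi>) \<le> cmod (u k \<xi>) * cmod (f k \<xi>)"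
      by (metis complex_Re_le_cmod complex_mod_cnj norm_mult)
    also have "\<dots> \<le> c / 2 * (l\<^sup>2 * (cmod (u k \<xi>))\<^sup>2) + (cmod (f k \<xi>))\<^sup>2 / l\<^sup>2 / (2 * c)"
    proof -
      have "0 \<le> (c * l * cmod (u k \<xi>) - cmod (f k \<xi>) / l)\<^sup>2" by simp
      also have "\<dots> = c\<^sup>2 * l\<^sup>2 * (cmod (u k \<xi>))\<^sup>2 - 2 * c * cmod (u k \<xi>) * cmod (f k \<xi>) + (cmod (f k \<xi>))\<^sup>2 / l\<^sup>2"
        using l by (simp add: power2_diff power_mult_distrib power_divide)
      finally have "2 * c * (cmod (u k \<xi>) * cmod (f k \<xi>)) \<le> 2 * c * (c / 2 * (l\<^sup>2 * (cmod (u k \<xi>))\<^sup>2) + (cmod (f k \<xi>))\<^sup>2 / l\<^sup>2 / (2 * c))"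
        using c by (simp add: algebra_simps power2_eq_square)
      then show ?thesis using c by simp
    qed
    finally show "Re (cnj (u k \<xi>) * f k \<xi>) \<le> c / 2 * ((norm (lattice_vec \<xi>))\<^sup>2 * (cmod (u k \<xi>))\<^sup>2) + (cmod (f k \<xi>))\<^sup>2 / (norm (lattice_vec \<xi>))\<^sup>2 / (2 * c)"
      by (simp add: l_def)
  qed
  also have "\<dots> = c / 2 * E + (\<Sum>\<xi>\<in>\<Lambda>. \<Sum>k\<in>UNIV. (cmod (f k \<xi>))\<^sup>2 / (norm (lattice_vec \<xi>))\<^sup>2) / (2 * c)"
    by (simp add: E_def sum.distrib sum_distrib_left sum_divide_distrib)
  also have "\<dots> \<le> c / 2 * E + K"
    using K c by (simp add: divide_le_eq mult_ac)
  finally have 2: "(\<Sum>\<xi>\<in>\<Lambda>. \<Sum>k\<in>UNIV. Re (cnj (u k \<xi>) * f k \<xi>)) \<le> c / 2 * E + K" .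
  have "c / 2 * E - K \<le> Re (\<Sum>\<xi>\<in>\<Lambda>. \<Sum>k\<in>UNIV. cnj (u k \<xi>) * galerkin_residual A f \<Lambda> u k \<xi>)"
    using 1 2 unfolding eq by (simp add: field_simps)
  then show ?thesis by (simp add: E_def)
qed

section \<open>Solenoidal waves and the truncated systems\<close>

definition amplitude :: "bool \<Rightarrow> complex" where
  "amplitude b = (if b then 1 else \<i>)"

text \<open>These fields span the real solenoidal trigonometric polynomials, but they are linearly dependent.
  In \<open>galerkin_exists\<close> the summand \<open>\<epsilon> * x i\<close> restores coercivity in the coordinates \<open>x\<close>.\<close>
definition wave :: "(int^'n) \<times> 'n \<times> bool \<Rightarrow> 'n::finite \<Rightarrow> int^'n \<Rightarrow> complex" where
  "wave = (\<lambda>(\<zeta>, l, b) k \<xi>.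
     of_real ((if k = l then (norm (lattice_vec \<zeta>))\<^sup>2 else 0) - lattice_vec \<zeta> $ l * lattice_vec \<zeta> $ k)
     * ((if \<xi> = \<zeta> then amplitude b else 0) + (if \<xi> = - \<zeta> then cnj (amplitude b) else 0)))"

text \<open>Two facts about the shape of \<open>wave\<close>: the conjugate amplitude at
  \<open>- \<zeta>\<close> makes it real, with cosine and sine as its two phases, and its scalar
  factor is the \<open>l\<close>-th column of \<open>|\<zeta>|^2\<close> times the projection
  orthogonal to \<open>\<zeta>\<close>, which makes it solenoidal without any division.\<close>

lemma hermitian_wave: "hermitian (wave i k)"
  by (auto simp: hermitian_def wave_def split: prod.splits)

lemma solenoidal_wave: "solenoidal (wave i)"
proof -
  obtain \<zeta> l b where i: "i = (\<zeta>, l, b)" by (cases i)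
  let ?L = "lattice_vec \<zeta>"
  have "(\<Sum>k\<in>UNIV. ?L $ k * ((if k = l then (norm ?L)\<^sup>2 else 0) - ?L $ l * ?L $ k)) = 0"
  proof -
    have "(\<Sum>k\<in>UNIV. ?L $ k * ((if k = l then (norm ?L)\<^sup>2 else 0) - ?L $ l * ?L $ k))
      = (\<Sum>k\<in>UNIV. (if k = l then ?L $ k * (norm ?L)\<^sup>2 else 0)) - ?L $ l * (\<Sum>k\<in>UNIV. (?L $ k)\<^sup>2)"
      unfolding sum_distrib_left sum_subtractf[symmetric]
      by (intro sum.cong refl) (auto simp: algebra_simps power2_eq_square)
    also have "(\<Sum>k\<in>UNIV. (?L $ k)\<^sup>2) = (norm ?L)\<^sup>2"
      by (simp add: norm_vec_def L2_set_def sum_nonneg)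
    finally show ?thesis by simp
  qed
  then have z: "(\<Sum>k\<in>UNIV. of_real (?L $ k) * (of_real ((if k = l then (norm ?L)\<^sup>2 else 0) - ?L $ l * ?L $ k) :: complex)) = 0"
    unfolding of_real_mult[symmetric] of_real_sum[symmetric] by simp
  have "(\<Sum>k\<in>UNIV. of_real (lattice_vec \<xi> $ k) * wave i k \<xi>) = 0" for \<xi>
  proof -
    define a where "a = (if \<xi> = \<zeta> then amplitude b else 0) + (if \<xi> = - \<zeta> then cnj (amplitude b) else 0)"
    have "(\<Sum>k\<in>UNIV. of_real (lattice_vec \<xi> $ k) * wave i k \<xi>)
      = (\<Sum>k\<in>UNIV. of_real (lattice_vec \<xi> $ k) * of_real ((if k = l then (norm ?L)\<^sup>2 else 0) - ?L $ l * ?L $ k)) * a"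
      unfolding sum_distrib_right by (intro sum.cong refl) (simp add: wave_def i a_def)
    also have "\<dots> = 0"
    proof (cases "\<xi> = \<zeta> \<or> \<xi> = - \<zeta>")
      case True
      then have "(\<forall>k. lattice_vec \<xi> $ k = ?L $ k) \<or> (\<forall>k. lattice_vec \<xi> $ k = - ?L $ k)" by auto
      then show ?thesis
      proof
        assume "\<forall>k. lattice_vec \<xi> $ k = - ?L $ k"
        then show ?thesis using z by (simp add: sum_negf del: of_real_diff)
      qed (use z in simp)
    qed (simp add: a_def)
    finally show ?thesis .
  qed
  then show ?thesis by (simp add: solenoidal_def)
qed

text \<open>The residual is only approximately orthogonal to the waves: a zero of \<open>F\<close>
  has \<open>P x i = - \<epsilon> * x i\<close>. The energy inequality bounds
  \<open>\<epsilon>\<close> times the square sum of \<open>x\<close> by \<open>K\<close>, so the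
  square of this defect is at most \<open>\<epsilon> * K\<close> and disappears as
  \<open>\<epsilon>\<close> tends to 0, whereas the bound on the energy of \<open>u\<close> does not
  depend on \<open>\<epsilon>\<close>.\<close>

lemma galerkin_exists:
  fixes A :: "'n::finite tensor4" and f :: "'n \<Rightarrow> int^'n \<Rightarrow> complex"
  assumes c: "c > 0" and ell: "\<And>\<xi> (v::'n \<Rightarrow> complex). (\<Sum>k\<in>UNIV. of_real (lattice_vec \<xi> $ k) * v k) = 0 \<Longrightarrow>
      c * ((norm (lattice_vec \<xi>))\<^sup>2 * (\<Sum>k\<in>UNIV. (cmod (v k))\<^sup>2))
        \<le> Re (\<Sum>k\<in>UNIV. cnj (v k) * (\<Sum>j\<in>UNIV. of_real (symbol A k j \<xi>) * v j))"
    and \<Lambda>: "finite \<Lambda>" "0 \<notin> \<Lambda>" "\<And>\<xi>. \<xi> \<in> \<Lambda> \<Longrightarrow> - \<xi> \<in> \<Lambda>"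
    and K: "(\<Sum>\<xi>\<in>\<Lambda>. \<Sum>k\<in>UNIV. (cmod (f k \<xi>))\<^sup>2 / (norm (lattice_vec \<xi>))\<^sup>2) \<le> 2 * c * K"
    and \<epsilon>: "\<epsilon> > 0" and "K \<ge> 0"
  shows "\<exists>u. (\<forall>k. hermitian (u k)) \<and> solenoidal u \<and> (\<forall>k \<xi>. \<xi> \<notin> \<Lambda> \<longrightarrow> u k \<xi> = 0)
    \<and> c / 2 * (\<Sum>\<xi>\<in>\<Lambda>. \<Sum>k\<in>UNIV. (norm (lattice_vec \<xi>))\<^sup>2 * (cmod (u k \<xi>))\<^sup>2) \<le> K
    \<and> (\<forall>\<zeta>\<in>\<Lambda>. \<forall>l b. (Re (\<Sum>\<xi>\<in>\<Lambda>. \<Sum>k\<in>UNIV. cnj (wave (\<zeta>, l, b) k \<xi>) * galerkin_residual A f \<Lambda> u k \<xi>))\<^sup>2 \<le> \<epsilon> * K)"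
proof -
  define I where "I = \<Lambda> \<times> (UNIV :: 'n set) \<times> (UNIV :: bool set)"
  have "finite I" using \<Lambda> by (simp add: I_def)
  define U where "U = (\<lambda>x k \<xi>. \<Sum>i\<in>I. of_real (x i) * wave i k \<xi>)"
  define P where "P = (\<lambda>x i. Re (\<Sum>\<xi>\<in>\<Lambda>. \<Sum>k\<in>UNIV. cnj (wave i k \<xi>) * galerkin_residual A f \<Lambda> (U x) k \<xi>))"
  define F where "F = (\<lambda>x i. P x i + \<epsilon> * x i)"
  define E where "E = (\<lambda>x. \<Sum>\<xi>\<in>\<Lambda>. \<Sum>k\<in>UNIV. (norm (lattice_vec \<xi>))\<^sup>2 * (cmod (U x k \<xi>))\<^sup>2)"
  have E0: "E x \<ge> 0" for x unfolding E_def by (intro sum_nonneg) auto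
  have herm: "hermitian (U x k)" for x k
    unfolding hermitian_def U_def
    by (simp add: hermitian_wave[unfolded hermitian_def, rule_format])
  have sol: "solenoidal (U x)" for x
  proof -
    have "(\<Sum>k\<in>UNIV. of_real (lattice_vec \<xi> $ k) * U x k \<xi>) =
        (\<Sum>i\<in>I. of_real (x i) * (\<Sum>k\<in>UNIV. of_real (lattice_vec \<xi> $ k) * wave i k \<xi>))" for \<xi>
      unfolding U_def sum_distrib_left by (subst sum.swap) (simp add: mult_ac)
    then show ?thesis
      unfolding solenoidal_def by (simp add: solenoidal_wave[unfolded solenoidal_def, rule_format])
  qed
  have supp: "U x k \<xi> = 0" if "\<xi> \<notin> \<Lambda>" for x k \<xi>
    unfolding U_def using that \<Lambda>(3)
    by (intro sum.neutral ballI) (auto simp: I_def wave_def split: if_splits)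
  have PU: "(\<Sum>i\<in>I. P x i * x i) = Re (\<Sum>\<xi>\<in>\<Lambda>. \<Sum>k\<in>UNIV. cnj (U x k \<xi>) * galerkin_residual A f \<Lambda> (U x) k \<xi>)" for x
  proof -
    have "(\<Sum>\<xi>\<in>\<Lambda>. \<Sum>k\<in>UNIV. cnj (U x k \<xi>) * galerkin_residual A f \<Lambda> (U x) k \<xi>)
      = (\<Sum>\<xi>\<in>\<Lambda>. \<Sum>i\<in>I. \<Sum>k\<in>UNIV. of_real (x i) * (cnj (wave i k \<xi>) * galerkin_residual A f \<Lambda> (U x) k \<xi>))"
      by (intro sum.cong refl, subst sum.swap) (simp add: U_def sum_distrib_right mult.assoc)
    also have "\<dots> = (\<Sum>i\<in>I. \<Sum>\<xi>\<in>\<Lambda>. \<Sum>k\<in>UNIV. of_real (x i) * (cnj (wave i k \<xi>) * galerkin_residual A f \<Lambda> (U x) k \<xi>))"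
      by (rule sum.swap)
    also have "\<dots> = (\<Sum>i\<in>I. of_real (x i) * (\<Sum>\<xi>\<in>\<Lambda>. \<Sum>k\<in>UNIV. cnj (wave i k \<xi>) * galerkin_residual A f \<Lambda> (U x) k \<xi>))"
      by (simp only: sum_distrib_left)
    finally show ?thesis by (simp add: P_def mult.commute)
  qed
  have energy: "(\<Sum>i\<in>I. F x i * x i) \<ge> c / 2 * E x - K + \<epsilon> * (\<Sum>i\<in>I. (x i)\<^sup>2)" for x
  proof -
    have "(\<Sum>i\<in>I. F x i * x i) = (\<Sum>i\<in>I. P x i * x i) + \<epsilon> * (\<Sum>i\<in>I. (x i)\<^sup>2)"
      unfolding sum_distrib_left sum.distrib[symmetric]
      by (intro sum.cong refl) (simp add: F_def power2_eq_square algebra_simps)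
    then show ?thesis
      using galerkin_energy[OF c ell \<Lambda>(1,2) sol[of x] herm K] by (simp add: PU E_def)
  qed
  \<comment> \<open>Chosen so that \<open>\<epsilon> * R\<^sup>2 = K + 1\<close>, which outweighs
    the \<open>- K\<close> in \<open>energy\<close> and makes \<open>F\<close> point outward on the
    sphere of radius \<open>R\<close>.\<close>
  define R where "R = sqrt ((K + 1) / \<epsilon>)"
  have "R > 0" using \<open>K \<ge> 0\<close> \<epsilon> by (simp add: R_def)
  have contU: "continuous_on UNIV (\<lambda>x. U x k \<xi>)" for k \<xi>
    unfolding U_def by (intro continuous_intros continuous_on_product_coordinates)
  have "\<exists>x. (\<Sum>i\<in>I. (x i)\<^sup>2) \<le> R\<^sup>2 \<and> (\<forall>i\<in>I. F x i = 0)"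
  proof (rule acute_angle[OF \<open>finite I\<close> _ \<open>R > 0\<close>])
    show "continuous_on UNIV (\<lambda>x. F x i)" for i
      unfolding F_def P_def galerkin_residual_def advection_def
      by (intro continuous_intros contU continuous_on_product_coordinates)
    fix x :: "(int^'n) \<times> 'n \<times> bool \<Rightarrow> real" assume "(\<Sum>i\<in>I. (x i)\<^sup>2) = R\<^sup>2"
    then have "\<epsilon> * (\<Sum>i\<in>I. (x i)\<^sup>2) = K + 1"
      using \<open>K \<ge> 0\<close> \<epsilon> by (simp add: R_def)
    moreover have "c / 2 * E x \<ge> 0" using c E0 by simp
    ultimately show "(\<Sum>i\<in>I. F x i * x i) > 0" using energy[of x] by linarith
  qed
  then obtain x where x: "\<And>i. i \<in> I \<Longrightarrow> F x i = 0" by blast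
  then have le: "c / 2 * E x + \<epsilon> * (\<Sum>i\<in>I. (x i)\<^sup>2) \<le> K"
    using energy[of x] by simp
  show ?thesis
  proof (intro exI[of _ "U x"] conjI allI ballI impI)
    show "hermitian (U x k)" for k by (rule herm)
    show "solenoidal (U x)" by (rule sol)
    show "U x k \<xi> = 0" if "\<xi> \<notin> \<Lambda>" for k \<xi> using that by (rule supp)
    have "\<epsilon> * (\<Sum>i\<in>I. (x i)\<^sup>2) \<ge> 0" using \<epsilon> by (intro mult_nonneg_nonneg sum_nonneg) auto
    then show "c / 2 * (\<Sum>\<xi>\<in>\<Lambda>. \<Sum>k\<in>UNIV. (norm (lattice_vec \<xi>))\<^sup>2 * (cmod (U x k \<xi>))\<^sup>2) \<le> K"
      using le by (simp add: E_def)
    fix \<zeta> l b assume "\<zeta> \<in> \<Lambda>"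
    then have i: "(\<zeta>, l, b) \<in> I" by (simp add: I_def)
    have "P x (\<zeta>, l, b) = - \<epsilon> * x (\<zeta>, l, b)"
      using x[OF i] by (simp add: F_def)
    moreover have "(- \<epsilon> * x (\<zeta>, l, b))\<^sup>2 \<le> \<epsilon> * K"
    proof -
      have "(x (\<zeta>, l, b))\<^sup>2 \<le> (\<Sum>i\<in>I. (x i)\<^sup>2)"
        using i \<open>finite I\<close> by (intro member_le_sum) auto
      then have "\<epsilon> * (x (\<zeta>, l, b))\<^sup>2 \<le> \<epsilon> * (\<Sum>i\<in>I. (x i)\<^sup>2)"
        using \<epsilon> by simp
      also have "\<dots> \<le> K"
        using le mult_nonneg_nonneg[of "c/2" "E x"] c E0[of x] by linarith
      finally have "\<epsilon> * (\<epsilon> * (x (\<zeta>, l, b))\<^sup>2) \<le> \<epsilon> * K"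
        using \<epsilon> by simp
      then show ?thesis by (simp add: power2_eq_square mult_ac)
    qed
    ultimately show "(Re (\<Sum>\<xi>\<in>\<Lambda>. \<Sum>k\<in>UNIV. cnj (wave (\<zeta>, l, b) k \<xi>) * galerkin_residual A f \<Lambda> (U x) k \<xi>))\<^sup>2 \<le> \<epsilon> * K"
      by (simp add: P_def)
  qed
qed

section \<open>Passage to the limit in the truncated systems\<close>

text \<open>Tightness, that is, tails small uniformly in \<open>N\<close>, takes the place of a
  dominating family. The limit inherits the tail bounds, and both sums are compared on one finite
  set \<open>S\<close>.\<close>

lemma tendsto_sum_infsum:
  fixes a :: "nat \<Rightarrow> 'i \<Rightarrow> 'b::banach"
  assumes lim: "\<And>i. (\<lambda>N. a N i) \<longlonglongrightarrow> b i"
    and supp: "\<And>N. finite (\<Lambda> N)" "\<And>N i. i \<notin> \<Lambda> N \<Longrightarrow> a N i = 0"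
    and tails: "\<And>\<delta>. \<delta> > 0 \<Longrightarrow> \<exists>S. finite S \<and> (\<forall>N F. finite F \<and> F \<inter> S = {} \<longrightarrow> (\<Sum>i\<in>F. norm (a N i)) \<le> \<delta>)"
  shows "(\<lambda>N. \<Sum>i\<in>\<Lambda> N. a N i) \<longlonglongrightarrow> (\<Sum>\<^sub>\<infinity>i. b i)"
proof -
  have tb: "(\<Sum>i\<in>F. norm (b i)) \<le> \<delta>"
    if "\<And>N. (\<Sum>i\<in>F. norm (a N i)) \<le> \<delta>" for F :: "'i set" and \<delta>
    by (rule LIMSEQ_le_const2[where X="\<lambda>N. \<Sum>i\<in>F. norm (a N i)"])
       (use that in \<open>auto intro!: tendsto_intros lim\<close>)
  have sum: "(\<lambda>i. norm (b i)) summable_on UNIV"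
  proof -
    obtain S where S: "finite S" "\<And>N F. finite F \<Longrightarrow> F \<inter> S = {} \<Longrightarrow> (\<Sum>i\<in>F. norm (a N i)) \<le> 1"
      using tails[of 1] by auto
    show ?thesis
    proof (rule nonneg_bdd_above_summable_on)
      show "bdd_above (sum (\<lambda>i. norm (b i)) ` {F. F \<subseteq> UNIV \<and> finite F})"
      proof (rule bdd_aboveI2)
        fix F :: "'i set" assume "F \<in> {F. F \<subseteq> UNIV \<and> finite F}"
        then have F: "finite F" by simp
        have "(\<Sum>i\<in>F. norm (b i)) \<le> (\<Sum>i\<in>(F - S) \<union> S. norm (b i))"
          using F S by (intro sum_mono2) auto
        also have "\<dots> = (\<Sum>i\<in>F - S. norm (b i)) + (\<Sum>i\<in>S. norm (b i))"
          using F S by (intro sum.union_disjoint) auto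
        also have "(\<Sum>i\<in>F - S. norm (b i)) \<le> 1"
          by (rule tb, rule S) (use F in auto)
        finally show "(\<Sum>i\<in>F. norm (b i)) \<le> 1 + (\<Sum>i\<in>S. norm (b i))" by simp
      qed
    qed simp
  qed
  show "(\<lambda>N. \<Sum>i\<in>\<Lambda> N. a N i) \<longlonglongrightarrow> (\<Sum>\<^sub>\<infinity>i. b i)"
  proof (rule tendstoI)
    fix \<epsilon> :: real assume "\<epsilon> > 0"
    then obtain S where S: "finite S" "\<And>N F. finite F \<Longrightarrow> F \<inter> S = {} \<Longrightarrow> (\<Sum>i\<in>F. norm (a N i)) \<le> \<epsilon> / 3"
      using tails[of "\<epsilon> / 3"] by auto
    have "(\<Sum>\<^sub>\<infinity>i. b i) = (\<Sum>i\<in>S. b i) + (\<Sum>\<^sub>\<infinity>i\<in>-S. b i)"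
    proof -
      have sb: "b summable_on X" for X
        using sum abs_summable_summable summable_on_subset_banach by blast
      show ?thesis
        using infsum_Un_disjoint[of b S "- S"] S(1) sb by simp
    qed
    moreover have "norm (\<Sum>\<^sub>\<infinity>i\<in>-S. b i) \<le> \<epsilon> / 3"
    proof -
      have s: "(\<lambda>i. norm (b i)) summable_on - S"
        using sum summable_on_subset_banach by blast
      have "norm (\<Sum>\<^sub>\<infinity>i\<in>-S. b i) \<le> (\<Sum>\<^sub>\<infinity>i\<in>-S. norm (b i))"
        by (rule norm_infsum_bound[OF s])
      also have "\<dots> \<le> \<epsilon> / 3"
        by (rule infsum_le_finite_sums[OF s]) (rule tb, rule S, auto)
      finally show ?thesis .
    qed
    ultimately have 1: "norm ((\<Sum>i\<in>S. b i) - (\<Sum>\<^sub>\<infinity>i. b i)) \<le> \<epsilon> / 3"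
      by simp
    have "(\<lambda>N. \<Sum>i\<in>S. a N i) \<longlonglongrightarrow> (\<Sum>i\<in>S. b i)"
      by (intro tendsto_intros lim)
    then have "\<forall>\<^sub>F N in sequentially. dist (\<Sum>i\<in>S. a N i) (\<Sum>i\<in>S. b i) < \<epsilon> / 3"
      using \<open>\<epsilon> > 0\<close> by (intro tendstoD) auto
    then show "\<forall>\<^sub>F N in sequentially. dist (\<Sum>i\<in>\<Lambda> N. a N i) (\<Sum>\<^sub>\<infinity>i. b i) < \<epsilon>"
    proof eventually_elim
      case (elim N)
      have "(\<Sum>i\<in>\<Lambda> N. a N i) = (\<Sum>i\<in>\<Lambda> N \<union> S. a N i)"
        using supp S by (intro sum.mono_neutral_left) auto
      also have "\<dots> = (\<Sum>i\<in>(\<Lambda> N - S) \<union> S. a N i)"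
        by (intro sum.cong) auto
      also have "\<dots> = (\<Sum>i\<in>\<Lambda> N - S. a N i) + (\<Sum>i\<in>S. a N i)"
        using supp S by (intro sum.union_disjoint) auto
      finally have "(\<Sum>i\<in>\<Lambda> N. a N i) - (\<Sum>\<^sub>\<infinity>i. b i) =
          (\<Sum>i\<in>\<Lambda> N - S. a N i) + ((\<Sum>i\<in>S. a N i) - (\<Sum>i\<in>S. b i)) + ((\<Sum>i\<in>S. b i) - (\<Sum>\<^sub>\<infinity>i. b i))" by simp
      also have "norm \<dots> \<le> norm (\<Sum>i\<in>\<Lambda> N - S. a N i) + norm ((\<Sum>i\<in>S. a N i) - (\<Sum>i\<in>S. b i)) + norm ((\<Sum>i\<in>S. b i) - (\<Sum>\<^sub>\<infinity>i. b i))"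
        by (intro norm_triangle_le add_mono norm_triangle_ineq order_refl)
      also have "norm (\<Sum>i\<in>\<Lambda> N - S. a N i) \<le> \<epsilon> / 3"
        by (rule order_trans[OF norm_sum S(2)]) (use supp in auto)
      also have "norm ((\<Sum>i\<in>S. a N i) - (\<Sum>i\<in>S. b i)) < \<epsilon> / 3"
        using elim by (simp add: dist_norm)
      finally show ?case using 1 by (simp add: dist_norm)
    qed
  qed
qed

definition ns_fourier :: "'n::finite tensor4 \<Rightarrow> ('n \<Rightarrow> int^'n \<Rightarrow> complex) \<Rightarrow> ('n \<Rightarrow> int^'n \<Rightarrow> complex) \<Rightarrow> (int^'n \<Rightarrow> complex) \<Rightarrow> bool" where
  "ns_fourier A f u p \<longleftrightarrow> (\<forall>k \<xi>.
     4 * (of_real pi)\<^sup>2 * (\<Sum>j\<in>UNIV. of_real (symbol A k j \<xi>) * u j \<xi>)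
     + 2 * of_real pi * \<i> * of_real (lattice_vec \<xi> $ k) * p \<xi>
     + (\<Sum>\<^sub>\<infinity>\<zeta>. advection u k \<xi> \<zeta>) = f k \<xi>)"

text \<open>Tychonoff for a product of discs. Countability of the index type makes the product first
  countable, so compactness gives convergent subsequences.\<close>

lemma pointwise_convergent_subseq:
  fixes u :: "nat \<Rightarrow> 'i::countable \<Rightarrow> complex"
  assumes "\<And>N i. cmod (u N i) \<le> B"
  obtains r v where "strict_mono (r :: nat \<Rightarrow> nat)" "\<And>i. (\<lambda>N. u (r N) i) \<longlonglongrightarrow> v i"
proof -
  have "compact (Pi\<^sub>E UNIV (\<lambda>_::'i. cball (0::complex) B))"
    using compactin_PiE[of "\<lambda>_. euclidean" UNIV "\<lambda>_::'i. cball (0::complex) B"]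
    by (simp add: euclidean_product_topology)
  then have "seq_compact (Pi\<^sub>E UNIV (\<lambda>_::'i. cball (0::complex) B))"
    by (rule compact_imp_seq_compact)
  moreover have "\<forall>N. u N \<in> Pi\<^sub>E UNIV (\<lambda>_::'i. cball (0::complex) B)"
    using assms by auto
  ultimately obtain v r where r: "strict_mono (r :: nat \<Rightarrow> nat)" "(u \<circ> r) \<longlonglongrightarrow> v"
    unfolding seq_compact_def by blast
  show ?thesis
  proof (rule that[OF r(1)])
    fix i
    have "continuous_on UNIV (\<lambda>x::'i \<Rightarrow> complex. x i)" by simp
    from continuous_on_tendsto_compose[OF this r(2)] show "(\<lambda>N. u (r N) i) \<longlonglongrightarrow> v i"
      by simp
  qed
qed

text \<open>Testing with a wave sees only the frequencies \<open>\<zeta>\<close> and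
  \<open>- \<zeta>\<close>, and there only the components orthogonal to \<open>\<zeta>\<close>. For
  fixed \<open>\<zeta>\<close> this is a finite expression, independent of \<open>\<Lambda>\<close>,
  so limits can be taken in it.\<close>

lemma wave_pairing:
  fixes g :: "'n::finite \<Rightarrow> int^'n \<Rightarrow> complex"
  assumes "finite \<Lambda>" "\<zeta> \<in> \<Lambda>" "- \<zeta> \<in> \<Lambda>" "\<zeta> \<noteq> 0"
  shows "(\<Sum>\<xi>\<in>\<Lambda>. \<Sum>k\<in>UNIV. cnj (wave (\<zeta>, l, b) k \<xi>) * g k \<xi>) =
    (\<Sum>k\<in>UNIV. of_real ((if k = l then (norm (lattice_vec \<zeta>))\<^sup>2 else 0) - lattice_vec \<zeta> $ l * lattice_vec \<zeta> $ k)
      * (cnj (amplitude b) * g k \<zeta> + amplitude b * g k (- \<zeta>)))"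
proof -
  have nz: "\<zeta> \<noteq> - \<zeta>"
    using \<open>\<zeta> \<noteq> 0\<close> by (auto simp: vec_eq_iff)
  have "(\<Sum>\<xi>\<in>\<Lambda>. cnj (wave (\<zeta>, l, b) k \<xi>) * g k \<xi>) =
    of_real ((if k = l then (norm (lattice_vec \<zeta>))\<^sup>2 else 0) - lattice_vec \<zeta> $ l * lattice_vec \<zeta> $ k)
      * (cnj (amplitude b) * g k \<zeta> + amplitude b * g k (- \<zeta>))" (is "_ = of_real ?d * _") for k
  proof -
    have "(\<Sum>\<xi>\<in>\<Lambda>. cnj (wave (\<zeta>, l, b) k \<xi>) * g k \<xi>) =
       of_real ?d * ((\<Sum>\<xi>\<in>\<Lambda>. if \<xi> = \<zeta> then cnj (amplitude b) * g k \<xi> else 0)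
         + (\<Sum>\<xi>\<in>\<Lambda>. if \<xi> = - \<zeta> then amplitude b * g k \<xi> else 0))"
      unfolding sum.distrib[symmetric] sum_distrib_left
      by (intro sum.cong refl) (use nz in \<open>auto simp: wave_def mult_ac\<close>)
    then show ?thesis using assms by simp
  qed
  then show ?thesis by (subst sum.swap) simp
qed

lemma advection_uminus:
  assumes "\<And>k. hermitian (u k)"
  shows "advection u k (- \<xi>) (- \<zeta>) = cnj (advection u k \<xi> \<zeta>)"
proof -
  have "u j (- \<xi> - - \<zeta>) = cnj (u j (\<xi> - \<zeta>))" for j
    using assms[of j] unfolding hermitian_def by (metis minus_diff_minus)
  then show ?thesis
    using assms[of k] by (simp add: advection_def hermitian_def sum_negf)
qed

lemma infsum_advection_uminus:
  assumes "\<And>k. hermitian (u k)"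
  shows "(\<Sum>\<^sub>\<infinity>\<zeta>. advection u k (- \<xi>) \<zeta>) = cnj (\<Sum>\<^sub>\<infinity>\<zeta>. advection u k \<xi> \<zeta>)"
proof -
  have "(\<Sum>\<^sub>\<infinity>\<zeta>. advection u k (- \<xi>) \<zeta>) = (\<Sum>\<^sub>\<infinity>\<zeta>. advection u k (- \<xi>) (- \<zeta>))"
    by (rule infsum_reindex_bij_witness[of _ uminus uminus]) auto
  then show ?thesis
    by (simp add: advection_uminus[OF assms])
qed

lemma norm_advection_le:
  "cmod (advection u k \<xi> \<zeta>) \<le> 2 * pi * norm (lattice_vec \<xi>) * (\<Sum>j\<in>UNIV. cmod (u k \<zeta>) * cmod (u j (\<xi> - \<zeta>)))"
proof -
  have "cmod (\<Sum>j\<in>UNIV. of_real (lattice_vec \<xi> $ j) * u j (\<xi> - \<zeta>)) \<le> (\<Sum>j\<in>UNIV. norm (lattice_vec \<xi>) * cmod (u j (\<xi> - \<zeta>)))"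
    by (rule sum_norm_le) (auto simp: norm_mult intro!: mult_right_mono component_le_norm_cart)
  then have "2 * pi * (cmod (\<Sum>j\<in>UNIV. of_real (lattice_vec \<xi> $ j) * u j (\<xi> - \<zeta>)) * cmod (u k \<zeta>))
      \<le> 2 * pi * ((\<Sum>j\<in>UNIV. norm (lattice_vec \<xi>) * cmod (u j (\<xi> - \<zeta>))) * cmod (u k \<zeta>))"
    by (intro mult_left_mono mult_right_mono) auto
  moreover have "cmod (advection u k \<xi> \<zeta>) = 2 * pi * (cmod (\<Sum>j\<in>UNIV. of_real (lattice_vec \<xi> $ j) * u j (\<xi> - \<zeta>)) * cmod (u k \<zeta>))"
    by (simp add: advection_def norm_mult)
  moreover have "2 * pi * ((\<Sum>j\<in>UNIV. norm (lattice_vec \<xi>) * cmod (u j (\<xi> - \<zeta>))) * cmod (u k \<zeta>))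
      = 2 * pi * norm (lattice_vec \<xi>) * (\<Sum>j\<in>UNIV. cmod (u k \<zeta>) * cmod (u j (\<xi> - \<zeta>)))"
    by (simp add: sum_distrib_left sum_distrib_right mult_ac)
  ultimately show ?thesis by simp
qed

text \<open>Outside the box of size \<open>M\<close> one has \<open>|\<zeta>| \<ge> M\<close>, so by
  Young's inequality the product of the two amplitudes is at most \<open>1 / (2 * M)\<close> times
  an energy term plus an \<open>L\<^sup>2\<close> term, both bounded uniformly in \<open>N\<close>.
  The conservative form matters here: its factor \<open>\<xi>\<close> is fixed, and the whole weight
  \<open>|\<zeta>|\<close> is available for this gain.\<close>

lemma tendsto_advection:
  fixes v :: "nat \<Rightarrow> 'n::finite \<Rightarrow> int^'n \<Rightarrow> complex"
  assumes lim: "\<And>k \<xi>. (\<lambda>N. v N k \<xi>) \<longlonglongrightarrow> u k \<xi>"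
    and supp: "\<And>N. finite (\<Lambda> N)" "\<And>N k \<xi>. \<xi> \<notin> \<Lambda> N \<Longrightarrow> v N k \<xi> = 0"
    and mean: "\<And>N k. v N k 0 = 0"
    and bound: "\<And>N k F. finite F \<Longrightarrow> (\<Sum>\<xi>\<in>F. (norm (lattice_vec \<xi>))\<^sup>2 * (cmod (v N k \<xi>))\<^sup>2) \<le> B"
  shows "(\<lambda>N. \<Sum>\<zeta>\<in>\<Lambda> N. advection (v N) k \<xi> \<zeta>) \<longlonglongrightarrow> (\<Sum>\<^sub>\<infinity>\<zeta>. advection u k \<xi> \<zeta>)"
proof -
  have l: "(\<lambda>N. advection (v N) k \<xi> \<zeta>) \<longlonglongrightarrow> advection u k \<xi> \<zeta>" for \<zeta>
    unfolding advection_def by (intro tendsto_intros lim)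
  have s: "advection (v N) k \<xi> \<zeta> = 0" if "\<zeta> \<notin> \<Lambda> N" for N \<zeta>
    using that supp by (simp add: advection_def)
  have bound0: "(\<Sum>\<xi>\<in>F. (cmod (v N k \<xi>))\<^sup>2) \<le> B" if "finite F" for F N k
  proof -
    have "(\<Sum>\<xi>\<in>F. (cmod (v N k \<xi>))\<^sup>2) \<le> (\<Sum>\<xi>\<in>F. (norm (lattice_vec \<xi>))\<^sup>2 * (cmod (v N k \<xi>))\<^sup>2)"
    proof (rule sum_mono)
      fix \<xi>
      show "(cmod (v N k \<xi>))\<^sup>2 \<le> (norm (lattice_vec \<xi>))\<^sup>2 * (cmod (v N k \<xi>))\<^sup>2"
      proof (cases "\<xi> = 0")
        case False
        then have "1 \<le> (norm (lattice_vec \<xi>))\<^sup>2"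
          by (intro one_le_power norm_lattice_vec_ge_1)
        then show ?thesis
          using mult_right_mono[of 1 _ "(cmod (v N k \<xi>))\<^sup>2"] by simp
      qed (simp add: mean)
    qed
    with bound[OF that, of N k] show ?thesis by linarith
  qed
  have B0: "B \<ge> 0" using bound[of "{}"] by simp
  have t: "\<exists>S. finite S \<and> (\<forall>N F. finite F \<and> F \<inter> S = {} \<longrightarrow> (\<Sum>\<zeta>\<in>F. norm (advection (v N) k \<xi> \<zeta>)) \<le> \<delta>)"
    if "\<delta> > 0" for \<delta>
  proof -
    define C where "C = 2 * pi * norm (lattice_vec \<xi>)"
    \<comment> \<open>Summing over the \<open>n\<close> components, each with bound
      \<open>B + B\<close> and prefactor \<open>C / (2 * M)\<close>, gives a tail of at most
      \<open>D / M\<close>.\<close>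
    define D where "D = C * (real CARD('n) * B)"
    have C0: "C \<ge> 0" and D0: "D \<ge> 0" using B0 by (simp_all add: C_def D_def)
    \<comment> \<open>The added 1 keeps \<open>M\<close> positive even when
      \<open>D = 0\<close>.\<close>
    obtain M :: nat where M: "D / \<delta> + 1 \<le> real M" by (meson real_arch_simple)
    then have Mpos: "real M > 0"
      using D0 that by (smt (verit) divide_nonneg_pos)
    have MD: "D / real M \<le> \<delta>"
    proof -
      have "D / \<delta> \<le> real M" using M by simp
      then show ?thesis using that Mpos by (simp add: field_simps)
    qed
    show ?thesis
    proof (intro exI[of _ "box_freqs M"] conjI allI impI finite_box_freqs)
      fix N and F :: "(int^'n) set" assume F: "finite F \<and> F \<inter> box_freqs M = {}"
      have "(\<Sum>\<zeta>\<in>F. norm (advection (v N) k \<xi> \<zeta>)) \<le>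
        (\<Sum>\<zeta>\<in>F. \<Sum>j\<in>UNIV. C / (2 * real M) * ((cmod (v N j (\<xi> - \<zeta>)))\<^sup>2 + (norm (lattice_vec \<zeta>))\<^sup>2 * (cmod (v N k \<zeta>))\<^sup>2))"
      proof (rule sum_mono)
        fix \<zeta> assume "\<zeta> \<in> F"
        then have lower: "real M \<le> norm (lattice_vec \<zeta>)"
          using F by (intro not_in_box_freqs_norm) auto
        have "norm (advection (v N) k \<xi> \<zeta>) \<le> (\<Sum>j\<in>UNIV. C * (cmod (v N k \<zeta>) * cmod (v N j (\<xi> - \<zeta>))))"
          using norm_advection_le[of "v N" k \<xi> \<zeta>] by (simp add: C_def sum_distrib_left)
        also have "\<dots> \<le> (\<Sum>j\<in>UNIV. C / (2 * real M) * ((cmod (v N j (\<xi> - \<zeta>)))\<^sup>2 + (norm (lattice_vec \<zeta>))\<^sup>2 * (cmod (v N k \<zeta>))\<^sup>2))"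
        proof (rule sum_mono)
          fix j
          let ?a = "cmod (v N k \<zeta>)" and ?b = "cmod (v N j (\<xi> - \<zeta>))" and ?l = "norm (lattice_vec \<zeta>)"
          have "2 * (real M * (?a * ?b)) \<le> 2 * (?l * (?a * ?b))"
            using lower by (intro mult_left_mono mult_right_mono) auto
          also have "\<dots> \<le> ?b\<^sup>2 + ?l\<^sup>2 * ?a\<^sup>2"
            using sum_squares_bound[of ?b "?l * ?a"] by (simp add: power_mult_distrib mult_ac)
          finally have "?a * ?b \<le> (?b\<^sup>2 + ?l\<^sup>2 * ?a\<^sup>2) / (2 * real M)"
            using Mpos by (simp add: field_simps)
          then have "C * (?a * ?b) \<le> C * ((?b\<^sup>2 + ?l\<^sup>2 * ?a\<^sup>2) / (2 * real M))"
            using C0 by (rule mult_left_mono)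
          then show "C * (?a * ?b) \<le> C / (2 * real M) * (?b\<^sup>2 + ?l\<^sup>2 * ?a\<^sup>2)" by simp
        qed
        finally show "norm (advection (v N) k \<xi> \<zeta>) \<le> (\<Sum>j\<in>UNIV. C / (2 * real M) * ((cmod (v N j (\<xi> - \<zeta>)))\<^sup>2 + (norm (lattice_vec \<zeta>))\<^sup>2 * (cmod (v N k \<zeta>))\<^sup>2))" .
      qed
      also have "\<dots> = (\<Sum>j\<in>UNIV. C / (2 * real M) * ((\<Sum>\<zeta>\<in>F. (cmod (v N j (\<xi> - \<zeta>)))\<^sup>2) + (\<Sum>\<zeta>\<in>F. (norm (lattice_vec \<zeta>))\<^sup>2 * (cmod (v N k \<zeta>))\<^sup>2)))"
        by (subst sum.swap) (simp add: sum_distrib_left sum.distrib distrib_left)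
      also have "\<dots> \<le> (\<Sum>j\<in>(UNIV::'n set). C / (2 * real M) * (B + B))"
      proof (intro sum_mono mult_left_mono add_mono)
        fix j
        have "(\<Sum>\<zeta>\<in>F. (cmod (v N j (\<xi> - \<zeta>)))\<^sup>2) = (\<Sum>\<zeta>\<in>(\<lambda>\<zeta>. \<xi> - \<zeta>) ` F. (cmod (v N j \<zeta>))\<^sup>2)"
          by (subst sum.reindex) (auto simp: inj_on_def)
        also have "\<dots> \<le> B" using F by (intro bound0) auto
        finally show "(\<Sum>\<zeta>\<in>F. (cmod (v N j (\<xi> - \<zeta>)))\<^sup>2) \<le> B" .
      qed (use F bound C0 in auto)
      also have "\<dots> = D / real M" by (simp add: D_def)
      also have "\<dots> \<le> \<delta>" by (rule MD)
      finally show "(\<Sum>\<zeta>\<in>F. norm (advection (v N) k \<xi> \<zeta>)) \<le> \<delta>" .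
    qed
  qed
  show "(\<lambda>N. \<Sum>\<zeta>\<in>\<Lambda> N. advection (v N) k \<xi> \<zeta>) \<longlonglongrightarrow> (\<Sum>\<^sub>\<infinity>\<zeta>. advection u k \<xi> \<zeta>)"
    by (rule tendsto_sum_infsum[where \<Lambda>=\<Lambda>, OF l supp(1) s t])
qed

lemma ns_fourier_exists:
  fixes A :: "'n::finite tensor4" and f :: "'n \<Rightarrow> int^'n \<Rightarrow> complex"
  assumes A: "tensor_symmetric A" "relaxed_elliptic A"
    and f: "\<And>k. hermitian (f k)" "\<And>k. f k 0 = 0" "\<And>k. sobolev (- 1) (f k)"
  shows "\<exists>u p. (\<forall>k. hermitian (u k)) \<and> solenoidal u \<and> (\<forall>k. u k 0 = 0) \<and> (\<forall>k. sobolev 1 (u k))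
    \<and> hermitian p \<and> p 0 = 0 \<and> ns_fourier A f u p"
proof -
  obtain c where c: "c > 0" and ell: "\<And>\<xi> (v::'n \<Rightarrow> complex). (\<Sum>k\<in>UNIV. of_real (lattice_vec \<xi> $ k) * v k) = 0 \<Longrightarrow>
      c * ((norm (lattice_vec \<xi>))\<^sup>2 * (\<Sum>k\<in>UNIV. (cmod (v k))\<^sup>2))
        \<le> Re (\<Sum>k\<in>UNIV. cnj (v k) * (\<Sum>j\<in>UNIV. of_real (symbol A k j \<xi>) * v j))"
    using elliptic_symbol[OF A] by blast
  \<comment> \<open>\<open>K\<close> is the squared \<open>H\<^sup>-\<^sup>1\<close> norm of the
    force over \<open>c\<close>. The factor 2 in \<open>2 * c * K\<close> pays for replacing
    \<open>|\<xi>|^2\<close> by \<open>weight \<xi> / 2\<close>.\<close>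
  define K where "K = (\<Sum>k\<in>UNIV. \<Sum>\<^sub>\<infinity>\<xi>. weight \<xi> powr - 1 * (cmod (f k \<xi>))\<^sup>2) / c"
  have K0: "K \<ge> 0" unfolding K_def using c by (intro divide_nonneg_pos sum_nonneg infsum_nonneg) auto
  define \<Lambda> :: "nat \<Rightarrow> (int^'n) set" where "\<Lambda> = (\<lambda>N. box_freqs N - {0})"
  have \<Lambda>: "finite (\<Lambda> N)" "0 \<notin> \<Lambda> N" "\<And>\<xi>. \<xi> \<in> \<Lambda> N \<Longrightarrow> - \<xi> \<in> \<Lambda> N" for N
    using finite_box_freqs uminus_box_freqs by (auto simp: \<Lambda>_def)
  have fK: "(\<Sum>\<xi>\<in>\<Lambda> N. \<Sum>k\<in>UNIV. (cmod (f k \<xi>))\<^sup>2 / (norm (lattice_vec \<xi>))\<^sup>2) \<le> 2 * c * K" for N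
  proof -
    have "(\<Sum>\<xi>\<in>\<Lambda> N. \<Sum>k\<in>UNIV. (cmod (f k \<xi>))\<^sup>2 / (norm (lattice_vec \<xi>))\<^sup>2)
      \<le> (\<Sum>\<xi>\<in>\<Lambda> N. \<Sum>k\<in>UNIV. 2 * (weight \<xi> powr - 1 * (cmod (f k \<xi>))\<^sup>2))"
    proof (intro sum_mono)
      fix \<xi> k assume "\<xi> \<in> \<Lambda> N"
      then have "\<xi> \<noteq> 0" using \<Lambda> by auto
      from weight_le_2_norm[OF this] norm_lattice_vec_ge_1[OF this]
      have "(cmod (f k \<xi>))\<^sup>2 / (norm (lattice_vec \<xi>))\<^sup>2 \<le> (cmod (f k \<xi>))\<^sup>2 / (weight \<xi> / 2)"
        by (intro divide_left_mono mult_pos_pos) auto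
      then show "(cmod (f k \<xi>))\<^sup>2 / (norm (lattice_vec \<xi>))\<^sup>2 \<le> 2 * (weight \<xi> powr - 1 * (cmod (f k \<xi>))\<^sup>2)"
        by (simp add: powr_minus_divide field_simps)
    qed
    also have "\<dots> = 2 * (\<Sum>k\<in>UNIV. \<Sum>\<xi>\<in>\<Lambda> N. weight \<xi> powr - 1 * (cmod (f k \<xi>))\<^sup>2)"
      by (subst sum.swap) (simp add: sum_distrib_left)
    also have "\<dots> \<le> 2 * (\<Sum>k\<in>UNIV. \<Sum>\<^sub>\<infinity>\<xi>. weight \<xi> powr - 1 * (cmod (f k \<xi>))\<^sup>2)"
      using f(3) \<Lambda>(1) unfolding sobolev_def
      by (intro mult_left_mono sum_mono finite_sum_le_infsum) auto
    also have "\<dots> = 2 * c * K" using c by (simp add: K_def)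
    finally show ?thesis .
  qed
  \<comment> \<open>The regularization is removed together with the truncation, along one and the
    same sequence.\<close>
  define \<epsilon> where "\<epsilon> = (\<lambda>N. 1 / (real N + 1))"
  have \<epsilon>: "\<epsilon> N > 0" for N by (simp add: \<epsilon>_def add_pos_pos)
  define Q where "Q = (\<lambda>N u. (\<forall>k. hermitian (u k)) \<and> solenoidal u \<and> (\<forall>k \<xi>. \<xi> \<notin> \<Lambda> N \<longrightarrow> u k \<xi> = 0)
    \<and> c / 2 * (\<Sum>\<xi>\<in>\<Lambda> N. \<Sum>k\<in>UNIV. (norm (lattice_vec \<xi>))\<^sup>2 * (cmod (u k \<xi>))\<^sup>2) \<le> K
    \<and> (\<forall>\<zeta>\<in>\<Lambda> N. \<forall>l b. (Re (\<Sum>\<xi>\<in>\<Lambda> N. \<Sum>k\<in>UNIV. cnj (wave (\<zeta>, l, b) k \<xi>) * galerkin_residual A f (\<Lambda> N) u k \<xi>))\<^sup>2 \<le> \<epsilon> N * K))"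
  have "\<exists>u. Q N u" for N
    unfolding Q_def by (rule galerkin_exists[OF c ell \<Lambda> fK \<epsilon> K0])
  then obtain U where Q: "\<And>N. Q N (U N)" by metis
  then have U: "\<And>N k. hermitian (U N k)" "\<And>N. solenoidal (U N)" "\<And>N k \<xi>. \<xi> \<notin> \<Lambda> N \<Longrightarrow> U N k \<xi> = 0"
      "\<And>N. c / 2 * (\<Sum>\<xi>\<in>\<Lambda> N. \<Sum>k\<in>UNIV. (norm (lattice_vec \<xi>))\<^sup>2 * (cmod (U N k \<xi>))\<^sup>2) \<le> K"
      "\<And>N \<zeta> l b. \<zeta> \<in> \<Lambda> N \<Longrightarrow> (Re (\<Sum>\<xi>\<in>\<Lambda> N. \<Sum>k\<in>UNIV. cnj (wave (\<zeta>, l, b) k \<xi>) * galerkin_residual A f (\<Lambda> N) (U N) k \<xi>))\<^sup>2 \<le> \<epsilon> N * K"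
    unfolding Q_def by simp_all
  define B where "B = 2 * K / c"
  have boundU: "(\<Sum>\<xi>\<in>F. (norm (lattice_vec \<xi>))\<^sup>2 * (cmod (U N k \<xi>))\<^sup>2) \<le> B" if F: "finite F" for F N k
  proof -
    have "(\<Sum>\<xi>\<in>F. (norm (lattice_vec \<xi>))\<^sup>2 * (cmod (U N k \<xi>))\<^sup>2) \<le> (\<Sum>\<xi>\<in>F \<union> \<Lambda> N. (norm (lattice_vec \<xi>))\<^sup>2 * (cmod (U N k \<xi>))\<^sup>2)"
      using F \<Lambda> by (intro sum_mono2) auto
    also have "\<dots> = (\<Sum>\<xi>\<in>\<Lambda> N. (norm (lattice_vec \<xi>))\<^sup>2 * (cmod (U N k \<xi>))\<^sup>2)"
      using F \<Lambda> U(3) by (intro sum.mono_neutral_right) auto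
    also have "\<dots> \<le> (\<Sum>\<xi>\<in>\<Lambda> N. \<Sum>k\<in>UNIV. (norm (lattice_vec \<xi>))\<^sup>2 * (cmod (U N k \<xi>))\<^sup>2)"
      by (intro sum_mono member_le_sum) auto
    also have "\<dots> \<le> B"
      using U(4)[of N] c by (simp add: B_def field_simps)
    finally show ?thesis .
  qed
  have U0: "U N k 0 = 0" for N k using U(3) \<Lambda>(2) by blast
  have "cmod (U N k \<xi>) \<le> sqrt B" for N k \<xi>
  proof (cases "\<xi> = 0")
    case True
    have "B \<ge> 0" using K0 c by (simp add: B_def)
    then show ?thesis using True U0 by simp
  next
    case False
    then have "1 \<le> (norm (lattice_vec \<xi>))\<^sup>2" by (intro one_le_power norm_lattice_vec_ge_1)
    then have "(cmod (U N k \<xi>))\<^sup>2 \<le> (norm (lattice_vec \<xi>))\<^sup>2 * (cmod (U N k \<xi>))\<^sup>2"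
      using mult_right_mono[of 1 _ "(cmod (U N k \<xi>))\<^sup>2"] by simp
    also have "\<dots> \<le> B" using boundU[of "{\<xi>}"] by simp
    finally show ?thesis by (rule real_le_rsqrt)
  qed
  then have "cmod ((\<lambda>(k, \<xi>). U N k \<xi>) i) \<le> sqrt B" for N i by (cases i) simp
  from pointwise_convergent_subseq[of "\<lambda>N (k, \<xi>). U N k \<xi>", OF this]
  obtain r v where r: "strict_mono r" and v: "\<And>i. (\<lambda>N. (\<lambda>(k, \<xi>). U (r N) k \<xi>) i) \<longlonglongrightarrow> v i"
    by blast
  define u where "u = (\<lambda>k \<xi>. v (k, \<xi>))"
  have lim: "(\<lambda>N. U (r N) k \<xi>) \<longlonglongrightarrow> u k \<xi>" for k \<xi>
    using v[of "(k, \<xi>)"] by (simp add: u_def)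
  have u_herm: "hermitian (u k)" for k
    unfolding hermitian_def
  proof
    fix \<xi>
    have "(\<lambda>N. U (r N) k (- \<xi>)) \<longlonglongrightarrow> cnj (u k \<xi>)"
      using tendsto_cnj[OF lim[of k \<xi>]] U(1) by (simp add: hermitian_def)
    then show "u k (- \<xi>) = cnj (u k \<xi>)" using lim LIMSEQ_unique by blast
  qed
  have u_sol: "solenoidal u"
    unfolding solenoidal_def
  proof
    fix \<xi>
    have "(\<lambda>N. \<Sum>k\<in>UNIV. of_real (lattice_vec \<xi> $ k) * U (r N) k \<xi>) \<longlonglongrightarrow> (\<Sum>k\<in>UNIV. of_real (lattice_vec \<xi> $ k) * u k \<xi>)"
      by (intro tendsto_intros lim)
    moreover have "(\<Sum>k\<in>UNIV. of_real (lattice_vec \<xi> $ k) * U (r N) k \<xi>) = 0" for N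
      using U(2) by (simp add: solenoidal_def)
    ultimately show "(\<Sum>k\<in>UNIV. of_real (lattice_vec \<xi> $ k) * u k \<xi>) = 0"
      by (simp add: LIMSEQ_const_iff)
  qed
  have u0: "u k 0 = 0" for k
    using lim[of k 0] U0 by (simp add: LIMSEQ_const_iff)
  have boundu: "(\<Sum>\<xi>\<in>F. (norm (lattice_vec \<xi>))\<^sup>2 * (cmod (u k \<xi>))\<^sup>2) \<le> B" if F: "finite F" for F k
    by (rule LIMSEQ_le_const2[where X="\<lambda>N. \<Sum>\<xi>\<in>F. (norm (lattice_vec \<xi>))\<^sup>2 * (cmod (U (r N) k \<xi>))\<^sup>2"])
       (use boundU[OF F] in \<open>auto intro!: tendsto_intros lim\<close>)
  have u_sob: "sobolev 1 (u k)" for k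
    unfolding sobolev_def
  proof (rule nonneg_bdd_above_summable_on)
    show "bdd_above (sum (\<lambda>\<xi>. weight \<xi> powr 1 * (cmod (u k \<xi>))\<^sup>2) ` {F. F \<subseteq> UNIV \<and> finite F})"
    proof (rule bdd_aboveI2)
      fix F :: "(int^'n) set" assume "F \<in> {F. F \<subseteq> UNIV \<and> finite F}"
      then have F: "finite F" by simp
      have "(\<Sum>\<xi>\<in>F. weight \<xi> powr 1 * (cmod (u k \<xi>))\<^sup>2) \<le> (\<Sum>\<xi>\<in>F. 2 * ((norm (lattice_vec \<xi>))\<^sup>2 * (cmod (u k \<xi>))\<^sup>2))"
      proof (rule sum_mono)
        fix \<xi>
        show "weight \<xi> powr 1 * (cmod (u k \<xi>))\<^sup>2 \<le> 2 * ((norm (lattice_vec \<xi>))\<^sup>2 * (cmod (u k \<xi>))\<^sup>2)"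
          using mult_right_mono[OF weight_le_2_norm[of \<xi>], of "(cmod (u k \<xi>))\<^sup>2"]
          by (cases "\<xi> = 0") (auto simp: u0)
      qed
      also have "\<dots> \<le> 2 * B" using boundu[OF F] by (simp flip: sum_distrib_left)
      finally show "(\<Sum>\<xi>\<in>F. weight \<xi> powr 1 * (cmod (u k \<xi>))\<^sup>2) \<le> 2 * B" .
    qed
  qed simp
  have adv: "(\<lambda>N. \<Sum>\<zeta>\<in>\<Lambda> (r N). advection (U (r N)) k \<xi> \<zeta>) \<longlonglongrightarrow> (\<Sum>\<^sub>\<infinity>\<zeta>. advection u k \<xi> \<zeta>)" for k \<xi>
    using tendsto_advection[of "\<lambda>N. U (r N)" u "\<lambda>N. \<Lambda> (r N)" B k \<xi>, OF lim \<Lambda>(1) U(3) U0 boundU] .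
  define R where "R = (\<lambda>k \<xi>. 4 * (of_real pi)\<^sup>2 * (\<Sum>j\<in>UNIV. of_real (symbol A k j \<xi>) * u j \<xi>) + (\<Sum>\<^sub>\<infinity>\<zeta>. advection u k \<xi> \<zeta>) - f k \<xi>)"
  have limR: "(\<lambda>N. galerkin_residual A f (\<Lambda> (r N)) (U (r N)) k \<xi>) \<longlonglongrightarrow> R k \<xi>" for k \<xi>
    unfolding galerkin_residual_def R_def by (intro tendsto_intros lim adv)
  have R_herm: "R k (- \<xi>) = cnj (R k \<xi>)" for k \<xi>
  proof -
    have "symbol A k j (- \<xi>) = symbol A k j \<xi>" for j by (simp add: symbol_def)
    then show ?thesis
      using u_herm f(1) infsum_advection_uminus[of u k \<xi>, OF u_herm] by (simp add: R_def hermitian_def)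
  qed
  \<comment> \<open>\<open>X\<close> is \<open>|\<zeta>|^2\<close> times the projection of the limit
    residual orthogonal to \<open>\<zeta>\<close>. Its vanishing says that the residual is a
    gradient.\<close>
  define X where "X = (\<lambda>l \<zeta>. \<Sum>k\<in>UNIV. of_real ((if k = l then (norm (lattice_vec \<zeta>))\<^sup>2 else 0) - lattice_vec \<zeta> $ l * lattice_vec \<zeta> $ k) * R k \<zeta>)"
  have X0: "X l \<zeta> = 0" if \<zeta>: "\<zeta> \<noteq> 0" for l \<zeta>
  proof -
    let ?d = "\<lambda>k. (if k = l then (norm (lattice_vec \<zeta>))\<^sup>2 else 0) - lattice_vec \<zeta> $ l * lattice_vec \<zeta> $ k"
    have "Re (cnj (amplitude b) * X l \<zeta>) = 0" for b
    proof -
      \<comment> \<open>\<open>Y\<close> is the wave pairing written at the two frequencies only,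
        hence continuous under coefficientwise limits, with square at most
        \<open>\<epsilon> (r N) * K\<close>. By the reality of \<open>R\<close> the contributions of
        \<open>\<zeta>\<close> and \<open>- \<zeta>\<close> to \<open>Y R\<close> are conjugate,
        which gives twice a real part.\<close>
      define Y where "Y = (\<lambda>g. Re (\<Sum>k\<in>UNIV. of_real (?d k) * (cnj (amplitude b) * g k \<zeta> + amplitude b * g k (- \<zeta>))))"
      have 1: "(\<lambda>N. Y (galerkin_residual A f (\<Lambda> (r N)) (U (r N)))) \<longlonglongrightarrow> Y R"
        unfolding Y_def by (intro tendsto_intros limR)
      have "eventually (\<lambda>N. \<zeta> \<in> \<Lambda> N) sequentially"
        using eventually_in_box_freqs[of \<zeta>] \<zeta> by (simp add: \<Lambda>_def)
      then have "eventually (\<lambda>N. \<zeta> \<in> \<Lambda> (r N)) sequentially"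
        by (rule eventually_subseq[OF r])
      then have "eventually (\<lambda>N. (Y (galerkin_residual A f (\<Lambda> (r N)) (U (r N))))\<^sup>2 \<le> \<epsilon> (r N) * K) sequentially"
      proof eventually_elim
        case (elim N)
        show ?case
          using U(5)[OF elim, of l b] wave_pairing[OF \<Lambda>(1) elim \<Lambda>(3)[OF elim] \<zeta>, of l b]
          by (simp add: Y_def)
      qed
      moreover have "(\<lambda>N. \<epsilon> (r N) * K) \<longlonglongrightarrow> 0 * K"
      proof (intro tendsto_intros)
        have "\<epsilon> \<longlonglongrightarrow> 0" unfolding \<epsilon>_def using LIMSEQ_inverse_real_of_nat by (simp add: inverse_eq_divide add.commute)
        from LIMSEQ_subseq_LIMSEQ[OF this r] show "(\<lambda>N. \<epsilon> (r N)) \<longlonglongrightarrow> 0" by (simp add: o_def)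
      qed
      ultimately have "(Y R)\<^sup>2 \<le> 0 * K"
        using tendsto_power[OF 1, of 2] by (intro tendsto_le[OF sequentially_bot]) auto
      then have "Y R = 0" by simp
      moreover have "Y R = 2 * Re (cnj (amplitude b) * X l \<zeta>)"
      proof -
        have e: "(\<Sum>k\<in>UNIV. of_real (?d k) * (cnj (amplitude b) * R k \<zeta> + amplitude b * R k (- \<zeta>)))
          = cnj (amplitude b) * X l \<zeta> + cnj (cnj (amplitude b) * X l \<zeta>)"
          unfolding X_def cnj_sum complex_cnj_mult sum_distrib_left sum.distrib[symmetric]
          by (intro sum.cong refl) (simp add: R_herm algebra_simps)
        show ?thesis unfolding Y_def e by simp
      qed
      ultimately show ?thesis by simp
    qed
    \<comment> \<open>Amplitude 1 yields the real part of \<open>X l \<zeta>\<close>, amplitude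
      \<open>\<i>\<close> its imaginary part.\<close>
    from this[of True] this[of False] show "X l \<zeta> = 0"
      by (simp add: amplitude_def complex_eq_iff)
  qed
  \<comment> \<open>This solves \<open>2 * pi * \<i> * \<xi> * p = - R\<close> in the direction of
    \<open>\<xi>\<close>. At \<open>\<xi> = 0\<close> the quotient is 0, which makes the pressure
    mean-free.\<close>
  define p where "p = (\<lambda>\<xi>. \<i> * (\<Sum>k\<in>UNIV. of_real (lattice_vec \<xi> $ k) * R k \<xi>) / of_real (2 * pi * (norm (lattice_vec \<xi>))\<^sup>2))"
  show ?thesis
  proof (intro exI[of _ u] exI[of _ p] conjI allI u_herm u_sol u0 u_sob)
    show "hermitian p"
      by (simp add: hermitian_def p_def R_herm sum_negf)
    show "p 0 = 0" by (simp add: p_def)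
    show "ns_fourier A f u p"
      unfolding ns_fourier_def
    proof (intro allI)
      fix k \<xi>
      have "R k \<xi> + 2 * of_real pi * \<i> * of_real (lattice_vec \<xi> $ k) * p \<xi> = 0"
      proof (cases "\<xi> = 0")
        \<comment> \<open>At frequency 0 the elliptic and advection terms carry a factor
          \<open>\<xi>\<close>; the mean-free force is the compatibility condition.\<close>
        case True
        then show ?thesis by (simp add: R_def symbol_def advection_def f(2))
      next
        case False
        let ?L = "lattice_vec \<xi>"
        have n: "norm ?L > 0" using norm_lattice_vec_ge_1[OF False] by linarith
        have "X k \<xi> = (\<Sum>j\<in>UNIV. (if j = k then of_real ((norm ?L)\<^sup>2) * R j \<xi> else 0)) - of_real (?L $ k) * (\<Sum>j\<in>UNIV. of_real (?L $ j) * R j \<xi>)"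
          unfolding X_def sum_distrib_left sum_subtractf[symmetric]
          by (intro sum.cong refl) (auto simp: algebra_simps)
        then have "of_real ((norm ?L)\<^sup>2) * R k \<xi> = of_real (?L $ k) * (\<Sum>j\<in>UNIV. of_real (?L $ j) * R j \<xi>)"
          using X0[OF False, of k] by simp
        then have "R k \<xi> = of_real (?L $ k) * (\<Sum>j\<in>UNIV. of_real (?L $ j) * R j \<xi>) / of_real ((norm ?L)\<^sup>2)"
          using n by (simp add: field_simps)
        then show ?thesis using n by (simp add: p_def field_simps)
      qed
      then show "4 * (of_real pi)\<^sup>2 * (\<Sum>j\<in>UNIV. of_real (symbol A k j \<xi>) * u j \<xi>)
     + 2 * of_real pi * \<i> * of_real (lattice_vec \<xi> $ k) * p \<xi>
     + (\<Sum>\<^sub>\<infinity>\<zeta>. advection u k \<xi> \<zeta>) = f k \<xi>"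
        by (simp add: R_def algebra_simps)
    qed
  qed
qed

subsection \<open>Regularity\<close>

lemma norm_infsum_advection_le:
  fixes u :: "'n::finite \<Rightarrow> int^'n \<Rightarrow> complex"
  assumes card: "CARD('n) \<le> 3" and u: "\<And>k. sobolev 1 (u k)"
  shows "cmod (\<Sum>\<^sub>\<infinity>\<zeta>. advection u k \<xi> \<zeta>) \<le> 2 * pi * norm (lattice_vec \<xi>) * (\<Sum>j\<in>UNIV. abs_conv (u k) (u j) \<xi>)"
proof -
  have conv: "(\<lambda>\<zeta>. cmod (u k \<zeta>) * cmod (u j (\<xi> - \<zeta>))) summable_on UNIV" for j
    by (rule sobolev_convolution_0(1)[OF u u]) (use card in auto)
  have "((\<lambda>\<zeta>. 2 * pi * norm (lattice_vec \<xi>) * (\<Sum>j\<in>UNIV. cmod (u k \<zeta>) * cmod (u j (\<xi> - \<zeta>)))) has_sum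
      2 * pi * norm (lattice_vec \<xi>) * (\<Sum>j\<in>UNIV. abs_conv (u k) (u j) \<xi>)) UNIV"
    unfolding abs_conv_def by (intro has_sum_cmult_right has_sum_sum finite has_sum_infsum conv)
  note s = has_sum_imp_summable[OF this] and i = infsumI[OF this]
  have a: "(\<lambda>\<zeta>. norm (advection u k \<xi> \<zeta>)) summable_on UNIV"
    by (rule summable_on_comparison_test[OF s norm_advection_le]) auto
  have "cmod (\<Sum>\<^sub>\<infinity>\<zeta>. advection u k \<xi> \<zeta>) \<le> (\<Sum>\<^sub>\<infinity>\<zeta>. cmod (advection u k \<xi> \<zeta>))"
    by (rule norm_infsum_bound[OF a])
  also have "\<dots> \<le> (\<Sum>\<^sub>\<infinity>\<zeta>. 2 * pi * norm (lattice_vec \<xi>) * (\<Sum>j\<in>UNIV. cmod (u k \<zeta>) * cmod (u j (\<xi> - \<zeta>))))"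
    by (rule infsum_mono[OF a s norm_advection_le])
  also have "\<dots> = 2 * pi * norm (lattice_vec \<xi>) * (\<Sum>j\<in>UNIV. abs_conv (u k) (u j) \<xi>)"
    by (rule i)
  finally show "cmod (\<Sum>\<^sub>\<infinity>\<zeta>. advection u k \<xi> \<zeta>) \<le> 2 * pi * norm (lattice_vec \<xi>) * (\<Sum>j\<in>UNIV. abs_conv (u k) (u j) \<xi>)" .
qed

text \<open>Testing the equation at the single frequency \<open>\<xi>\<close> with \<open>u\<close>
  itself removes the pressure, and coercivity gains \<open>|\<xi>|^2\<close>. Since the advection
  costs one factor \<open>|\<xi>|\<close>, dividing by the weight leaves powers \<open>- 1\<close>
  on the force and \<open>- 1/2\<close> on the convolution. \<open>C\<close> depends only on
  \<open>A\<close>, through its ellipticity constant.\<close>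

lemma ns_fourier_velocity_bound:
  fixes A :: "'n::finite tensor4"
  assumes card: "CARD('n) \<le> 3" and A: "tensor_symmetric A" "relaxed_elliptic A"
  obtains C where "\<And>(f :: 'n \<Rightarrow> int^'n \<Rightarrow> complex) u p k \<xi>. ns_fourier A f u p \<Longrightarrow> solenoidal u \<Longrightarrow>
    (\<And>k. sobolev 1 (u k)) \<Longrightarrow> \<xi> \<noteq> 0 \<Longrightarrow>
    cmod (u k \<xi>) \<le> C * ((\<Sum>l\<in>UNIV. weight \<xi> powr - 1 * norm (f l \<xi>))
       + (\<Sum>l\<in>UNIV. \<Sum>j\<in>UNIV. weight \<xi> powr (- 1/2) * norm (abs_conv (u l) (u j) \<xi>)))"
proof -
  obtain c where c: "c > 0" and ell: "\<And>\<xi> (v::'n \<Rightarrow> complex). (\<Sum>k\<in>UNIV. of_real (lattice_vec \<xi> $ k) * v k) = 0 \<Longrightarrow>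
      c * ((norm (lattice_vec \<xi>))\<^sup>2 * (\<Sum>k\<in>UNIV. (cmod (v k))\<^sup>2))
        \<le> Re (\<Sum>k\<in>UNIV. cnj (v k) * (\<Sum>j\<in>UNIV. of_real (symbol A k j \<xi>) * v j))"
    using elliptic_symbol[OF A] by blast
  show ?thesis
  \<comment> \<open>The 2 comes from \<open>weight_le_2_norm\<close> and \<open>2 * pi\<close> from
    the derivative in the advection. The force is enlarged by \<open>2 * pi\<close> as well, so that
    a single factor can be pulled out.\<close>
  proof (rule that[of "2 / c * (2 * pi)"])
    fix f u :: "'n \<Rightarrow> int^'n \<Rightarrow> complex" and p and k and \<xi> :: "int^'n"
    assume ns: "ns_fourier A f u p" and sol: "solenoidal u" and sob: "\<And>k. sobolev 1 (u k)" and \<xi>: "\<xi> \<noteq> 0"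
    define l where "l = norm (lattice_vec \<xi>)"
    have l: "l \<ge> 1" using norm_lattice_vec_ge_1[OF \<xi>] by (simp add: l_def)
    have div: "(\<Sum>k\<in>UNIV. of_real (lattice_vec \<xi> $ k) * u k \<xi>) = 0"
      using sol by (simp add: solenoidal_def)
    define g where "g = (\<lambda>k. f k \<xi> - (\<Sum>\<^sub>\<infinity>\<zeta>. advection u k \<xi> \<zeta>))"
    have eq: "4 * (of_real pi)\<^sup>2 * (\<Sum>j\<in>UNIV. of_real (symbol A k j \<xi>) * u j \<xi>) = g k - 2 * of_real pi * \<i> * p \<xi> * of_real (lattice_vec \<xi> $ k)" for k
      using ns[unfolded ns_fourier_def, rule_format, of k \<xi>] by (simp add: g_def algebra_simps)
    define m where "m = sqrt (\<Sum>k\<in>UNIV. (cmod (u k \<xi>))\<^sup>2)"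
    have m2: "m\<^sup>2 = (\<Sum>k\<in>UNIV. (cmod (u k \<xi>))\<^sup>2)" and m0: "m \<ge> 0"
      by (simp_all add: m_def sum_nonneg)
    have um: "cmod (u k \<xi>) \<le> m" for k
      unfolding m_def by (rule real_le_rsqrt) (rule member_le_sum, auto)
    define S where "S = (\<Sum>k\<in>UNIV. cnj (u k \<xi>) * (\<Sum>j\<in>UNIV. of_real (symbol A k j \<xi>) * u j \<xi>))"
    have S: "of_real (4 * pi\<^sup>2) * S = (\<Sum>k\<in>UNIV. cnj (u k \<xi>) * g k)"
    proof -
      have "of_real (4 * pi\<^sup>2) * S = (\<Sum>k\<in>UNIV. cnj (u k \<xi>) * (4 * (of_real pi)\<^sup>2 * (\<Sum>j\<in>UNIV. of_real (symbol A k j \<xi>) * u j \<xi>)))"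
        unfolding S_def sum_distrib_left[of "of_real (4 * pi\<^sup>2)"] by (intro sum.cong refl) simp
      also have "\<dots> = (\<Sum>k\<in>UNIV. cnj (u k \<xi>) * g k) - 2 * of_real pi * \<i> * p \<xi> * cnj (\<Sum>k\<in>UNIV. of_real (lattice_vec \<xi> $ k) * u k \<xi>)"
        unfolding eq unfolding cnj_sum sum_distrib_left sum_subtractf[symmetric]
        by (intro sum.cong refl) (simp add: algebra_simps)
      finally show ?thesis by (simp add: div)
    qed
    have "c * (l\<^sup>2 * m\<^sup>2) \<le> Re S"
      using ell[OF div] by (simp add: S_def l_def m2)
    moreover have "0 \<le> c * (l\<^sup>2 * m\<^sup>2)" using c by simp
    moreover note one_le_4_pi_squared
    ultimately have "c * (l\<^sup>2 * m\<^sup>2) \<le> 4 * pi\<^sup>2 * Re S"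
      by (smt (verit) mult_le_cancel_right1)
    also have "\<dots> = Re (\<Sum>k\<in>UNIV. cnj (u k \<xi>) * g k)"
      unfolding S[symmetric] by simp
    also have "\<dots> \<le> cmod (\<Sum>k\<in>UNIV. cnj (u k \<xi>) * g k)" by (rule complex_Re_le_cmod)
    also have "\<dots> \<le> (\<Sum>k\<in>UNIV. m * cmod (g k))"
      by (rule sum_norm_le) (auto simp: norm_mult intro!: mult_right_mono um)
    also have "\<dots> = m * (\<Sum>k\<in>UNIV. cmod (g k))" by (simp add: sum_distrib_left)
    finally have "m * (c * l\<^sup>2 * m) \<le> m * (\<Sum>k\<in>UNIV. cmod (g k))"
      by (simp add: power2_eq_square mult_ac)
    then have "c * l\<^sup>2 * m \<le> (\<Sum>k\<in>UNIV. cmod (g k))"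
      using m0 by (cases "m = 0") (auto simp: sum_nonneg)
    also have "\<dots> \<le> (\<Sum>k\<in>UNIV. norm (f k \<xi>) + 2 * pi * (weight \<xi> powr (1/2)) * (\<Sum>j\<in>UNIV. norm (abs_conv (u k) (u j) \<xi>)))"
    proof (rule sum_mono)
      fix k
      have "cmod (g k) \<le> norm (f k \<xi>) + cmod (\<Sum>\<^sub>\<infinity>\<zeta>. advection u k \<xi> \<zeta>)"
        unfolding g_def by (rule norm_triangle_ineq4)
      also have "cmod (\<Sum>\<^sub>\<infinity>\<zeta>. advection u k \<xi> \<zeta>) \<le> 2 * pi * l * (\<Sum>j\<in>UNIV. norm (abs_conv (u k) (u j) \<xi>))"
        using norm_infsum_advection_le[where u=u and k=k and \<xi>=\<xi>, OF card sob] by (simp add: l_def abs_conv_nonneg)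
      also have "\<dots> \<le> 2 * pi * (weight \<xi> powr (1/2)) * (\<Sum>j\<in>UNIV. norm (abs_conv (u k) (u j) \<xi>))"
        unfolding l_def by (intro mult_right_mono mult_left_mono norm_lattice_vec_le_weight sum_nonneg) auto
      finally show "cmod (g k) \<le> norm (f k \<xi>) + 2 * pi * (weight \<xi> powr (1/2)) * (\<Sum>j\<in>UNIV. norm (abs_conv (u k) (u j) \<xi>))" by simp
    qed
    also have "\<dots> \<le> (\<Sum>k\<in>UNIV. 2 * pi * norm (f k \<xi>) + 2 * pi * (weight \<xi> powr (1/2)) * (\<Sum>j\<in>UNIV. norm (abs_conv (u k) (u j) \<xi>)))"
      using pi_ge_two by (intro sum_mono add_right_mono) (auto simp: mult_le_cancel_right1)
    also have "\<dots> = 2 * pi * ((\<Sum>k\<in>UNIV. norm (f k \<xi>)) + weight \<xi> powr (1/2) * (\<Sum>k\<in>UNIV. \<Sum>j\<in>UNIV. norm (abs_conv (u k) (u j) \<xi>)))"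
      by (simp add: sum.distrib sum_distrib_left distrib_left mult_ac)
    finally have 1: "c * l\<^sup>2 * m \<le> 2 * pi * ((\<Sum>k\<in>UNIV. norm (f k \<xi>)) + weight \<xi> powr (1/2) * (\<Sum>k\<in>UNIV. \<Sum>j\<in>UNIV. norm (abs_conv (u k) (u j) \<xi>)))" (is "_ \<le> 2 * pi * ?R") .
    have "c * weight \<xi> * m \<le> c * (2 * l\<^sup>2) * m"
      using weight_le_2_norm[OF \<xi>] c m0 by (intro mult_right_mono mult_left_mono) (auto simp: l_def)
    also have "\<dots> = 2 * (c * l\<^sup>2 * m)" by simp
    also have "\<dots> \<le> 2 * (2 * pi * ?R)" using 1 by (rule mult_left_mono) simp
    finally have "m \<le> 2 / c * (2 * pi) * (weight \<xi> powr - 1 * ?R)"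
      using c by (simp add: powr_minus_divide field_simps)
    also have "weight \<xi> powr - 1 * ?R = (\<Sum>l\<in>UNIV. weight \<xi> powr - 1 * norm (f l \<xi>))
       + (\<Sum>l\<in>UNIV. \<Sum>j\<in>UNIV. weight \<xi> powr (- 1/2) * norm (abs_conv (u l) (u j) \<xi>))"
    proof -
      have "weight \<xi> powr - 1 * weight \<xi> powr (1/2) = weight \<xi> powr (- 1/2)"
        unfolding powr_add[symmetric] by simp
      then show ?thesis
        by (simp only: distrib_left sum_distrib_left mult.assoc[symmetric])
    qed
    finally show "cmod (u k \<xi>) \<le> 2 / c * (2 * pi) * ((\<Sum>l\<in>UNIV. weight \<xi> powr - 1 * norm (f l \<xi>))
       + (\<Sum>l\<in>UNIV. \<Sum>j\<in>UNIV. weight \<xi> powr (- 1/2) * norm (abs_conv (u l) (u j) \<xi>)))"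
      using um[of k] by linarith
  qed
qed

text \<open>Bootstrap: each application of \<open>ns_fourier_velocity_bound\<close> gains a quarter of a derivative, since
  the convolution of two functions in \<open>H\<^sup>\<sigma>\<close>, \<open>\<sigma> \<ge> 1\<close>, lies in \<open>H\<close> of order \<open>\<sigma> - 3/4\<close> in dimension at most 3.\<close>
lemma ns_fourier_velocity_regular:
  fixes A :: "'n::finite tensor4" and f u :: "'n \<Rightarrow> int^'n \<Rightarrow> complex"
  assumes card: "CARD('n) \<le> 3" and A: "tensor_symmetric A" "relaxed_elliptic A"
    and ns: "ns_fourier A f u p" "solenoidal u" "\<And>k. u k 0 = 0" "\<And>k. sobolev 1 (u k)"
    and f: "\<And>k. sobolev (s - 2) (f k)" and "1 \<le> s"
  shows "sobolev s (u k)"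
proof -
  obtain C where C: "\<And>k \<xi>. \<xi> \<noteq> 0 \<Longrightarrow>
    cmod (u k \<xi>) \<le> C * ((\<Sum>l\<in>UNIV. weight \<xi> powr - 1 * norm (f l \<xi>))
       + (\<Sum>l\<in>UNIV. \<Sum>j\<in>UNIV. weight \<xi> powr (- 1/2) * norm (abs_conv (u l) (u j) \<xi>)))"
    using ns_fourier_velocity_bound[OF card A] ns by metis
  define D where "D = (\<lambda>\<xi>. (\<Sum>l\<in>UNIV. weight \<xi> powr - 1 * norm (f l \<xi>))
       + (\<Sum>l\<in>UNIV. \<Sum>j\<in>UNIV. weight \<xi> powr (- 1/2) * norm (abs_conv (u l) (u j) \<xi>)))"
  have D0: "D \<xi> \<ge> 0" for \<xi> unfolding D_def by (intro add_nonneg_nonneg sum_nonneg) auto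
  have bound: "cmod (u k \<xi>) \<le> \<bar>C\<bar> * D \<xi>" for k \<xi>
  proof (cases "\<xi> = 0")
    case False
    then have "cmod (u k \<xi>) \<le> C * D \<xi>" using C unfolding D_def by blast
    also have "\<dots> \<le> \<bar>C\<bar> * D \<xi>" by (intro mult_right_mono D0) simp
    finally show ?thesis .
  qed (simp add: ns D0)
  have step: "sobolev t (u k)" if \<sigma>: "\<And>k. sobolev \<sigma> (u k)" "1 \<le> \<sigma>" and t: "t \<le> s" "t \<le> \<sigma> + 1/4" for \<sigma> t k
  proof (rule sobolev_bound[OF _ bound])
    show "sobolev t D"
      unfolding D_def
    proof (intro sobolev_add sobolev_sum[OF finite])
      fix l j
      show "sobolev t (\<lambda>\<xi>. weight \<xi> powr - 1 * norm (f l \<xi>))"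
        by (rule sobolev_weight_mult[OF sobolev_mono[OF f, of "t - 2"]]) (use t in auto)
      \<comment> \<open>With \<open>t = \<sigma> - 3/4\<close> the convolution estimate needs
        \<open>n / 2 < \<sigma> + 3/4\<close>, and \<open>3/2 < 7/4\<close> for
        \<open>n \<le> 3\<close> and \<open>\<sigma> \<ge> 1\<close>. The power \<open>- 1/2\<close>
        of the weight adds one order, which makes \<open>\<sigma> + 1/4\<close>.\<close>
      have "sobolev (\<sigma> - 3/4) (abs_conv (u l) (u j))"
        by (rule sobolev_convolution[OF \<sigma>(1) \<sigma>(1)]) (use \<sigma> card in auto)
      then have "sobolev (t - 1) (abs_conv (u l) (u j))"
        by (rule sobolev_mono) (use t in auto)
      then show "sobolev t (\<lambda>\<xi>. weight \<xi> powr (- 1/2) * norm (abs_conv (u l) (u j) \<xi>))"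
        by (rule sobolev_weight_mult) simp
    qed
  qed
  \<comment> \<open>The minimum caps the iteration at the order \<open>s\<close> that the force
    permits.\<close>
  have iter: "\<forall>k. sobolev (min s (1 + real m / 4)) (u k)" for m :: nat
  proof (induction m)
    case 0
    then show ?case using ns(4) \<open>1 \<le> s\<close> by (simp add: min_def)
  next
    case (Suc m)
    show ?case
    proof
      fix k
      show "sobolev (min s (1 + real (Suc m) / 4)) (u k)"
        by (rule step[of "min s (1 + real m / 4)"]) (use Suc \<open>1 \<le> s\<close> in \<open>auto simp: min_def field_simps\<close>)
    qed
  qed
  obtain m :: nat where "4 * s \<le> real m" by (meson real_arch_simple)
  then have "min s (1 + real m / 4) = s" by (simp add: min_def field_simps)
  then show ?thesis using iter[of m] by simp
qed

text \<open>The pressure is the part of the equation along \<open>\<xi>\<close>. After division by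
  \<open>|\<xi>|\<close> the force gains one order over \<open>s - 2\<close>, the elliptic term
  loses one from \<open>s\<close>, and the convolution has order \<open>s - 1\<close>: all three
  land in the same space.\<close>

lemma ns_fourier_pressure_regular:
  fixes A :: "'n::finite tensor4" and f u :: "'n \<Rightarrow> int^'n \<Rightarrow> complex"
  assumes card: "CARD('n) \<le> 3"
    and ns: "ns_fourier A f u p" "\<And>k. sobolev s (u k)" "p 0 = 0"
    and f: "\<And>k. sobolev (s - 2) (f k)" and "1 \<le> s"
  shows "sobolev (s - 1) p"
proof -
  define a where "a = (\<Sum>k\<in>UNIV. \<Sum>j\<in>UNIV. \<Sum>\<alpha>\<in>UNIV. \<Sum>\<beta>\<in>UNIV. \<bar>A k j \<alpha> \<beta>\<bar>)"
  have a0: "a \<ge> 0" unfolding a_def by (intro sum_nonneg) auto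
  have sym: "\<bar>symbol A k j \<xi>\<bar> \<le> a * (norm (lattice_vec \<xi>))\<^sup>2" for k j \<xi>
  proof -
    have "\<bar>symbol A k j \<xi>\<bar> \<le> (\<Sum>\<alpha>\<in>UNIV. \<Sum>\<beta>\<in>UNIV. \<bar>A k j \<alpha> \<beta> * lattice_vec \<xi> $ \<alpha> * lattice_vec \<xi> $ \<beta>\<bar>)"
      unfolding symbol_def by (rule order_trans[OF sum_abs sum_mono[OF sum_abs]])
    also have "\<dots> \<le> (\<Sum>\<alpha>\<in>UNIV. \<Sum>\<beta>\<in>UNIV. \<bar>A k j \<alpha> \<beta>\<bar> * (norm (lattice_vec \<xi>))\<^sup>2)"
      unfolding abs_mult power2_eq_square mult.assoc
      by (intro sum_mono mult_left_mono mult_mono component_le_norm_cart) auto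
    also have "\<dots> = (\<Sum>\<alpha>\<in>UNIV. \<Sum>\<beta>\<in>UNIV. \<bar>A k j \<alpha> \<beta>\<bar>) * (norm (lattice_vec \<xi>))\<^sup>2"
      by (simp add: sum_distrib_right)
    also have "\<dots> \<le> a * (norm (lattice_vec \<xi>))\<^sup>2"
    proof (rule mult_right_mono)
      have "(\<Sum>\<alpha>\<in>UNIV. \<Sum>\<beta>\<in>UNIV. \<bar>A k j \<alpha> \<beta>\<bar>) \<le> (\<Sum>j\<in>UNIV. \<Sum>\<alpha>\<in>UNIV. \<Sum>\<beta>\<in>UNIV. \<bar>A k j \<alpha> \<beta>\<bar>)"
        by (rule member_le_sum) (auto intro!: sum_nonneg)
      also have "\<dots> \<le> a"
        unfolding a_def by (rule member_le_sum[of k]) (auto intro!: sum_nonneg)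
      finally show "(\<Sum>\<alpha>\<in>UNIV. \<Sum>\<beta>\<in>UNIV. \<bar>A k j \<alpha> \<beta>\<bar>) \<le> a" .
    qed simp
    finally show ?thesis .
  qed
  have u1: "sobolev 1 (u k)" for k using sobolev_mono[OF ns(2) \<open>1 \<le> s\<close>] .
  \<comment> \<open>The sum of the three constants met below, so that \<open>K\<close> dominates
    each of them: 2 from comparing \<open>|\<xi>|\<close> with the root of the weight, one from the
    symbol bound summed over components, and \<open>2 * pi\<close> from the advection.\<close>
  define K where "K = 2 + 4 * pi\<^sup>2 * real CARD('n) * a + 2 * pi"
  define D where "D = (\<lambda>\<xi>. (\<Sum>k\<in>UNIV. weight \<xi> powr (- 1/2) * norm (f k \<xi>))
      + ((\<Sum>j\<in>UNIV. weight \<xi> powr (1/2) * norm (u j \<xi>)) + (\<Sum>k\<in>UNIV. \<Sum>j\<in>UNIV. abs_conv (u k) (u j) \<xi>)))"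
  show ?thesis
  proof (rule sobolev_bound[where D=D and K=K])
    show "sobolev (s - 1) D"
      unfolding D_def
    proof (intro sobolev_add sobolev_sum[OF finite])
      fix k j
      show "sobolev (s - 1) (\<lambda>\<xi>. weight \<xi> powr (- 1/2) * norm (f k \<xi>))"
        by (rule sobolev_weight_mult[OF f]) simp
      show "sobolev (s - 1) (\<lambda>\<xi>. weight \<xi> powr (1/2) * norm (u j \<xi>))"
        by (rule sobolev_weight_mult[OF ns(2)]) simp
      \<comment> \<open>With \<open>t = s - 1\<close> the condition is \<open>n / 2 < s + 1\<close>,
        and \<open>s + 1 \<ge> 2 > 3/2\<close>.\<close>
      show "sobolev (s - 1) (abs_conv (u k) (u j))"
        by (rule sobolev_convolution[OF ns(2) ns(2)]) (use \<open>1 \<le> s\<close> card in auto)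
    qed
    fix \<xi>
    let ?F = "\<Sum>k\<in>UNIV. norm (f k \<xi>)" and ?U = "\<Sum>j\<in>UNIV. norm (u j \<xi>)" and ?W = "\<Sum>k\<in>UNIV. \<Sum>j\<in>UNIV. abs_conv (u k) (u j) \<xi>"
    have nn: "0 \<le> ?F" "0 \<le> ?U" "0 \<le> ?W" by (auto intro!: sum_nonneg abs_conv_nonneg)
    have D: "D \<xi> = weight \<xi> powr (- 1/2) * ?F + (weight \<xi> powr (1/2) * ?U + ?W)"
      by (simp add: D_def sum_distrib_left)
    have K: "K \<ge> 2" "K \<ge> 4 * pi\<^sup>2 * real CARD('n) * a" "K \<ge> 2 * pi"
      using a0 by (auto simp: K_def)
    show "norm (p \<xi>) \<le> K * D \<xi>"
    proof (cases "\<xi> = 0")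
      case True
      have "0 \<le> D \<xi>" unfolding D by (intro add_nonneg_nonneg mult_nonneg_nonneg nn) auto
      then show ?thesis using True ns(3) K by simp
    next
      case False
      define l where "l = norm (lattice_vec \<xi>)"
      have l: "l \<ge> 1" using norm_lattice_vec_ge_1[OF False] by (simp add: l_def)
      let ?N = "\<lambda>k. \<Sum>\<^sub>\<infinity>\<zeta>. advection u k \<xi> \<zeta>"
      let ?T = "\<lambda>k. \<Sum>j\<in>UNIV. of_real (symbol A k j \<xi>) * u j \<xi>"
      have eq: "2 * of_real pi * \<i> * p \<xi> * of_real (lattice_vec \<xi> $ k) = f k \<xi> - 4 * (of_real pi)\<^sup>2 * ?T k - ?N k" for k
        using ns(1)[unfolded ns_fourier_def, rule_format, of k \<xi>] by (simp add: algebra_simps)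
      have k: "2 * pi * cmod (p \<xi>) * \<bar>lattice_vec \<xi> $ k\<bar> \<le> norm (f k \<xi>) + 4 * pi\<^sup>2 * (a * l\<^sup>2 * ?U) + 2 * pi * l * (\<Sum>j\<in>UNIV. abs_conv (u k) (u j) \<xi>)" for k
      proof -
        have "2 * pi * cmod (p \<xi>) * \<bar>lattice_vec \<xi> $ k\<bar> = cmod (f k \<xi> - 4 * (of_real pi)\<^sup>2 * ?T k - ?N k)"
          unfolding eq[symmetric] by (simp add: norm_mult)
        also have "\<dots> \<le> norm (f k \<xi>) + cmod (4 * (of_real pi)\<^sup>2 * ?T k) + cmod (?N k)"
          by (smt (verit) norm_triangle_ineq4)
        also have "cmod (4 * (of_real pi)\<^sup>2 * ?T k) = 4 * pi\<^sup>2 * cmod (?T k)"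
          by (simp add: norm_mult norm_power)
        also have "cmod (?T k) \<le> (\<Sum>j\<in>UNIV. a * l\<^sup>2 * norm (u j \<xi>))"
          by (rule sum_norm_le) (use sym in \<open>auto simp: norm_mult l_def intro!: mult_right_mono\<close>)
        also have "\<dots> = a * l\<^sup>2 * ?U" by (simp add: sum_distrib_left)
        also have "cmod (?N k) \<le> 2 * pi * l * (\<Sum>j\<in>UNIV. abs_conv (u k) (u j) \<xi>)"
          unfolding l_def by (rule norm_infsum_advection_le[OF card u1])
        finally show ?thesis by simp
      qed
      \<comment> \<open>A single component of \<open>\<xi>\<close> may vanish, so the componentwise
        bounds are added before dividing by the length.\<close>
      have "2 * pi * cmod (p \<xi>) * l \<le> 2 * pi * cmod (p \<xi>) * (\<Sum>k\<in>UNIV. \<bar>lattice_vec \<xi> $ k\<bar>)"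
        unfolding l_def by (intro mult_left_mono norm_le_l1_cart) auto
      also have "\<dots> \<le> (\<Sum>k\<in>UNIV. norm (f k \<xi>) + 4 * pi\<^sup>2 * (a * l\<^sup>2 * ?U) + 2 * pi * l * (\<Sum>j\<in>UNIV. abs_conv (u k) (u j) \<xi>))"
        unfolding sum_distrib_left[of "2 * pi * cmod (p \<xi>)"] by (intro sum_mono k)
      also have "\<dots> = ?F + 4 * pi\<^sup>2 * real CARD('n) * a * l\<^sup>2 * ?U + 2 * pi * l * ?W"
        by (simp add: sum.distrib sum_distrib_left mult_ac)
      finally have "2 * pi * cmod (p \<xi>) * l \<le> \<dots>" .
      moreover have "cmod (p \<xi>) * l \<le> 2 * pi * cmod (p \<xi>) * l"
        using l pi_ge_two by (intro mult_right_mono) (auto simp: mult_le_cancel_right1)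
      ultimately have 1: "cmod (p \<xi>) * l \<le> ?F + 4 * pi\<^sup>2 * real CARD('n) * a * l\<^sup>2 * ?U + 2 * pi * l * ?W"
        by linarith
      then have "cmod (p \<xi>) \<le> (?F + 4 * pi\<^sup>2 * real CARD('n) * a * l\<^sup>2 * ?U + 2 * pi * l * ?W) / l"
        using l by (simp add: pos_le_divide_eq)
      also have "\<dots> = ?F / l + 4 * pi\<^sup>2 * real CARD('n) * a * (l * ?U) + 2 * pi * ?W"
        using l by (simp add: field_simps power2_eq_square)
      also have "\<dots> \<le> K * (weight \<xi> powr (- 1/2) * ?F) + K * (weight \<xi> powr (1/2) * ?U) + K * ?W"
      proof (intro add_mono)
        have "weight \<xi> powr (1/2) \<le> 2 * l"
        proof -
          have "weight \<xi> \<le> (2 * l)\<^sup>2"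
            using weight_le_2_norm[OF False] by (simp add: l_def power_mult_distrib) (smt (verit) zero_le_power2)
          then show ?thesis using l by (simp add: powr_half_sqrt real_le_lsqrt)
        qed
        then have "1 / l \<le> 2 * weight \<xi> powr (- 1/2)"
          using l by (simp add: powr_minus_divide field_simps)
        also have "\<dots> \<le> K * weight \<xi> powr (- 1/2)"
          using K by (intro mult_right_mono) auto
        finally have "1 / l * ?F \<le> K * weight \<xi> powr (- 1/2) * ?F"
          using nn(1) by (rule mult_right_mono)
        then show "?F / l \<le> K * (weight \<xi> powr (- 1/2) * ?F)" by (simp add: mult_ac)
        have "l * ?U \<le> weight \<xi> powr (1/2) * ?U"
          unfolding l_def using nn by (intro mult_right_mono norm_lattice_vec_le_weight) auto
        then show "4 * pi\<^sup>2 * real CARD('n) * a * (l * ?U) \<le> K * (weight \<xi> powr (1/2) * ?U)"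
          by (rule mult_mono[OF K(2)]) (use K nn l in auto)
        show "2 * pi * ?W \<le> K * ?W" using K nn by (intro mult_right_mono) auto
      qed
      also have "\<dots> = K * D \<xi>" by (simp add: D distrib_left)
      finally show ?thesis by simp
    qed
  qed
qed

subsection \<open>Integration over the torus\<close>

text \<open>Set integrals over the torus become integrals over a probability space, so that
  finite-measure arguments apply directly.\<close>

definition torus_measure :: "(real^'n::finite) measure" where
  "torus_measure = restrict_space lebesgue torus"

lemma torus_borel [measurable]: "(torus :: (real^'n::finite) set) \<in> sets borel"
proof -
  have "(torus :: (real^'n) set) = (\<Inter>i. {x. 0 \<le> x $ i} \<inter> {x. x $ i < 1})"
    by (auto simp: torus_def)
  also have "\<dots> \<in> sets borel"
    by (intro sets.countable_INT'' sets.Int borel_closed borel_open closed_Collect_le open_Collect_less continuous_intros) auto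
  finally show ?thesis .
qed

lemma space_torus_measure [simp]: "space torus_measure = torus"
  by (simp add: torus_measure_def space_restrict_space)

lemma set_integral_torus:
  fixes f :: "real^'n::finite \<Rightarrow> 'b::{banach, second_countable_topology}"
  shows "(LINT x:torus|lebesgue. f x) = integral\<^sup>L torus_measure f"
  unfolding torus_measure_def set_lebesgue_integral_def by (subst integral_restrict_space) auto

lemma set_integrable_torus:
  fixes f :: "real^'n::finite \<Rightarrow> 'b::{banach, second_countable_topology}"
  shows "set_integrable lebesgue torus f \<longleftrightarrow> integrable torus_measure f"
  unfolding torus_measure_def set_integrable_def by (subst integrable_restrict_space) auto

lemma box_subset_torus: "box 0 1 \<subseteq> (torus :: (real^'n::finite) set)"
  and torus_subset_cbox: "(torus :: (real^'n::finite) set) \<subseteq> cbox 0 1"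
  by (auto simp: torus_def mem_box_cart less_imp_le)

lemma emeasure_torus: "emeasure lborel (torus :: (real^'n::finite) set) = 1"
proof (rule antisym)
  have "b \<in> Basis \<Longrightarrow> (1::real^'n) \<bullet> b = 1" for b
    by (auto simp: Basis_vec_def inner_axis)
  then have b: "emeasure lborel (cbox 0 1 :: (real^'n) set) = 1"
    by (simp add: emeasure_lborel_cbox_eq)
  show "emeasure lborel (torus :: (real^'n) set) \<le> 1"
    unfolding b[symmetric] by (rule emeasure_mono[OF torus_subset_cbox]) simp
  have "emeasure lborel (box 0 1 :: (real^'n) set) = 1"
    using b emeasure_lborel_box_eq emeasure_lborel_cbox_eq by metis
  moreover have "emeasure lborel (box 0 1 :: (real^'n) set) \<le> emeasure lborel (torus :: (real^'n) set)"
    by (rule emeasure_mono[OF box_subset_torus]) simp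
  ultimately show "1 \<le> emeasure lborel (torus :: (real^'n) set)" by simp
qed

lemma emeasure_torus_measure: "emeasure torus_measure (torus :: (real^'n::finite) set) = 1"
  unfolding torus_measure_def by (subst emeasure_restrict_space) (auto simp: emeasure_torus)

interpretation torus: finite_measure "torus_measure :: (real^'n::finite) measure"
  by standard (simp add: emeasure_torus_measure)

lemma measure_torus [simp]: "measure torus_measure (torus :: (real^'n::finite) set) = 1"
  by (simp add: measure_def emeasure_torus_measure)

lemma borel_measurable_torus:
  "f \<in> borel_measurable borel \<Longrightarrow> f \<in> borel_measurable torus_measure"
  unfolding torus_measure_def by (intro measurable_restrict_space1 measurable_completion) simp

lemma continuous_measurable_torus:
  fixes f :: "real^'n::finite \<Rightarrow> 'b::{second_countable_topology, real_normed_vector}"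
  shows "continuous_on UNIV f \<Longrightarrow> f \<in> borel_measurable torus_measure"
  by (intro borel_measurable_torus borel_measurable_continuous_onI)

lemma integrable_torus_bounded:
  fixes f :: "real^'n::finite \<Rightarrow> 'b::{second_countable_topology, banach}"
  assumes "f \<in> borel_measurable torus_measure" "\<And>x. x \<in> torus \<Longrightarrow> norm (f x) \<le> B"
  shows "integrable torus_measure f"
  by (rule torus.integrable_const_bound[of _ B]) (use assms in auto)

lemma norm_integral_torus_le:
  fixes f :: "real^'n::finite \<Rightarrow> 'b::{second_countable_topology, banach}"
  assumes "f \<in> borel_measurable torus_measure" "\<And>x. x \<in> torus \<Longrightarrow> norm (f x) \<le> B"
  shows "norm (integral\<^sup>L torus_measure f) \<le> B"
proof -
  have "norm (integral\<^sup>L torus_measure f) \<le> (\<integral>x. norm (f x) \<partial>torus_measure)"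
    by (rule integral_norm_bound)
  also have "\<dots> \<le> (\<integral>x. B \<partial>(torus_measure :: (real^'n) measure))"
    using assms integrable_torus_bounded[OF assms] by (intro integral_mono) auto
  finally show ?thesis by simp
qed

lemma integrable_torus_continuous:
  fixes f :: "real^'n::finite \<Rightarrow> 'b::{second_countable_topology, banach}"
  assumes "continuous_on UNIV f"
  shows "integrable torus_measure f"
proof -
  have "bounded (f ` cbox 0 1)"
    using assms by (intro compact_imp_bounded compact_continuous_image compact_cbox) (auto intro: continuous_on_subset)
  then obtain B where "\<And>x. x \<in> cbox 0 1 \<Longrightarrow> norm (f x) \<le> B" unfolding bounded_iff by blast
  then show ?thesis
    using assms torus_subset_cbox by (intro integrable_torus_bounded[of f B] continuous_measurable_torus) auto
qed

lemma integral_torus_eq_lborel: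
  fixes f :: "real^'n::finite \<Rightarrow> 'b::{second_countable_topology, banach}"
  assumes [measurable]: "f \<in> borel_measurable borel"
  shows "integral\<^sup>L torus_measure f = (\<integral>x. indicator torus x *\<^sub>R f x \<partial>lborel)"
  unfolding set_integral_torus[symmetric] set_lebesgue_integral_def by (subst integral_completion) auto

text \<open>\<open>periodic\<close> with an arbitrary target type, as needed for complex-valued
  functions such as characters.\<close>

definition lattice_periodic :: "(real^'n::finite \<Rightarrow> 'b) \<Rightarrow> bool" where
  "lattice_periodic f \<longleftrightarrow> (\<forall>x i. f (x + axis i 1) = f x)"

lemma periodic_iff_lattice_periodic: "periodic f \<longleftrightarrow> lattice_periodic f"
  by (simp add: periodic_def lattice_periodic_def)

text \<open>Cut and paste: the slab of points that remain in the cube is shifted by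
  \<open>h\<close>; the slab that leaves it is shifted by \<open>h - 1\<close> instead, which
  periodicity does not notice. Both shifts preserve Lebesgue measure.\<close>

lemma integral_torus_translate:
  fixes f :: "real^'n::finite \<Rightarrow> 'b::{second_countable_topology, banach}"
  assumes cont: "continuous_on UNIV f" and per: "lattice_periodic f" and h: "0 \<le> h" "h \<le> 1"
  shows "integral\<^sup>L torus_measure (\<lambda>x. f (x + h *\<^sub>R axis j 1)) = integral\<^sup>L torus_measure f"
proof -
  let ?e = "axis j 1 :: real^'n"
  define P where "P = torus \<inter> {x::real^'n. x $ j < 1 - h}"
  define Q where "Q = torus \<inter> {x::real^'n. 1 - h \<le> x $ j}"
  define P' where "P' = torus \<inter> {x::real^'n. h \<le> x $ j}"
  define Q' where "Q' = torus \<inter> {x::real^'n. x $ j < h}"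
  have lt: "{x::real^'n. x $ j < a} \<in> sets borel" and ge: "{x::real^'n. a \<le> x $ j} \<in> sets borel" for a
    by (auto intro!: borel_closed borel_open closed_Collect_le open_Collect_less continuous_intros)
  have meas [measurable]: "P \<in> sets borel" "Q \<in> sets borel" "P' \<in> sets borel" "Q' \<in> sets borel"
    unfolding P_def Q_def P'_def Q'_def by (auto intro!: sets.Int lt ge)
  have fm [measurable]: "f \<in> borel_measurable borel"
    by (rule borel_measurable_continuous_onI[OF cont])
  have ib: "integrable lborel (\<lambda>x. indicator S x *\<^sub>R g x)"
    if S: "S \<in> sets borel" "S \<subseteq> torus" and g: "continuous_on UNIV g" for S and g :: "real^'n \<Rightarrow> 'b"
  proof -
    have "integrable lborel (\<lambda>x. indicator (cbox 0 1) x *\<^sub>R g x)"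
      by (rule borel_integrable_compact) (auto intro: continuous_on_subset[OF g])
    then have "integrable lborel (\<lambda>x. indicator S x *\<^sub>R (indicator (cbox 0 1) x *\<^sub>R g x))"
      by (rule integrable_mult_indicator[rotated]) (use S in simp)
    moreover have "indicator S x *\<^sub>R (indicator (cbox 0 1) x *\<^sub>R g x) = indicator S x *\<^sub>R g x" for x
      using S torus_subset_cbox by (auto simp: indicator_def)
    ultimately show ?thesis by (simp only:)
  qed
  have contg: "continuous_on UNIV (\<lambda>x. f (x + h *\<^sub>R ?e))"
    by (intro continuous_on_compose2[OF cont] continuous_intros) auto
  have shift: "(\<integral>x. g (v + x) \<partial>lborel) = (\<integral>x. g x \<partial>lborel)" if [measurable]: "g \<in> borel_measurable borel" for g :: "real^'n \<Rightarrow> 'b" and v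
    using integral_distr[of "(+) v" lborel borel g] by (simp add: lborel_distr_plus)
  have coord: "?e $ i = (if i = j then 1 else 0)" for i
    by (simp add: axis_def)
  have torus_j: "y \<in> torus \<longleftrightarrow> (0 \<le> y $ j \<and> y $ j < 1) \<and> (\<forall>i. i \<noteq> j \<longrightarrow> 0 \<le> y $ i \<and> y $ i < 1)" for y :: "real^'n"
    by (auto simp: torus_def)
  have P: "(\<integral>x. indicator P x *\<^sub>R f (x + h *\<^sub>R ?e) \<partial>lborel) = (\<integral>x. indicator P' x *\<^sub>R f x \<partial>lborel)"
  proof -
    have "h *\<^sub>R ?e + x \<in> P' \<longleftrightarrow> x \<in> P" for x
      using h by (auto simp: P_def P'_def torus_j coord)
    then have "(\<integral>x. indicator P x *\<^sub>R f (x + h *\<^sub>R ?e) \<partial>lborel) = (\<integral>x. indicator P' (h *\<^sub>R ?e + x) *\<^sub>R f (h *\<^sub>R ?e + x) \<partial>lborel)"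
      by (intro Bochner_Integration.integral_cong refl) (auto simp: indicator_def add.commute)
    also have "\<dots> = (\<integral>x. indicator P' x *\<^sub>R f x \<partial>lborel)"
      by (rule shift[of "\<lambda>x. indicator P' x *\<^sub>R f x"]) measurable
    finally show ?thesis .
  qed
  have Q: "(\<integral>x. indicator Q x *\<^sub>R f (x + h *\<^sub>R ?e) \<partial>lborel) = (\<integral>x. indicator Q' x *\<^sub>R f x \<partial>lborel)"
  proof -
    have 1: "(h - 1) *\<^sub>R ?e + x \<in> Q' \<longleftrightarrow> x \<in> Q" for x
      using h by (auto simp: Q_def Q'_def torus_j coord)
    have "f (x + h *\<^sub>R ?e) = f ((h - 1) *\<^sub>R ?e + x)" for x
    proof -
      have "x + h *\<^sub>R ?e = ((h - 1) *\<^sub>R ?e + x) + ?e" by (simp add: algebra_simps)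
      then show ?thesis using per unfolding lattice_periodic_def by metis
    qed
    then have "(\<integral>x. indicator Q x *\<^sub>R f (x + h *\<^sub>R ?e) \<partial>lborel) = (\<integral>x. indicator Q' ((h - 1) *\<^sub>R ?e + x) *\<^sub>R f ((h - 1) *\<^sub>R ?e + x) \<partial>lborel)"
      using 1 by (intro Bochner_Integration.integral_cong refl) (auto simp: indicator_def)
    also have "\<dots> = (\<integral>x. indicator Q' x *\<^sub>R f x \<partial>lborel)"
      by (rule shift[of "\<lambda>x. indicator Q' x *\<^sub>R f x"]) measurable
    finally show ?thesis .
  qed
  have "integral\<^sup>L torus_measure (\<lambda>x. f (x + h *\<^sub>R ?e)) = (\<integral>x. indicator torus x *\<^sub>R f (x + h *\<^sub>R ?e) \<partial>lborel)"
    by (rule integral_torus_eq_lborel) (rule borel_measurable_continuous_onI[OF contg])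
  also have "\<dots> = (\<integral>x. indicator P x *\<^sub>R f (x + h *\<^sub>R ?e) + indicator Q x *\<^sub>R f (x + h *\<^sub>R ?e) \<partial>lborel)"
    by (intro Bochner_Integration.integral_cong refl) (auto simp: indicator_def P_def Q_def)
  also have "\<dots> = (\<integral>x. indicator P x *\<^sub>R f (x + h *\<^sub>R ?e) \<partial>lborel) + (\<integral>x. indicator Q x *\<^sub>R f (x + h *\<^sub>R ?e) \<partial>lborel)"
    by (intro Bochner_Integration.integral_add ib contg) (auto simp: meas, auto simp: P_def Q_def)
  also have "\<dots> = (\<integral>x. indicator P' x *\<^sub>R f x \<partial>lborel) + (\<integral>x. indicator Q' x *\<^sub>R f x \<partial>lborel)"
    unfolding P Q ..
  also have "\<dots> = (\<integral>x. indicator P' x *\<^sub>R f x + indicator Q' x *\<^sub>R f x \<partial>lborel)"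
    by (intro Bochner_Integration.integral_add[symmetric] ib cont) (auto simp: meas, auto simp: P'_def Q'_def)
  also have "\<dots> = (\<integral>x. indicator torus x *\<^sub>R f x \<partial>lborel)"
    by (intro Bochner_Integration.integral_cong refl) (auto simp: indicator_def P'_def Q'_def)
  also have "\<dots> = integral\<^sup>L torus_measure f"
    by (rule integral_torus_eq_lborel[symmetric]) measurable
  finally show ?thesis .
qed

text \<open>Integration by parts on a manifold without boundary: the difference quotients integrate
  to 0 by translation invariance and converge to \<open>g'\<close> under a constant bound.\<close>

lemma integral_torus_derivative:
  fixes g g' :: "real^'n::finite \<Rightarrow> 'b::{second_countable_topology, banach}"
  assumes cont: "continuous_on UNIV g" "continuous_on UNIV g'" and per: "lattice_periodic g"
    and der: "\<And>x. ((\<lambda>t. g (x + t *\<^sub>R axis j 1)) has_vector_derivative g' x) (at 0)"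
  shows "integral\<^sup>L torus_measure g' = 0"
proof -
  let ?e = "axis j 1 :: real^'n"
  define h :: "nat \<Rightarrow> real" where "h = (\<lambda>m. 1 / (real m + 1))"
  have h: "0 < h m" "h m \<le> 1" for m by (simp_all add: h_def)
  define D where "D = (\<lambda>m x. (1 / h m) *\<^sub>R (g (x + h m *\<^sub>R ?e) - g x))"
  \<comment> \<open>Side length 2, because \<open>x + t *\<^sub>R ?e\<close> leaves the unit cube
    for \<open>x\<close> in the torus and \<open>t\<close> up to 1.\<close>
  have "bounded (g' ` cbox 0 (2 *\<^sub>R 1))"
    using cont by (intro compact_imp_bounded compact_continuous_image compact_cbox) (auto intro: continuous_on_subset)
  then obtain B where B: "\<And>x. x \<in> cbox 0 (2 *\<^sub>R 1) \<Longrightarrow> norm (g' x) \<le> B" unfolding bounded_iff by blast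
  have der': "((\<lambda>t. g (x + t *\<^sub>R ?e)) has_vector_derivative g' (x + t *\<^sub>R ?e)) (at t)" for x t
  proof -
    have "((\<lambda>s. g ((x + t *\<^sub>R ?e) + s *\<^sub>R ?e)) \<circ> (\<lambda>s. s - t) has_vector_derivative (1 *\<^sub>R g' (x + t *\<^sub>R ?e))) (at t)"
    proof (rule vector_diff_chain_at)
      show "((\<lambda>s. s - t) has_vector_derivative 1) (at t)"
        by (auto intro!: derivative_eq_intros)
      show "((\<lambda>s. g (x + t *\<^sub>R ?e + s *\<^sub>R ?e)) has_vector_derivative g' (x + t *\<^sub>R ?e)) (at (t - t))"
        using der by simp
    qed
    then show ?thesis by (simp add: o_def algebra_simps)
  qed
  \<comment> \<open>One \<open>B\<close> is the size of the derivative at \<open>x\<close>; the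
    other two bound its oscillation along the segment in the linearization estimate.\<close>
  have Dbound: "norm (D m x) \<le> 3 * B" if x: "x \<in> torus" for m x
  proof -
    have xt: "norm (g' (x + t *\<^sub>R ?e)) \<le> B" if "t \<in> {0..1}" for t
    proof (rule B)
      have "0 \<le> (x + t *\<^sub>R ?e) $ i \<and> (x + t *\<^sub>R ?e) $ i \<le> 2" for i
      proof -
        have "0 \<le> x $ i" "x $ i < 1" using x by (auto simp: torus_def)
        then show ?thesis using that by (auto simp: axis_def)
      qed
      then show "x + t *\<^sub>R ?e \<in> cbox 0 (2 *\<^sub>R 1)" by (simp add: mem_box_cart)
    qed
    have "norm (g (x + h m *\<^sub>R ?e) - g (x + 0 *\<^sub>R ?e) - (h m - 0) *\<^sub>R g' (x + 0 *\<^sub>R ?e)) \<le> norm (h m - 0) * (2 * B)"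
    proof (rule vector_differentiable_bound_linearization[where S="{0..1}" and f="\<lambda>t. g (x + t *\<^sub>R ?e)" and f'="\<lambda>t. g' (x + t *\<^sub>R ?e)"])
      show "((\<lambda>t. g (x + t *\<^sub>R ?e)) has_vector_derivative g' (x + t *\<^sub>R ?e)) (at t within {0..1})" for t
        using der' by (rule has_vector_derivative_at_within)
      show "closed_segment 0 (h m) \<subseteq> {0..1}"
        using h[of m] by (simp add: closed_segment_eq_real_ivl)
      show "norm (g' (x + t *\<^sub>R ?e) - g' (x + 0 *\<^sub>R ?e)) \<le> 2 * B" if "t \<in> {0..1}" for t
        using norm_triangle_ineq4[of "g' (x + t *\<^sub>R ?e)" "g' (x + 0 *\<^sub>R ?e)"] xt[OF that] xt[of 0] by simp
    qed simp
    then have "norm (g (x + h m *\<^sub>R ?e) - g x) \<le> norm (h m *\<^sub>R g' x) + h m * (2 * B)"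
      using h[of m] norm_triangle_sub[of "g (x + h m *\<^sub>R ?e) - g x" "h m *\<^sub>R g' x"] by simp
    also have "norm (h m *\<^sub>R g' x) \<le> h m * B"
      using xt[of 0] h[of m] by simp
    finally have "norm (g (x + h m *\<^sub>R ?e) - g x) \<le> h m * (3 * B)" by (simp add: algebra_simps)
    moreover have "norm (D m x) = norm (g (x + h m *\<^sub>R ?e) - g x) / h m"
      using h[of m] by (simp add: D_def)
    ultimately show ?thesis using h[of m] by (simp add: pos_divide_le_eq mult.commute)
  qed
  have D0: "integral\<^sup>L torus_measure (D m) = 0" for m
  proof -
    have c: "continuous_on UNIV (\<lambda>x. g (x + h m *\<^sub>R ?e))"
      by (intro continuous_on_compose2[OF cont(1)] continuous_intros) auto
    have "integral\<^sup>L torus_measure (D m) = (1 / h m) *\<^sub>R (integral\<^sup>L torus_measure (\<lambda>x. g (x + h m *\<^sub>R ?e)) - integral\<^sup>L torus_measure g)"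
      unfolding D_def using integrable_torus_continuous[OF c] integrable_torus_continuous[OF cont(1)] by simp
    then show ?thesis
      using integral_torus_translate[OF cont(1) per, of "h m" j] h[of m] by simp
  qed
  have "(\<lambda>m. integral\<^sup>L torus_measure (D m)) \<longlonglongrightarrow> integral\<^sup>L torus_measure g'"
  proof (rule integral_dominated_convergence[where w="\<lambda>_. 3 * B"])
    show "g' \<in> borel_measurable torus_measure"
      by (rule continuous_measurable_torus[OF cont(2)])
    show "D m \<in> borel_measurable torus_measure" for m
      unfolding D_def
      by (intro continuous_measurable_torus continuous_intros continuous_on_compose2[OF cont(1)] cont) auto
    show "AE x in torus_measure. (\<lambda>m. D m x) \<longlonglongrightarrow> g' x"
    proof (rule AE_I2)
      fix x
      have "((\<lambda>t. norm (g (x + t *\<^sub>R ?e) - g x - t *\<^sub>R g' x) / norm t) \<longlongrightarrow> 0) (at 0)"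
        using der[of x] unfolding has_vector_derivative_def has_derivative_at by simp
      then have "((\<lambda>t. norm ((1 / t) *\<^sub>R (g (x + t *\<^sub>R ?e) - g x) - g' x)) \<longlongrightarrow> 0) (at 0)"
      proof (rule Lim_transform_eventually)
        have "norm (g (x + t *\<^sub>R ?e) - g x - t *\<^sub>R g' x) / norm t = norm ((1 / t) *\<^sub>R (g (x + t *\<^sub>R ?e) - g x) - g' x)"
          if "t \<noteq> 0" for t
        proof -
          have "(1 / t) *\<^sub>R (g (x + t *\<^sub>R ?e) - g x) - g' x = (1 / t) *\<^sub>R (g (x + t *\<^sub>R ?e) - g x - t *\<^sub>R g' x)"
            using that by (simp add: scaleR_diff_right)
          then show ?thesis by (simp add: divide_inverse mult.commute abs_inverse)
        qed
        then show "\<forall>\<^sub>F t in at 0. norm (g (x + t *\<^sub>R ?e) - g x - t *\<^sub>R g' x) / norm t = norm ((1 / t) *\<^sub>R (g (x + t *\<^sub>R ?e) - g x) - g' x)"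
          by (auto simp: eventually_at_filter)
      qed
      then have "((\<lambda>t. (1 / t) *\<^sub>R (g (x + t *\<^sub>R ?e) - g x)) \<longlongrightarrow> g' x) (at 0)"
        by (rule LIM_zero_cancel[OF tendsto_norm_zero_cancel])
      moreover have "filterlim h (at 0) sequentially"
        unfolding filterlim_at h_def using LIMSEQ_inverse_real_of_nat by (auto simp: inverse_eq_divide add.commute)
      ultimately show "(\<lambda>m. D m x) \<longlonglongrightarrow> g' x"
        unfolding D_def by (rule filterlim_compose)
    qed
    show "AE x in torus_measure. norm (D m x) \<le> 3 * B" for m
      by (rule AE_I2) (use Dbound in simp)
  qed simp
  then show ?thesis by (simp add: D0 LIMSEQ_const_iff)
qed

subsection \<open>Characters and trigonometric polynomials\<close>

definition character :: "int^'n::finite \<Rightarrow> real^'n \<Rightarrow> complex" where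
  "character \<xi> x = cis (2 * pi * (x \<bullet> lattice_vec \<xi>))"

lemma norm_character [simp]: "norm (character \<xi> x) = 1"
  by (simp add: character_def)

lemma cnj_character: "cnj (character \<xi> x) = character (- \<xi>) x"
  by (simp add: character_def cis_cnj)

lemma character_mult: "character \<xi> x * character \<eta> x = character (\<xi> + \<eta>) x"
  by (simp add: character_def cis_mult lattice_vec_add inner_add_right distrib_left)

lemma character_0 [simp]: "character 0 x = 1"
  by (simp add: character_def)

lemma Re_character: "Re (character \<xi> x) = cos (2 * pi * (x \<bullet> lattice_vec \<xi>))"
  and Im_character: "Im (character \<xi> x) = sin (2 * pi * (x \<bullet> lattice_vec \<xi>))"
  by (simp_all add: character_def)

lemma continuous_on_character [continuous_intros]: "continuous_on S (character \<xi>)"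
  unfolding character_def by (intro continuous_intros)

lemma character_periodic: "lattice_periodic (character (\<xi> :: int^'n::finite))"
  unfolding lattice_periodic_def
proof (intro allI)
  fix x :: "real^'n" and i
  have "2 * pi * ((x + axis i 1) \<bullet> lattice_vec \<xi>) = 2 * pi * (x \<bullet> lattice_vec \<xi>) + 2 * pi * of_int (\<xi> $ i)"
    by (simp add: inner_add_left distrib_left inner_axis' lattice_vec_def)
  then show "character \<xi> (x + axis i 1) = character \<xi> x"
    unfolding character_def by (metis cis_mult cis_multiple_2pi Ints_of_int mult.right_neutral)
qed

lemma character_has_vector_derivative:
  "((\<lambda>t. character \<xi> (x + t *\<^sub>R axis j 1)) has_vector_derivative
      2 * of_real pi * \<i> * of_real (lattice_vec \<xi> $ j) * character \<xi> x) (at 0)"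
proof -
  define a where "a = 2 * pi * (x \<bullet> lattice_vec \<xi>)"
  define b where "b = 2 * pi * lattice_vec \<xi> $ j"
  have "(\<lambda>t. character \<xi> (x + t *\<^sub>R axis j 1)) = (\<lambda>t. cis (a + t * b))"
    by (simp add: character_def inner_add_left inner_axis' a_def b_def algebra_simps)
  moreover have "((\<lambda>t. cis (a + t * b)) has_vector_derivative b *\<^sub>R (\<i> * cis (a + 0 * b))) (at 0)"
  proof -
    have "((\<lambda>z. exp (\<i> * (of_real a + z * of_real b))) has_field_derivative exp (\<i> * (of_real a + of_real 0 * of_real b)) * (\<i> * of_real b)) (at (of_real 0))"
      by (auto intro!: derivative_eq_intros)
    from has_vector_derivative_real_field[OF this] show ?thesis
      by (simp add: cis_conv_exp scaleR_conv_of_real mult_ac)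
  qed
  moreover have "b *\<^sub>R (\<i> * cis (a + 0 * b)) = 2 * of_real pi * \<i> * of_real (lattice_vec \<xi> $ j) * character \<xi> x"
    by (simp add: a_def b_def character_def scaleR_conv_of_real)
  ultimately show ?thesis by simp
qed

lemma lattice_periodic_lattice_vec:
  assumes "lattice_periodic g"
  shows "g (x + lattice_vec \<xi>) = g x"
proof -
  have nat: "g (x + of_nat m *\<^sub>R axis i 1) = g x" for x i and m :: nat
  proof (induction m)
    case (Suc m)
    have "x + of_nat (Suc m) *\<^sub>R axis i 1 = (x + of_nat m *\<^sub>R axis i 1) + axis i 1"
      by (simp add: algebra_simps)
    then show ?case using assms Suc unfolding lattice_periodic_def by metis
  qed simp
  have int: "g (x + of_int m *\<^sub>R axis i 1) = g x" for x i and m :: int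
  proof (cases "m \<ge> 0")
    case True
    then show ?thesis using nat[of x "nat m" i] by simp
  next
    case False
    then show ?thesis using nat[of "x + of_int m *\<^sub>R axis i 1" "nat (- m)" i] by simp
  qed
  have "g (x + (\<Sum>i\<in>I. of_int (\<xi> $ i) *\<^sub>R axis i 1)) = g x" if "finite I" for I
    using that
  proof (induction I rule: finite_induct)
    case (insert i I)
    have "x + (\<Sum>i\<in>insert i I. of_int (\<xi> $ i) *\<^sub>R axis i 1)
       = (x + (\<Sum>i\<in>I. of_int (\<xi> $ i) *\<^sub>R axis i 1)) + of_int (\<xi> $ i) *\<^sub>R axis i 1"
      using insert by (simp add: add_ac)
    then have "g (x + (\<Sum>i\<in>insert i I. of_int (\<xi> $ i) *\<^sub>R axis i 1)) = g (x + (\<Sum>i\<in>I. of_int (\<xi> $ i) *\<^sub>R axis i 1))"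
      by (simp only: int)
    then show ?case using insert by (simp only:)
  qed simp
  moreover have "lattice_vec \<xi> = (\<Sum>i\<in>UNIV. of_int (\<xi> $ i) *\<^sub>R axis i 1)"
    by (simp add: vec_eq_iff lattice_vec_def axis_def if_distrib[of "\<lambda>x. _ * x"] cong: if_cong)
  ultimately show ?thesis by simp
qed

lemma torus_representative:
  obtains \<xi> y where "x = y + lattice_vec \<xi>" "y \<in> torus"
proof
  show "x = (\<chi> i. frac (x $ i)) + lattice_vec (\<chi> i. \<lfloor>x $ i\<rfloor>)"
    by (simp add: vec_eq_iff lattice_vec_def frac_def)
  show "(\<chi> i. frac (x $ i)) \<in> torus"
    by (simp add: torus_def frac_lt_1)
qed

lemma lattice_periodic_bounded:
  fixes g :: "real^'n::finite \<Rightarrow> 'b::real_normed_vector"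
  assumes "continuous_on UNIV g" "lattice_periodic g"
  obtains B where "\<And>x. norm (g x) \<le> B"
proof -
  have "bounded (g ` cbox 0 1)"
    using assms by (intro compact_imp_bounded compact_continuous_image compact_cbox) (auto intro: continuous_on_subset)
  then obtain B where B: "\<And>x. x \<in> cbox 0 1 \<Longrightarrow> norm (g x) \<le> B" unfolding bounded_iff by blast
  show ?thesis
  proof (rule that[of B])
    fix x :: "real^'n"
    obtain \<xi> y where "x = y + lattice_vec \<xi>" "y \<in> torus" by (rule torus_representative)
    then show "norm (g x) \<le> B"
      using lattice_periodic_lattice_vec[OF assms(2)] B torus_subset_cbox by auto
  qed
qed

text \<open>A nontrivial character is a nonzero multiple of one of its own partial derivatives, and
  those integrate to 0.\<close>

lemma integral_character: "integral\<^sup>L torus_measure (character \<xi>) = (if \<xi> = 0 then 1 else 0)"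
proof (cases "\<xi> = 0")
  case False
  then obtain j where j: "\<xi> $ j \<noteq> 0" by (auto simp: vec_eq_iff)
  let ?c = "2 * of_real pi * \<i> * of_real (lattice_vec \<xi> $ j) :: complex"
  have "integral\<^sup>L torus_measure (\<lambda>x. ?c * character \<xi> x) = 0"
    by (rule integral_torus_derivative[OF _ _ character_periodic character_has_vector_derivative])
       (intro continuous_intros)+
  then show ?thesis using j False by (simp add: lattice_vec_def)
next
  case True
  then have "character \<xi> = (\<lambda>_. 1)" by (simp add: fun_eq_iff)
  then show ?thesis using True by simp
qed

definition fourier :: "(real^'n::finite \<Rightarrow> complex) \<Rightarrow> int^'n \<Rightarrow> complex" where
  "fourier f \<xi> = integral\<^sup>L torus_measure (\<lambda>x. f x * cnj (character \<xi> x))"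

lemma integrable_mult_character:
  assumes "integrable torus_measure f"
  shows "integrable torus_measure (\<lambda>x. f x * cnj (character \<xi> x))"
proof (rule Bochner_Integration.integrable_bound[OF assms])
  have "(\<lambda>x. cnj (character \<xi> x)) \<in> borel_measurable torus_measure"
    by (intro continuous_measurable_torus continuous_intros)
  then show "(\<lambda>x. f x * cnj (character \<xi> x)) \<in> borel_measurable torus_measure"
    using assms by (intro borel_measurable_times) auto
qed (auto simp: norm_mult)

lemma norm_fourier_le:
  assumes "f \<in> borel_measurable torus_measure" "\<And>x. x \<in> torus \<Longrightarrow> norm (f x) \<le> B"
  shows "cmod (fourier f \<xi>) \<le> B"
  unfolding fourier_def
proof (rule norm_integral_torus_le)
  have "(\<lambda>x. cnj (character \<xi> x)) \<in> borel_measurable torus_measure"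
    by (intro continuous_measurable_torus continuous_intros)
  then show "(\<lambda>x. f x * cnj (character \<xi> x)) \<in> borel_measurable torus_measure"
    using assms by (intro borel_measurable_times) auto
qed (use assms in \<open>auto simp: norm_mult\<close>)

lemma fourier_character_sum:
  assumes "finite F"
  shows "fourier (\<lambda>x. \<Sum>\<eta>\<in>F. c \<eta> * character \<eta> x) \<xi> = (if \<xi> \<in> F then c \<xi> else 0)"
proof -
  have "fourier (\<lambda>x. \<Sum>\<eta>\<in>F. c \<eta> * character \<eta> x) \<xi> = integral\<^sup>L torus_measure (\<lambda>x. \<Sum>\<eta>\<in>F. c \<eta> * character (\<eta> - \<xi>) x)"
    unfolding fourier_def cnj_character by (simp add: sum_distrib_right mult.assoc character_mult)
  also have "\<dots> = (\<Sum>\<eta>\<in>F. c \<eta> * integral\<^sup>L torus_measure (character (\<eta> - \<xi>)))"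
    by (subst Bochner_Integration.integral_sum) (auto intro!: integrable_torus_continuous continuous_intros)
  also have "\<dots> = (\<Sum>\<eta>\<in>F. if \<eta> = \<xi> then c \<eta> else 0)"
    by (intro sum.cong refl) (auto simp: integral_character)
  finally show ?thesis using assms by simp
qed

section \<open>Density of trigonometric polynomials\<close>

text \<open>Products are not a constructor: linear generation lets orthogonality be checked on
  cosines and sines alone, and closure under products follows from the product-to-sum
  formulas.\<close>

inductive trig_poly :: "(real^'n::finite \<Rightarrow> real) \<Rightarrow> bool" where
  cos: "trig_poly (\<lambda>x. cos (2 * pi * (x \<bullet> lattice_vec \<xi>)))"
| sin: "trig_poly (\<lambda>x. sin (2 * pi * (x \<bullet> lattice_vec \<xi>)))"
| add: "trig_poly f \<Longrightarrow> trig_poly g \<Longrightarrow> trig_poly (\<lambda>x. f x + g x)"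
| cmult: "trig_poly f \<Longrightarrow> trig_poly (\<lambda>x. c * f x)"

lemma trig_poly_const: "trig_poly (\<lambda>_. c)"
  using trig_poly.cmult[OF trig_poly.cos[of 0], of c] by simp

lemma trig_poly_sum:
  assumes "finite I" "\<And>i. i \<in> I \<Longrightarrow> trig_poly (f i)"
  shows "trig_poly (\<lambda>x. \<Sum>i\<in>I. f i x)"
  using assms by (induction I rule: finite_induct) (auto intro: trig_poly_const trig_poly.add)

lemma trig_poly_diff: "trig_poly f \<Longrightarrow> trig_poly g \<Longrightarrow> trig_poly (\<lambda>x. f x - g x)"
  using trig_poly.add[OF _ trig_poly.cmult[of g "- 1"], of f] by simp

lemma trig_poly_mult_basic:
  "trig_poly (\<lambda>x. cos (2 * pi * (x \<bullet> lattice_vec \<xi>)) * cos (2 * pi * (x \<bullet> lattice_vec \<eta>)))"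
  "trig_poly (\<lambda>x. cos (2 * pi * (x \<bullet> lattice_vec \<xi>)) * sin (2 * pi * (x \<bullet> lattice_vec \<eta>)))"
  "trig_poly (\<lambda>x. sin (2 * pi * (x \<bullet> lattice_vec \<xi>)) * cos (2 * pi * (x \<bullet> lattice_vec \<eta>)))"
  "trig_poly (\<lambda>x. sin (2 * pi * (x \<bullet> lattice_vec \<xi>)) * sin (2 * pi * (x \<bullet> lattice_vec \<eta>)))"
proof -
  let ?a = "\<lambda>x. 2 * pi * (x \<bullet> lattice_vec \<xi>)" and ?b = "\<lambda>x. 2 * pi * (x \<bullet> lattice_vec \<eta>)"
  have s: "2 * pi * (x \<bullet> lattice_vec (\<xi> + \<eta>)) = ?a x + ?b x" "2 * pi * (x \<bullet> lattice_vec (\<xi> - \<eta>)) = ?a x - ?b x" for x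
    by (simp_all add: lattice_vec_add lattice_vec_diff inner_add_right inner_diff_right algebra_simps)
  note c = trig_poly.cos[of "\<xi> + \<eta>", unfolded s] trig_poly.cos[of "\<xi> - \<eta>", unfolded s]
    and n = trig_poly.sin[of "\<xi> + \<eta>", unfolded s] trig_poly.sin[of "\<xi> - \<eta>", unfolded s]
  have "(\<lambda>x. cos (?a x) * cos (?b x)) = (\<lambda>x. (1/2) * (cos (?a x + ?b x) + cos (?a x - ?b x)))"
    by (simp add: cos_add cos_diff mult.commute)
  then show "trig_poly (\<lambda>x. cos (?a x) * cos (?b x))"
    by (simp only:) (intro trig_poly.cmult trig_poly.add c)
  have "(\<lambda>x. cos (?a x) * sin (?b x)) = (\<lambda>x. (1/2) * (sin (?a x + ?b x) - sin (?a x - ?b x)))"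
    by (simp add: sin_add sin_diff)
  then show "trig_poly (\<lambda>x. cos (?a x) * sin (?b x))"
    by (simp only:) (intro trig_poly.cmult trig_poly_diff n)
  have "(\<lambda>x. sin (?a x) * cos (?b x)) = (\<lambda>x. (1/2) * (sin (?a x + ?b x) + sin (?a x - ?b x)))"
    by (simp add: sin_add sin_diff mult.commute)
  then show "trig_poly (\<lambda>x. sin (?a x) * cos (?b x))"
    by (simp only:) (intro trig_poly.cmult trig_poly.add n)
  have "(\<lambda>x. sin (?a x) * sin (?b x)) = (\<lambda>x. (1/2) * (cos (?a x - ?b x) - cos (?a x + ?b x)))"
    by (simp add: cos_add cos_diff mult.commute)
  then show "trig_poly (\<lambda>x. sin (?a x) * sin (?b x))"
    by (simp only:) (intro trig_poly.cmult trig_poly_diff c)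
qed

lemma trig_poly_mult:
  assumes "trig_poly f" "trig_poly g"
  shows "trig_poly (\<lambda>x. f x * g x)"
  using assms(1)
proof induction
  case (cos \<xi>)
  show ?case using assms(2)
  proof induction
    case (add f g)
    then show ?case using trig_poly.add[OF add(3,4)] by (simp add: algebra_simps)
  next
    case (cmult f c)
    then show ?case using trig_poly.cmult[OF cmult(2), of c] by (simp add: algebra_simps)
  qed (auto intro: trig_poly_mult_basic)
next
  case (sin \<xi>)
  show ?case using assms(2)
  proof induction
    case (add f g)
    then show ?case using trig_poly.add[OF add(3,4)] by (simp add: algebra_simps)
  next
    case (cmult f c)
    then show ?case using trig_poly.cmult[OF cmult(2), of c] by (simp add: algebra_simps)
  qed (auto intro: trig_poly_mult_basic)
next
  case (add f g)
  then show ?case using trig_poly.add[OF add(3,4)] by (simp add: algebra_simps)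
next
  case (cmult f c)
  then show ?case using trig_poly.cmult[OF cmult(2), of c] by (simp add: algebra_simps)
qed

text \<open>Realizes the torus as a compact subset of complex space, on which Stone-Weierstrass for
  polynomials is available.\<close>

definition torus_embedding :: "real^'n \<Rightarrow> complex^'n::finite" where
  "torus_embedding x = (\<chi> i. cis (2 * pi * (x $ i)))"

lemma trig_poly_polynomial:
  assumes "real_polynomial_function (q :: complex^'n::finite \<Rightarrow> real)"
  shows "trig_poly (\<lambda>x. q (torus_embedding x))"
  using assms
proof induction
  case (linear f)
  then interpret f: bounded_linear f .
  have coord: "x $ i = x \<bullet> lattice_vec (axis i 1)" for x :: "real^'n" and i
  proof -
    have "lattice_vec (axis i 1) = (axis i 1 :: real^'n)"
      by (simp add: lattice_vec_def vec_eq_iff axis_def)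
    then show ?thesis by (simp add: inner_axis)
  qed
  have "f (torus_embedding x) = (\<Sum>i\<in>UNIV. f (axis i 1) * cos (2 * pi * (x \<bullet> lattice_vec (axis i 1))) + f (axis i \<i>) * sin (2 * pi * (x \<bullet> lattice_vec (axis i 1))))" for x
  proof -
    have "torus_embedding x = (\<Sum>i\<in>UNIV. cos (2 * pi * (x $ i)) *\<^sub>R axis i 1 + sin (2 * pi * (x $ i)) *\<^sub>R axis i \<i>)"
      by (simp add: torus_embedding_def vec_eq_iff axis_def complex_eq_iff sum.distrib if_distrib[of "\<lambda>x. _ * x"] if_distrib[of Re] if_distrib[of Im] cong: if_cong)
    then show ?thesis
      by (simp add: f.sum f.add f.scale coord mult.commute)
  qed
  then show ?case
    by (simp only:) (intro trig_poly_sum finite trig_poly.add trig_poly.cmult trig_poly.cos trig_poly.sin)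
qed (auto intro: trig_poly_const trig_poly.add trig_poly_mult)

text \<open>Polynomials in the real and imaginary parts of the embedded coordinates pull back to
  trigonometric polynomials. The function descends to the image because the fibres of the embedding
  are cosets of the lattice, and the descended function is continuous because its closed preimages
  are images of compact parts of the cube.\<close>

lemma trig_poly_dense:
  fixes h :: "real^'n::finite \<Rightarrow> real"
  assumes cont: "continuous_on UNIV h" and per: "lattice_periodic h" and "\<epsilon> > 0"
  obtains q where "trig_poly q" "\<And>x. \<bar>h x - q x\<bar> < \<epsilon>"
proof -
  let ?E = "torus_embedding :: real^'n \<Rightarrow> complex^'n"
  define K where "K = ?E ` cbox 0 1"
  have contE: "continuous_on S ?E" for S
    unfolding torus_embedding_def cis_conv_exp by (intro continuous_intros)
  have fib: "h x = h y" if "?E x = ?E y" for x y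
  proof -
    have "\<exists>m::int. x $ i = y $ i + of_int m" for i
    proof -
      have "cis (2 * pi * (x $ i)) = cis (2 * pi * (y $ i))"
        using that by (simp add: torus_embedding_def vec_eq_iff)
      then have "sin (2 * pi * (x $ i)) = sin (2 * pi * (y $ i)) \<and> cos (2 * pi * (x $ i)) = cos (2 * pi * (y $ i))"
        by (simp add: complex_eq_iff)
      then obtain m :: int where "2 * pi * (x $ i) = 2 * pi * (y $ i) + 2 * pi * of_int m"
        unfolding sin_cos_eq_iff by blast
      then have "2 * pi * (x $ i) = 2 * pi * (y $ i + of_int m)" by (simp add: distrib_left)
      then show ?thesis by auto
    qed
    then obtain m :: "'n \<Rightarrow> int" where "\<And>i. x $ i = y $ i + of_int (m i)" by metis
    then have "x = y + lattice_vec (\<chi> i. m i)" by (simp add: vec_eq_iff lattice_vec_def)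
    then show ?thesis using lattice_periodic_lattice_vec[OF per] by simp
  qed
  \<comment> \<open>The choice of preimage does not matter, by \<open>fib\<close>.\<close>
  define G where "G = (\<lambda>z. h (SOME x. ?E x = z))"
  have G: "G (?E x) = h x" for x
    unfolding G_def by (rule fib) (rule someI[of "\<lambda>y. ?E y = ?E x"], simp)
  have compactK: "compact K"
    unfolding K_def by (intro compact_continuous_image contE compact_cbox)
  have "continuous_on K G"
  proof (subst continuous_on_closed_vimage)
    show "closed K" by (rule compact_imp_closed[OF compactK])
    show "\<forall>B. closed B \<longrightarrow> closed (G -` B \<inter> K)"
    proof (intro allI impI)
      fix B :: "real set" assume "closed B"
      have "G -` B \<inter> K = ?E ` (cbox 0 1 \<inter> h -` B)"
        by (auto simp: K_def G)
      moreover have "closed (h -` B)"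
        using \<open>closed B\<close> cont by (rule closed_vimage) 
      ultimately show "closed (G -` B \<inter> K)"
        by (auto intro!: compact_imp_closed compact_continuous_image contE compact_Int_closed compact_cbox)
    qed
  qed
  then obtain q where q: "real_polynomial_function q" "\<And>z. z \<in> K \<Longrightarrow> \<bar>G z - q z\<bar> < \<epsilon>"
    using Stone_Weierstrass_real_polynomial_function[OF compactK _ \<open>\<epsilon> > 0\<close>] by blast
  show ?thesis
  proof (rule that[OF trig_poly_polynomial[OF q(1)]])
    fix x :: "real^'n"
    obtain \<xi> y where xy: "x = y + lattice_vec \<xi>" "y \<in> torus" by (rule torus_representative)
    have "?E x = ?E y"
    proof -
      have "cis (2 * pi * (x $ i)) = cis (2 * pi * (y $ i))" for i
        using cis_multiple_2pi[of "of_int (\<xi> $ i)"]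
        by (simp add: xy lattice_vec_def distrib_left flip: cis_mult)
      then show ?thesis by (simp add: torus_embedding_def)
    qed
    then have "?E x \<in> K" using xy torus_subset_cbox by (auto simp: K_def)
    from q(2)[OF this] show "\<bar>h x - q (?E x)\<bar> < \<epsilon>" by (simp add: G)
  qed
qed

subsection \<open>Smooth periodic functions and their Fourier series\<close>

lemma trig_poly_continuous: "trig_poly q \<Longrightarrow> continuous_on UNIV q"
  by (induction rule: trig_poly.induct) (auto intro!: continuous_intros)

lemma fourier_zero_orthogonal:
  assumes f: "continuous_on UNIV f" and zero: "\<And>\<xi>. fourier f \<xi> = 0" and "trig_poly q"
  shows "integral\<^sup>L torus_measure (\<lambda>x. f x * of_real (q x)) = 0"
  using \<open>trig_poly q\<close>
proof induction
  have int: "integrable torus_measure (\<lambda>x. f x * character \<xi> x)" for \<xi>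
    by (intro integrable_torus_continuous continuous_intros f)
  have char: "integral\<^sup>L torus_measure (\<lambda>x. f x * character \<xi> x) = 0" for \<xi>
    using zero[of "- \<xi>"] by (simp add: fourier_def cnj_character)
  {
    case (cos \<xi>)
    have eq: "of_real (cos (2 * pi * (x \<bullet> lattice_vec \<xi>))) = (character \<xi> x + character (- \<xi>) x) / 2" for x
      unfolding cnj_character[symmetric] by (simp add: complex_eq_iff Re_character)
    have "(\<lambda>x. f x * of_real (cos (2 * pi * (x \<bullet> lattice_vec \<xi>)))) = (\<lambda>x. (f x * character \<xi> x + f x * character (- \<xi>) x) / 2)"
      unfolding eq by (simp add: algebra_simps add_divide_distrib)
    then show ?case using int by (simp add: char)
  next
    case (sin \<xi>)
    have eq: "of_real (sin (2 * pi * (x \<bullet> lattice_vec \<xi>))) = (character \<xi> x - character (- \<xi>) x) / (2 * \<i>)" for x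
      unfolding cnj_character[symmetric] by (simp add: complex_eq_iff Im_character)
    have "(\<lambda>x. f x * of_real (sin (2 * pi * (x \<bullet> lattice_vec \<xi>)))) = (\<lambda>x. (f x * character \<xi> x - f x * character (- \<xi>) x) / (2 * \<i>))"
      unfolding eq by (simp add: algebra_simps diff_divide_distrib)
    then show ?case using int by (simp add: char)
  next
    case (add g h)
    have "integrable torus_measure (\<lambda>x. f x * of_real (g x))" "integrable torus_measure (\<lambda>x. f x * of_real (h x))"
      using add trig_poly_continuous by (auto intro!: integrable_torus_continuous continuous_intros f)
    then show ?case using add by (simp add: distrib_left)
  next
    case (cmult g c)
    then show ?case by (simp add: mult.left_commute[of _ "of_real c"])
  }
qed

text \<open>Zero almost everywhere becomes zero on the open box by continuity, then on its closure,
  then everywhere by periodicity.\<close>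

lemma integral_torus_square_zero:
  fixes h :: "real^'n::finite \<Rightarrow> real"
  assumes cont: "continuous_on UNIV h" and per: "lattice_periodic h"
    and zero: "integral\<^sup>L torus_measure (\<lambda>x. (h x)\<^sup>2) = 0"
  shows "h x = 0"
proof -
  have "AE x in torus_measure. (h x)\<^sup>2 = 0"
    using zero by (subst (asm) integral_nonneg_eq_0_iff_AE) (auto intro!: integrable_torus_continuous continuous_intros cont)
  then have "AE x in lebesgue. x \<in> torus \<longrightarrow> h x = 0"
    unfolding torus_measure_def by (subst (asm) AE_restrict_space_iff) auto
  then have "AE x\<in>box 0 1 in lebesgue. x \<in> {x. h x = 0}"
    using box_subset_torus by (auto elim!: eventually_mono)
  then have box: "h x = 0" if "x \<in> box 0 1" for x
    using mem_closed_if_AE_lebesgue_open[OF open_box _ _ that, of "{x. h x = 0}"] closed_Collect_eq[OF cont continuous_on_const]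
    by auto
  have "box 0 (1 :: real^'n) \<noteq> {}"
  proof -
    have "(1/2) *\<^sub>R 1 \<in> box 0 (1 :: real^'n)" by (simp add: mem_box_cart)
    then show ?thesis by blast
  qed
  then have "closure (box 0 (1 :: real^'n)) = cbox 0 1" by (rule closure_box)
  then have cbox: "h x = 0" if "x \<in> cbox 0 1" for x
    using continuous_constant_on_closure[of "box 0 1" h 0 x] box that cont continuous_on_subset by blast
  obtain \<xi> y where "x = y + lattice_vec \<xi>" "y \<in> torus" by (rule torus_representative)
  then show ?thesis using lattice_periodic_lattice_vec[OF per] cbox torus_subset_cbox by auto
qed

text \<open>Orthogonality to characters extends to all continuous periodic functions by density, in
  particular to the real and imaginary parts of \<open>f\<close> itself.\<close>

lemma fourier_zero_imp_zero:
  assumes cont: "continuous_on UNIV f" and per: "lattice_periodic f" and zero: "\<And>\<xi>. fourier f \<xi> = 0"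
  shows "f x = 0"
proof -
  obtain B where B: "\<And>x. norm (f x) \<le> B" using lattice_periodic_bounded[OF cont per] by blast
  then have B0: "0 \<le> B" using norm_ge_zero order_trans by blast
  have orth: "integral\<^sup>L torus_measure (\<lambda>x. f x * of_real (h x)) = 0"
    if h: "continuous_on UNIV h" "lattice_periodic h" for h
  proof -
    have "norm (integral\<^sup>L torus_measure (\<lambda>x. f x * of_real (h x))) \<le> B * \<epsilon>" if "\<epsilon> > 0" for \<epsilon>
    proof -
      obtain q where q: "trig_poly q" "\<And>x. \<bar>h x - q x\<bar> < \<epsilon>" using trig_poly_dense[OF h \<open>\<epsilon> > 0\<close>] by blast
      have cq: "continuous_on UNIV q" by (rule trig_poly_continuous[OF q(1)])
      have ints: "integrable torus_measure (\<lambda>x. f x * of_real (h x))" "integrable torus_measure (\<lambda>x. f x * of_real (q x))"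
        by (intro integrable_torus_continuous continuous_intros cont h cq)+
      then have "integral\<^sup>L torus_measure (\<lambda>x. f x * of_real (h x)) = integral\<^sup>L torus_measure (\<lambda>x. f x * of_real (h x) - f x * of_real (q x))"
        using fourier_zero_orthogonal[OF cont zero q(1)] by simp
      also have "norm \<dots> \<le> B * \<epsilon>"
      proof (rule norm_integral_torus_le)
        show "(\<lambda>x. f x * of_real (h x) - f x * of_real (q x)) \<in> borel_measurable torus_measure"
          by (intro continuous_measurable_torus continuous_intros cont h cq)
        fix x
        have "f x * of_real (h x) - f x * of_real (q x) = f x * of_real (h x - q x)" by (simp add: algebra_simps)
        then show "norm (f x * of_real (h x) - f x * of_real (q x)) \<le> B * \<epsilon>"
          using B[of x] q(2)[of x] B0 by (simp add: norm_mult del: of_real_diff) (intro mult_mono, auto)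
      qed
      finally show ?thesis .
    qed
    then have "norm (integral\<^sup>L torus_measure (\<lambda>x. f x * of_real (h x))) \<le> 0"
    proof -
      assume *: "\<And>\<epsilon>. \<epsilon> > 0 \<Longrightarrow> norm (integral\<^sup>L torus_measure (\<lambda>x. f x * of_real (h x))) \<le> B * \<epsilon>"
      show ?thesis
      proof (rule field_le_epsilon)
        fix e :: real assume "e > 0"
        then have "norm (integral\<^sup>L torus_measure (\<lambda>x. f x * of_real (h x))) \<le> B * (e / (B + 1))"
          using B0 by (intro *) auto
        also have "\<dots> \<le> e" using B0 \<open>e > 0\<close> by (simp add: field_simps)
        finally show "norm (integral\<^sup>L torus_measure (\<lambda>x. f x * of_real (h x))) \<le> 0 + e" by simp
      qed
    qed
    then show ?thesis by simp
  qed
  have c: "continuous_on UNIV (\<lambda>x. Re (f x))" "continuous_on UNIV (\<lambda>x. Im (f x))"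
    by (intro continuous_intros cont)+
  have p: "lattice_periodic (\<lambda>x. Re (f x))" "lattice_periodic (\<lambda>x. Im (f x))"
    using per by (simp_all add: lattice_periodic_def)
  have "integral\<^sup>L torus_measure (\<lambda>x. (Re (f x))\<^sup>2) = Re (integral\<^sup>L torus_measure (\<lambda>x. f x * of_real (Re (f x))))"
    by (subst integral_Re[symmetric]) (auto intro!: integrable_torus_continuous continuous_intros cont simp: power2_eq_square)
  then have "Re (f x) = 0"
    using orth[OF c(1) p(1)] by (intro integral_torus_square_zero[OF c(1) p(1)]) simp
  moreover have "integral\<^sup>L torus_measure (\<lambda>x. (Im (f x))\<^sup>2) = Im (integral\<^sup>L torus_measure (\<lambda>x. f x * of_real (Im (f x))))"
    by (subst integral_Im[symmetric]) (auto intro!: integrable_torus_continuous continuous_intros cont simp: power2_eq_square)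
  then have "Im (f x) = 0"
    using orth[OF c(2) p(2)] by (intro integral_torus_square_zero[OF c(2) p(2)]) simp
  ultimately show ?thesis by (simp add: complex_eq_iff)
qed

section \<open>The algebra of smooth periodic functions and their derivatives\<close>

lemma partial_derivative_eq:
  "(f has_derivative D) (at x) \<Longrightarrow> partial_derivative j f x = D (axis j 1)"
  by (simp add: partial_derivative_def frechet_derivative_at[symmetric])

lemma partial_has_vector_derivative:
  assumes "f differentiable (at x)"
  shows "((\<lambda>t. f (x + t *\<^sub>R axis j 1)) has_vector_derivative partial_derivative j f x) (at 0)"
proof -
  obtain D where D: "(f has_derivative D) (at x)" using assms by (auto simp: differentiable_def)
  have "((\<lambda>t. f (x + t *\<^sub>R axis j 1)) has_derivative (\<lambda>t. D (t *\<^sub>R axis j 1))) (at 0)"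
    by (rule has_derivative_compose[where g=f and f="\<lambda>t. x + t *\<^sub>R axis j 1"]) (use D in \<open>auto intro!: derivative_eq_intros\<close>)
  moreover have "D (t *\<^sub>R axis j 1) = t *\<^sub>R D (axis j 1)" for t
    using has_derivative_bounded_linear[OF D] linear_simps(5) by blast
  ultimately show ?thesis
    by (simp add: has_vector_derivative_def partial_derivative_eq[OF D])
qed

lemma iterated_partial_Nil [simp]: "iterated_partial [] f = f"
  and iterated_partial_Cons: "iterated_partial (j # js) f = partial_derivative j (iterated_partial js f)"
  and iterated_partial_snoc: "iterated_partial (js @ [j]) f = iterated_partial js (partial_derivative j f)"
  by (simp_all add: iterated_partial_def)

text \<open>Coinduction for smoothness: exhibiting a class of differentiable functions closed under
  partial derivatives avoids computing the iterated derivatives of any member.\<close>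

lemma smooth_coinduct:
  assumes "f \<in> S" "\<And>f. f \<in> S \<Longrightarrow> f differentiable_on UNIV" "\<And>f j. f \<in> S \<Longrightarrow> partial_derivative j f \<in> S"
  shows "smooth f"
proof -
  have "iterated_partial js f \<in> S" for js
    by (induction js) (use assms in \<open>auto simp: iterated_partial_Cons\<close>)
  then show ?thesis using assms(2) by (simp add: smooth_def)
qed

lemma smooth_differentiable: "smooth f \<Longrightarrow> f differentiable_on UNIV"
  unfolding smooth_def by (metis iterated_partial_Nil)

lemma smooth_differentiable_at: "smooth f \<Longrightarrow> f differentiable (at x)"
  using smooth_differentiable[of f] by (simp add: differentiable_on_def)

lemma smooth_partial_derivative: "smooth f \<Longrightarrow> smooth (partial_derivative j f)"
  unfolding smooth_def by (metis iterated_partial_snoc)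

lemma periodic_partial_derivative:
  assumes "periodic f" "f differentiable_on UNIV"
  shows "periodic (partial_derivative j f)"
  unfolding periodic_def
proof (intro allI)
  fix x i
  let ?a = "axis i 1 :: real^'a"
  have "f differentiable (at (x + ?a))" using assms by (simp add: differentiable_on_def)
  then obtain D where D: "(f has_derivative D) (at (x + ?a))" by (auto simp: differentiable_def)
  have "((\<lambda>y. f (y + ?a)) has_derivative D) (at x)"
    by (rule has_derivative_compose[where g=f and f="\<lambda>y. y + ?a", of "\<lambda>h. h", simplified])
       (use D in \<open>auto intro!: derivative_eq_intros\<close>)
  moreover have "(\<lambda>y. f (y + ?a)) = f" using assms by (simp add: periodic_def)
  ultimately have "(f has_derivative D) (at x)" by simp
  then show "partial_derivative j f (x + ?a) = partial_derivative j f x"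
    using partial_derivative_eq D by metis
qed

lemma C_per_partial_derivative: "f \<in> C_per \<Longrightarrow> partial_derivative j f \<in> C_per"
  by (auto simp: C_per_def intro: smooth_partial_derivative periodic_partial_derivative smooth_differentiable)

lemma C_per_differentiable_at: "f \<in> C_per \<Longrightarrow> f differentiable (at x)"
  by (simp add: C_per_def smooth_differentiable_at)

lemma C_per_continuous: "f \<in> C_per \<Longrightarrow> continuous_on UNIV f"
  using differentiable_imp_continuous_on smooth_differentiable by (auto simp: C_per_def)

lemma C_per_periodic: "f \<in> C_per \<Longrightarrow> lattice_periodic f"
  by (simp add: C_per_def periodic_iff_lattice_periodic)

lemma C_per_bounded:
  assumes "f \<in> C_per"
  obtains B where "\<And>x. \<bar>f x\<bar> \<le> B"
  using lattice_periodic_bounded[OF C_per_continuous[OF assms] C_per_periodic[OF assms]] by auto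

lemma partial_derivative_linear:
  assumes "f differentiable (at x)" "g differentiable (at x)"
  shows "partial_derivative j (\<lambda>x. a * f x + b * g x) x = a * partial_derivative j f x + b * partial_derivative j g x"
proof -
  obtain D E where D: "(f has_derivative D) (at x)" "(g has_derivative E) (at x)"
    using assms by (auto simp: differentiable_def)
  then have "((\<lambda>x. a * f x + b * g x) has_derivative (\<lambda>h. a * D h + b * E h)) (at x)"
    by (auto intro!: derivative_eq_intros)
  then show ?thesis using D by (simp add: partial_derivative_eq)
qed

lemma C_per_linear:
  assumes "f \<in> C_per" "g \<in> C_per"
  shows "(\<lambda>x. a * f x + b * g x) \<in> C_per"
proof -
  let ?S = "{h. \<exists>f g. smooth f \<and> smooth g \<and> h = (\<lambda>x. a * f x + b * g x)}"
  have "smooth (\<lambda>x. a * f x + b * g x)"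
  proof (rule smooth_coinduct[of _ ?S])
    show "(\<lambda>x. a * f x + b * g x) \<in> ?S" using assms by (auto simp: C_per_def)
    fix h assume "h \<in> ?S"
    then obtain f g where fg: "smooth f" "smooth g" "h = (\<lambda>x. a * f x + b * g x)" by blast
    show "h differentiable_on UNIV"
      unfolding fg(3) by (intro derivative_intros smooth_differentiable fg)
    fix j
    have "partial_derivative j h = (\<lambda>x. a * partial_derivative j f x + b * partial_derivative j g x)"
      unfolding fg(3) using partial_derivative_linear fg(1,2) smooth_differentiable_at by blast
    then show "partial_derivative j h \<in> ?S" using fg smooth_partial_derivative by blast
  qed
  then show ?thesis using assms by (simp add: C_per_def periodic_def)
qed

lemma C_per_add: "f \<in> C_per \<Longrightarrow> g \<in> C_per \<Longrightarrow> (\<lambda>x. f x + g x) \<in> C_per"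
  using C_per_linear[of f g 1 1] by simp

lemma C_per_cmult: "f \<in> C_per \<Longrightarrow> (\<lambda>x. c * f x) \<in> C_per"
  using C_per_linear[of f f c 0] by simp

lemma character_has_derivative:
  "(character \<xi> has_derivative (\<lambda>h. 2 * of_real pi * \<i> * of_real (h \<bullet> lattice_vec \<xi>) * character \<xi> x)) (at x)"
proof -
  have 1: "((\<lambda>x. \<i> * complex_of_real (2 * pi * (x \<bullet> lattice_vec \<xi>))) has_derivative (\<lambda>h. \<i> * of_real (2 * pi * (h \<bullet> lattice_vec \<xi>)))) (at x)"
    by (intro derivative_intros)
  have 2: "(exp has_derivative (*) (exp z)) (at z)" for z :: complex
    by (rule DERIV_exp[unfolded has_field_derivative_def])
  note has_derivative_compose[OF 1 2]
  then show ?thesis by (simp add: character_def[abs_def] cis_conv_exp mult_ac)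
qed

definition fourier_sum :: "(int^'n::finite) set \<Rightarrow> (int^'n \<Rightarrow> complex) \<Rightarrow> real^'n \<Rightarrow> real" where
  "fourier_sum F c x = Re (\<Sum>\<xi>\<in>F. c \<xi> * character \<xi> x)"

lemma fourier_sum_has_derivative:
  "(fourier_sum F c has_derivative (\<lambda>h. Re (\<Sum>\<xi>\<in>F. c \<xi> * (2 * of_real pi * \<i> * of_real (h \<bullet> lattice_vec \<xi>) * character \<xi> x)))) (at x)"
  unfolding fourier_sum_def[abs_def] by (intro derivative_intros character_has_derivative)

lemma partial_derivative_fourier_sum:
  "partial_derivative j (fourier_sum F c) = fourier_sum F (\<lambda>\<xi>. 2 * of_real pi * \<i> * of_real (lattice_vec \<xi> $ j) * c \<xi>)"
proof
  fix x
  show "partial_derivative j (fourier_sum F c) x = fourier_sum F (\<lambda>\<xi>. 2 * of_real pi * \<i> * of_real (lattice_vec \<xi> $ j) * c \<xi>) x"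
    unfolding partial_derivative_eq[OF fourier_sum_has_derivative]
    by (simp add: fourier_sum_def inner_axis' mult_ac)
qed

lemma fourier_sum_C_per: "fourier_sum F c \<in> C_per"
proof -
  have "smooth (fourier_sum F c)"
  proof (rule smooth_coinduct[of _ "range (fourier_sum F)"])
    fix f assume "f \<in> range (fourier_sum F)"
    then show "f differentiable_on UNIV" 
      using fourier_sum_has_derivative by (auto simp: differentiable_on_def differentiable_def)
  qed (auto simp: partial_derivative_fourier_sum)
  moreover have "periodic (fourier_sum F c)"
    by (simp add: periodic_def fourier_sum_def character_periodic[unfolded lattice_periodic_def, rule_format])
  ultimately show ?thesis by (simp add: C_per_def)
qed

lemma fourier_linear:
  assumes "integrable torus_measure f" "integrable torus_measure g"
  shows "fourier (\<lambda>x. a * f x + b * g x) \<xi> = a * fourier f \<xi> + b * fourier g \<xi>"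
  using integrable_mult_character[OF assms(1), of \<xi>] integrable_mult_character[OF assms(2), of \<xi>]
  by (simp add: fourier_def distrib_right mult.assoc)

definition real_fourier :: "(real^'n::finite \<Rightarrow> real) \<Rightarrow> int^'n \<Rightarrow> complex" where
  "real_fourier \<phi> = fourier (\<lambda>x. of_real (\<phi> x))"

lemma integrable_torus_of_real:
  "integrable torus_measure f \<Longrightarrow> integrable torus_measure (\<lambda>x. complex_of_real (f x))"
  by simp

lemma C_per_integrable: "\<phi> \<in> C_per \<Longrightarrow> integrable torus_measure \<phi>"
  by (intro integrable_torus_continuous C_per_continuous)

lemma real_fourier_linear:
  assumes "integrable torus_measure f" "integrable torus_measure g"
  shows "real_fourier (\<lambda>x. a * f x + b * g x) \<xi> = of_real a * real_fourier f \<xi> + of_real b * real_fourier g \<xi>"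
  using fourier_linear[OF assms[THEN integrable_torus_of_real], of "of_real a" "of_real b" \<xi>]
  by (simp add: real_fourier_def)

lemma hermitian_real_fourier: "hermitian (real_fourier \<phi>)"
  unfolding hermitian_def
proof
  fix \<xi>
  have "cnj (real_fourier \<phi> \<xi>) = integral\<^sup>L torus_measure (\<lambda>x. cnj (of_real (\<phi> x) * cnj (character \<xi> x)))"
    unfolding real_fourier_def fourier_def by (rule Bochner_Integration.integral_cnj[symmetric])
  then show "real_fourier \<phi> (- \<xi>) = cnj (real_fourier \<phi> \<xi>)"
    by (simp add: real_fourier_def fourier_def cnj_character)
qed

text \<open>Integration by parts against \<open>character (- \<xi>)\<close>; no boundary term arises
  because the product is periodic.\<close>

lemma real_fourier_partial_derivative:
  assumes \<phi>: "\<phi> \<in> C_per"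
  shows "real_fourier (partial_derivative j \<phi>) \<xi> = 2 * of_real pi * \<i> * of_real (lattice_vec \<xi> $ j) * real_fourier \<phi> \<xi>"
proof -
  let ?c = "2 * of_real pi * \<i> * of_real (lattice_vec \<xi> $ j) :: complex"
  note pd = C_per_partial_derivative[OF \<phi>, of j]
  have "integral\<^sup>L torus_measure (\<lambda>x. of_real (\<phi> x) * (- ?c * character (- \<xi>) x) + of_real (partial_derivative j \<phi> x) * character (- \<xi>) x) = 0"
  proof (rule integral_torus_derivative[where g="\<lambda>x. of_real (\<phi> x) * character (- \<xi>) x"])
    show "continuous_on UNIV (\<lambda>x. of_real (\<phi> x) * character (- \<xi>) x)"
      by (intro continuous_intros C_per_continuous \<phi>)
    show "continuous_on UNIV (\<lambda>x. of_real (\<phi> x) * (- ?c * character (- \<xi>) x) + of_real (partial_derivative j \<phi> x) * character (- \<xi>) x)"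
      by (intro continuous_intros C_per_continuous \<phi> pd)
    show "lattice_periodic (\<lambda>x. of_real (\<phi> x) * character (- \<xi>) x :: complex)"
      using C_per_periodic[OF \<phi>] character_periodic[of "- \<xi>"] by (simp add: lattice_periodic_def)
    fix x
    have "((\<lambda>t. of_real (\<phi> (x + t *\<^sub>R axis j 1)) :: complex) has_vector_derivative of_real (partial_derivative j \<phi> x)) (at 0)"
      using partial_has_vector_derivative[OF C_per_differentiable_at[OF \<phi>], of x j] by (rule bounded_linear.has_vector_derivative[OF bounded_linear_of_real])
    from has_vector_derivative_mult[OF this character_has_vector_derivative[of "- \<xi>" x j]]
    show "((\<lambda>t. of_real (\<phi> (x + t *\<^sub>R axis j 1)) * character (- \<xi>) (x + t *\<^sub>R axis j 1)) has_vector_derivative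
        of_real (\<phi> x) * (- ?c * character (- \<xi>) x) + of_real (partial_derivative j \<phi> x) * character (- \<xi>) x) (at 0)"
      by simp
  qed
  moreover have "integrable torus_measure (\<lambda>x. of_real (\<phi> x) * (- ?c * character (- \<xi>) x))"
    and "integrable torus_measure (\<lambda>x. of_real (partial_derivative j \<phi> x) * character (- \<xi>) x)"
    by (intro integrable_torus_continuous continuous_intros C_per_continuous \<phi> pd)+
  ultimately have "integral\<^sup>L torus_measure (\<lambda>x. of_real (partial_derivative j \<phi> x) * character (- \<xi>) x)
     = - integral\<^sup>L torus_measure (\<lambda>x. of_real (\<phi> x) * (- ?c * character (- \<xi>) x))"
    by (simp add: add_eq_0_iff2)
  also have "\<dots> = ?c * integral\<^sup>L torus_measure (\<lambda>x. of_real (\<phi> x) * character (- \<xi>) x)"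
    unfolding integral_mult_right_zero[symmetric] integral_minus[symmetric]
    by (intro Bochner_Integration.integral_cong refl) (simp add: algebra_simps)
  finally show ?thesis by (simp add: real_fourier_def fourier_def cnj_character)
qed

text \<open>The operator \<open>1 - \<Delta> / (4 \<pi>\<^sup>2)\<close>, whose Fourier symbol is \<open>weight\<close>.\<close>
definition bessel :: "'n::finite scalar \<Rightarrow> 'n scalar" where
  "bessel \<phi> x = \<phi> x + (- 1 / (4 * pi\<^sup>2)) * (\<Sum>j\<in>UNIV. partial_derivative j (partial_derivative j \<phi>) x)"

lemma C_per_sum: "finite I \<Longrightarrow> (\<And>i. i \<in> I \<Longrightarrow> f i \<in> C_per) \<Longrightarrow> (\<lambda>x. \<Sum>i\<in>I. f i x) \<in> C_per"
proof (induction I rule: finite_induct)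
  case empty
  show ?case using fourier_sum_C_per[of "{}" "\<lambda>_. 0"] by (simp add: fourier_sum_def[abs_def])
qed (auto intro: C_per_add)

lemma C_per_bessel:
  assumes "\<phi> \<in> C_per"
  shows "bessel \<phi> \<in> C_per"
  unfolding bessel_def[abs_def]
  by (intro C_per_add C_per_cmult C_per_sum C_per_partial_derivative assms) simp

lemma real_fourier_sum:
  assumes "finite I" "\<And>i. i \<in> I \<Longrightarrow> integrable torus_measure (f i)"
  shows "real_fourier (\<lambda>x. \<Sum>i\<in>I. f i x) \<xi> = (\<Sum>i\<in>I. real_fourier (f i) \<xi>)"
  unfolding real_fourier_def fourier_def of_real_sum sum_distrib_right
  by (rule Bochner_Integration.integral_sum) (intro integrable_mult_character integrable_torus_of_real assms)

lemma real_fourier_bessel: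
  assumes \<phi>: "\<phi> \<in> C_per"
  shows "real_fourier (bessel \<phi>) \<xi> = of_real (weight \<xi>) * real_fourier \<phi> \<xi>"
proof -
  have C: "(\<lambda>x. \<Sum>j\<in>UNIV. partial_derivative j (partial_derivative j \<phi>) x) \<in> C_per"
    by (intro C_per_sum C_per_partial_derivative \<phi>) simp
  have "real_fourier (bessel \<phi>) \<xi> = real_fourier \<phi> \<xi> + of_real (- 1 / (4 * pi\<^sup>2)) * real_fourier (\<lambda>x. \<Sum>j\<in>UNIV. partial_derivative j (partial_derivative j \<phi>) x) \<xi>"
    using real_fourier_linear[OF C_per_integrable[OF \<phi>] C_per_integrable[OF C], of 1 "- 1 / (4 * pi\<^sup>2)" \<xi>]
    by (simp add: bessel_def[abs_def])
  also have "real_fourier (\<lambda>x. \<Sum>j\<in>UNIV. partial_derivative j (partial_derivative j \<phi>) x) \<xi>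
      = (\<Sum>j\<in>UNIV. of_real (- (4 * pi\<^sup>2) * (lattice_vec \<xi> $ j)\<^sup>2) * real_fourier \<phi> \<xi>)"
    by (subst real_fourier_sum)
       (auto simp: real_fourier_partial_derivative C_per_partial_derivative \<phi> power2_eq_square algebra_simps
             intro!: C_per_integrable C_per_partial_derivative)
  also have "\<dots> = of_real (- (4 * pi\<^sup>2) * (norm (lattice_vec \<xi>))\<^sup>2) * real_fourier \<phi> \<xi>"
    unfolding norm_lattice_vec_power2 by (simp add: sum_distrib_left sum_distrib_right lattice_vec_def)
  finally show ?thesis by (simp add: weight_def algebra_simps)
qed

text \<open>Each application of \<open>bessel\<close> multiplies the coefficients by
  \<open>weight\<close> and stays in \<open>C_per\<close>, where coefficients are bounded. Applying
  it \<open>m\<close> times gives decay of order \<open>m\<close> in the weight.\<close>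

lemma real_fourier_decay:
  assumes "\<phi> \<in> C_per"
  obtains B where "\<And>\<xi>. cmod (real_fourier \<phi> \<xi>) \<le> B * weight \<xi> powr - real m"
proof -
  have "\<exists>B. \<forall>\<xi>. weight \<xi> ^ m * cmod (real_fourier \<phi> \<xi>) \<le> B"
    using assms
  proof (induction m arbitrary: \<phi>)
    case 0
    obtain B where "\<And>x. \<bar>\<phi> x\<bar> \<le> B" using C_per_bounded[OF 0] by blast
    then have "cmod (real_fourier \<phi> \<xi>) \<le> B" for \<xi>
      unfolding real_fourier_def
      by (intro norm_fourier_le continuous_measurable_torus continuous_intros C_per_continuous 0) simp
    then show ?case by auto
  next
    case (Suc m)
    obtain B where "\<And>\<xi>. weight \<xi> ^ m * cmod (real_fourier (bessel \<phi>) \<xi>) \<le> B"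
      using Suc.IH[OF C_per_bessel[OF Suc.prems]] by blast
    then show ?case
      by (intro exI[of _ B]) (simp add: real_fourier_bessel[OF Suc.prems] norm_mult mult_ac)
  qed
  then obtain B where B: "\<And>\<xi>. weight \<xi> ^ m * cmod (real_fourier \<phi> \<xi>) \<le> B" by blast
  show ?thesis
  proof (rule that[of B])
    fix \<xi> :: "int^'a"
    show "cmod (real_fourier \<phi> \<xi>) \<le> B * weight \<xi> powr - real m"
      using B[of \<xi>] by (simp add: powr_minus_divide powr_realpow field_simps)
  qed
qed

lemma summable_real_fourier:
  fixes \<phi> :: "'n::finite scalar"
  assumes "\<phi> \<in> C_per"
  shows "(\<lambda>\<xi>. cmod (real_fourier \<phi> \<xi>)) summable_on UNIV"
proof -
  obtain B where B: "\<And>\<xi>. cmod (real_fourier \<phi> \<xi>) \<le> B * weight \<xi> powr - real CARD('n)"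
    using real_fourier_decay[OF assms, of "CARD('n)"] by blast
  show ?thesis
  proof (rule summable_on_comparison_test[OF _ B])
    show "(\<lambda>\<xi>::int^'n. B * weight \<xi> powr - real CARD('n)) summable_on UNIV"
      by (intro summable_on_cmult_right summable_on_weight) simp
  qed simp
qed

lemma sobolev_real_fourier:
  fixes \<phi> :: "'n::finite scalar"
  assumes "\<phi> \<in> C_per"
  shows "sobolev s (real_fourier \<phi>)"
proof -
  obtain m :: nat where m: "\<bar>s\<bar> + real CARD('n) \<le> real m" by (meson real_arch_simple)
  obtain B where B: "\<And>\<xi>. cmod (real_fourier \<phi> \<xi>) \<le> B * weight \<xi> powr - real m"
    using real_fourier_decay[OF assms, of m] by blast
  show ?thesis
  proof (rule sobolev_bound[OF _ B])
    have "real CARD('n) > 0" by simp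
    then have "(\<lambda>\<xi>::int^'n. weight \<xi> powr - (2 * real m - s)) summable_on UNIV"
      using m abs_ge_self[of s] abs_ge_zero[of s] by (intro summable_on_weight) linarith
    moreover have "weight \<xi> powr - (2 * real m - s) = weight \<xi> powr s * (norm (weight \<xi> powr - real m))\<^sup>2" for \<xi> :: "int^'n"
      by (simp add: powr_power flip: powr_add)
    ultimately show "sobolev s (\<lambda>\<xi>::int^'n. weight \<xi> powr - real m)"
      by (simp add: sobolev_def)
  qed
qed

lemma abs_fourier_series:
  fixes c :: "int^'n::finite \<Rightarrow> complex"
  assumes summ: "(\<lambda>\<xi>. cmod (c \<xi>)) summable_on UNIV"
  defines "S \<equiv> \<lambda>x. \<Sum>\<^sub>\<infinity>\<xi>. c \<xi> * character \<xi> x"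
  shows "uniform_limit UNIV (\<lambda>F x. \<Sum>\<xi>\<in>F. c \<xi> * character \<xi> x) S (finite_subsets_at_top UNIV)"
    and "continuous_on UNIV S" and "lattice_periodic S" and "fourier S \<eta> = c \<eta>"
proof -
  show lim: "uniform_limit UNIV (\<lambda>F x. \<Sum>\<xi>\<in>F. c \<xi> * character \<xi> x) S (finite_subsets_at_top UNIV)"
    unfolding S_def by (rule Weierstrass_m_test_general[OF _ summ]) (simp add: norm_mult)
  have contF: "continuous_on UNIV (\<lambda>x. \<Sum>\<xi>\<in>F. c \<xi> * character \<xi> x)" for F
    by (intro continuous_intros)
  show contS: "continuous_on UNIV S"
    by (rule uniform_limit_theorem[OF _ lim]) (auto intro: always_eventually contF)
  show "lattice_periodic S"
    by (simp add: lattice_periodic_def S_def character_periodic[unfolded lattice_periodic_def, rule_format])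
  show "fourier S \<eta> = c \<eta>"
  proof -
    have "cmod (fourier S \<eta> - c \<eta>) \<le> 0 + \<epsilon>" if "\<epsilon> > 0" for \<epsilon>
    proof -
      have "eventually (\<lambda>F. \<forall>x\<in>UNIV. dist (\<Sum>\<xi>\<in>F. c \<xi> * character \<xi> x) (S x) < \<epsilon>) (finite_subsets_at_top UNIV)"
        using uniform_limitD[OF lim \<open>\<epsilon> > 0\<close>] .
      then obtain F0 where F0: "finite F0" "\<And>F. finite F \<Longrightarrow> F0 \<subseteq> F \<Longrightarrow> \<forall>x. dist (\<Sum>\<xi>\<in>F. c \<xi> * character \<xi> x) (S x) < \<epsilon>"
        unfolding eventually_finite_subsets_at_top by auto
      define F where "F = insert \<eta> F0"
      have F: "finite F" "\<eta> \<in> F" "\<And>x. cmod (S x - (\<Sum>\<xi>\<in>F. c \<xi> * character \<xi> x)) < \<epsilon>"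
        using F0(1) F0(2)[of F] by (auto simp: F_def dist_norm norm_minus_commute)
      have "fourier S \<eta> - c \<eta> = fourier (\<lambda>x. 1 * S x + (- 1) * (\<Sum>\<xi>\<in>F. c \<xi> * character \<xi> x)) \<eta>"
        using fourier_linear[OF integrable_torus_continuous[OF contS] integrable_torus_continuous[OF contF[of F]], of 1 "- 1" \<eta>]
          fourier_character_sum[OF F(1), of c \<eta>] F(2) by simp
      also have "cmod \<dots> \<le> \<epsilon>"
      proof (rule norm_fourier_le)
        show "(\<lambda>x. 1 * S x + (- 1) * (\<Sum>\<xi>\<in>F. c \<xi> * character \<xi> x)) \<in> borel_measurable torus_measure"
          by (intro continuous_measurable_torus continuous_intros contS)
      qed (use F(3) in \<open>auto intro: less_imp_le\<close>)
      finally show ?thesis by simp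
    qed
    then have "cmod (fourier S \<eta> - c \<eta>) \<le> 0" by (rule field_le_epsilon)
    then show ?thesis by simp
  qed
qed

text \<open>Rapid decay makes the series converge uniformly to a continuous function with the same
  coefficients as \<open>\<phi>\<close>, and uniqueness identifies the two.\<close>

lemma fourier_sum_uniform_limit:
  fixes \<phi> :: "'n::finite scalar"
  assumes \<phi>: "\<phi> \<in> C_per"
  shows "uniform_limit UNIV (\<lambda>F. fourier_sum F (real_fourier \<phi>)) \<phi> (finite_subsets_at_top UNIV)"
proof -
  define c where "c = real_fourier \<phi>"
  define S where "S = (\<lambda>x. \<Sum>\<^sub>\<infinity>\<xi>. c \<xi> * character \<xi> x)"
  note series = abs_fourier_series[OF summable_real_fourier[OF \<phi>], folded c_def, folded S_def]
  note lim = series(1) and contS = series(2) and perS = series(3) and fS = series(4)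
  have "of_real (\<phi> x) - S x = 0" for x
  proof (rule fourier_zero_imp_zero[of "\<lambda>x. of_real (\<phi> x) - S x"])
    show "continuous_on UNIV (\<lambda>x. of_real (\<phi> x) - S x)"
      by (intro continuous_intros C_per_continuous \<phi> contS)
    show "lattice_periodic (\<lambda>x. of_real (\<phi> x) - S x)"
      using C_per_periodic[OF \<phi>] perS by (simp add: lattice_periodic_def)
    show "fourier (\<lambda>x. of_real (\<phi> x) - S x) \<xi> = 0" for \<xi>
      using fourier_linear[OF integrable_torus_of_real[OF C_per_integrable[OF \<phi>]] integrable_torus_continuous[OF contS], of 1 "- 1" \<xi>]
      by (simp add: fS c_def real_fourier_def)
  qed
  then have S: "S x = of_real (\<phi> x)" for x by (metis eq_iff_diff_eq_0)
  show ?thesis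
  proof (rule uniform_limitI)
    fix \<epsilon> :: real assume "\<epsilon> > 0"
    from uniform_limitD[OF lim this]
    show "\<forall>\<^sub>F F in finite_subsets_at_top UNIV. \<forall>x\<in>UNIV. dist (fourier_sum F (real_fourier \<phi>) x) (\<phi> x) < \<epsilon>"
    proof eventually_elim
      case (elim F)
      show ?case
      proof
        fix x
        have "\<bar>fourier_sum F (real_fourier \<phi>) x - \<phi> x\<bar> = \<bar>Re ((\<Sum>\<xi>\<in>F. c \<xi> * character \<xi> x) - S x)\<bar>"
          by (simp add: fourier_sum_def c_def S)
        also have "\<dots> \<le> cmod ((\<Sum>\<xi>\<in>F. c \<xi> * character \<xi> x) - S x)" by (rule abs_Re_le_cmod)
        also have "\<dots> < \<epsilon>" using elim by (simp add: dist_norm)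
        finally show "dist (fourier_sum F (real_fourier \<phi>) x) (\<phi> x) < \<epsilon>" by (simp add: dist_norm)
      qed
    qed
  qed
qed

section \<open>Convergence of Fourier sums together with all derivatives\<close>

lemma C_per_iterated_partial: "\<phi> \<in> C_per \<Longrightarrow> iterated_partial js \<phi> \<in> C_per"
  by (induction js) (auto simp: iterated_partial_Cons C_per_partial_derivative)

lemma iterated_partial_linear:
  assumes "\<phi> \<in> C_per" "\<psi> \<in> C_per"
  shows "iterated_partial js (\<lambda>x. a * \<phi> x + b * \<psi> x) = (\<lambda>x. a * iterated_partial js \<phi> x + b * iterated_partial js \<psi> x)"
proof (induction js)
  case (Cons j js)
  show ?case
    unfolding iterated_partial_Cons Cons
    by (intro ext partial_derivative_linear C_per_differentiable_at C_per_iterated_partial assms)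
qed simp

text \<open>Partial sums commute with differentiation, which upgrades uniform convergence to
  convergence in every \<open>C_norm\<close>.\<close>

lemma iterated_partial_fourier_sum:
  assumes "\<phi> \<in> C_per"
  shows "iterated_partial js (fourier_sum F (real_fourier \<phi>)) = fourier_sum F (real_fourier (iterated_partial js \<phi>))"
proof (induction js)
  case (Cons j js)
  have "real_fourier (partial_derivative j (iterated_partial js \<phi>)) = (\<lambda>\<xi>. 2 * of_real pi * \<i> * of_real (lattice_vec \<xi> $ j) * real_fourier (iterated_partial js \<phi>) \<xi>)"
    using real_fourier_partial_derivative[OF C_per_iterated_partial[OF assms]] by blast
  then show ?case
    unfolding iterated_partial_Cons Cons partial_derivative_fourier_sum by simp
qed simp

lemma finite_lists_le: "finite {js :: 'n::finite list. length js \<le> m}"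
  using finite_lists_length_le[of "UNIV :: 'n set" m] by simp

text \<open>A real supremum is informative only for a bounded set. Boundedness follows from
  periodicity for each derivative and from the finiteness of the set of derivatives of order at most
  \<open>m\<close>.\<close>

lemma C_norm_upper:
  fixes \<phi> :: "'n::finite scalar"
  assumes \<phi>: "\<phi> \<in> C_per" and "length js \<le> m"
  shows "\<bar>iterated_partial js \<phi> x\<bar> \<le> C_norm m \<phi>"
proof -
  have "\<forall>js. \<exists>B. \<forall>x. \<bar>iterated_partial js \<phi> x\<bar> \<le> B"
    using C_per_bounded[OF C_per_iterated_partial[OF \<phi>]] by metis
  then obtain B where B: "\<And>js x. \<bar>iterated_partial js \<phi> x\<bar> \<le> B js" by metis
  have "bdd_above ((\<lambda>(js, x). \<bar>iterated_partial js \<phi> x\<bar>) ` ({js. length js \<le> m} \<times> UNIV))"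
  proof (rule bdd_aboveI2)
    fix z :: "'n list \<times> (real^'n)" assume z: "z \<in> {js. length js \<le> m} \<times> UNIV"
    obtain js x where jx: "z = (js, x)" by (cases z)
    have "\<bar>iterated_partial js \<phi> x\<bar> \<le> B js" by (rule B)
    also have "\<dots> \<le> Max (B ` {js. length js \<le> m})"
      using z jx finite_lists_le by (intro Max_ge) auto
    finally show "(case z of (js, x) \<Rightarrow> \<bar>iterated_partial js \<phi> x\<bar>) \<le> Max (B ` {js. length js \<le> m})"
      by (simp add: jx)
  qed
  from cSUP_upper[OF _ this, of "(js, x)"] assms show ?thesis
    unfolding C_norm_def by simp
qed

lemma C_norm_least:
  assumes "\<And>js x. length js \<le> m \<Longrightarrow> \<bar>iterated_partial js \<phi> x\<bar> \<le> B"
  shows "C_norm m \<phi> \<le> B"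
  unfolding C_norm_def by (rule cSUP_least) (use assms in \<open>auto intro: exI[of _ "[]"]\<close>)

lemma C_norm_nonneg: "\<phi> \<in> C_per \<Longrightarrow> 0 \<le> C_norm m \<phi>"
  by (rule order_trans[OF abs_ge_zero C_norm_upper[of \<phi> "[]"]]) auto

lemma C_norm_mono: "\<phi> \<in> C_per \<Longrightarrow> m \<le> m' \<Longrightarrow> C_norm m \<phi> \<le> C_norm m' \<phi>"
  by (rule C_norm_least) (rule C_norm_upper, auto)

lemma C_norm_partial_derivative:
  fixes \<phi> :: "'n::finite scalar"
  assumes "\<phi> \<in> C_per"
  shows "C_norm m (partial_derivative j \<phi>) \<le> C_norm (Suc m) \<phi>"
proof (rule C_norm_least)
  fix js :: "'n list" and x assume "length js \<le> m"
  with assms show "\<bar>iterated_partial js (partial_derivative j \<phi>) x\<bar> \<le> C_norm (Suc m) \<phi>"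
    using C_norm_upper[of \<phi> "js @ [j]" "Suc m" x] by (simp add: iterated_partial_snoc)
qed

lemma fourier_sum_C_norm_approx:
  fixes \<phi> :: "'n::finite scalar"
  assumes \<phi>: "\<phi> \<in> C_per" and "\<epsilon> > 0"
  obtains F where "finite F" "C_norm m (\<lambda>x. 1 * \<phi> x + (- 1) * fourier_sum F (real_fourier \<phi>) x) \<le> \<epsilon>"
proof -
  have "eventually (\<lambda>F. finite F \<and> (\<forall>js\<in>{js. length js \<le> m}. \<forall>x\<in>UNIV. dist (fourier_sum F (real_fourier (iterated_partial js \<phi>)) x) (iterated_partial js \<phi> x) < \<epsilon>))
      (finite_subsets_at_top UNIV)"
    using finite_lists_le
    by (intro eventually_conj eventually_ball_finite ballI uniform_limitD[OF fourier_sum_uniform_limit] C_per_iterated_partial \<phi> \<open>\<epsilon> > 0\<close>)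
       (auto simp: eventually_finite_subsets_at_top_weakI)
  then obtain F where F: "finite F" "\<And>js x. length js \<le> m \<Longrightarrow> dist (fourier_sum F (real_fourier (iterated_partial js \<phi>)) x) (iterated_partial js \<phi> x) < \<epsilon>"
    using eventually_happens'[OF finite_subsets_at_top_neq_bot] by (smt (verit) UNIV_I mem_Collect_eq)
  show ?thesis
  proof (rule that[OF F(1)], rule C_norm_least)
    fix js :: "'n list" and x assume "length js \<le> m"
    from F(2)[OF this, of x]
    show "\<bar>iterated_partial js (\<lambda>x. 1 * \<phi> x + (- 1) * fourier_sum F (real_fourier \<phi>) x) x\<bar> \<le> \<epsilon>"
      unfolding iterated_partial_linear[OF \<phi> fourier_sum_C_per] iterated_partial_fourier_sum[OF \<phi>]
      by (simp add: dist_real_def)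
  qed
qed

subsection \<open>Periodic distributions and their Fourier coefficients\<close>

lemma cos_eq_fourier_sum: "(\<lambda>x. cos (2 * pi * (x \<bullet> lattice_vec \<xi>))) = fourier_sum {\<xi>} (\<lambda>_. 1)"
  and sin_eq_fourier_sum: "(\<lambda>x. sin (2 * pi * (x \<bullet> lattice_vec \<xi>))) = fourier_sum {\<xi>} (\<lambda>_. - \<i>)"
  by (simp_all add: fourier_sum_def fun_eq_iff Re_character Im_character)

lemma cos_C_per: "(\<lambda>x. cos (2 * pi * (x \<bullet> lattice_vec \<xi>))) \<in> C_per"
  and sin_C_per: "(\<lambda>x. sin (2 * pi * (x \<bullet> lattice_vec \<xi>))) \<in> C_per"
  unfolding cos_eq_fourier_sum sin_eq_fourier_sum by (rule fourier_sum_C_per)+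

lemma distribution_linear:
  assumes "g \<in> distributions" "\<phi> \<in> C_per" "\<psi> \<in> C_per"
  shows "g (\<lambda>x. a * \<phi> x + b * \<psi> x) = a * g \<phi> + b * g \<psi>"
  using assms C_per_cmult[of \<phi> a] C_per_cmult[of \<psi> b] unfolding distributions_def by simp

lemma distribution_cmult:
  assumes "g \<in> distributions" "\<phi> \<in> C_per"
  shows "g (\<lambda>x. a * \<phi> x) = a * g \<phi>"
  using distribution_linear[OF assms assms(2), of a 0] by simp

lemma distribution_zero:
  assumes "g \<in> distributions"
  shows "g (\<lambda>x. 0) = 0"
  using distribution_cmult[OF assms cos_C_per, of 0 0] by simp

lemma distribution_fourier_sum:
  assumes g: "g \<in> distributions" and "finite F"
  shows "g (fourier_sum F c) = (\<Sum>\<xi>\<in>F. Re (cnj (c \<xi>) * fourier_coeff g \<xi>))"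
  using \<open>finite F\<close>
proof (induction F rule: finite_induct)
  case empty
  then show ?case using distribution_zero[OF g] by (simp add: fourier_sum_def[abs_def])
next
  case (insert \<xi> F)
  let ?c = "\<lambda>x. Re (c \<xi>) * cos (2 * pi * (x \<bullet> lattice_vec \<xi>)) + (- Im (c \<xi>)) * sin (2 * pi * (x \<bullet> lattice_vec \<xi>))"
  have "fourier_sum (insert \<xi> F) c = (\<lambda>x. 1 * ?c x + 1 * fourier_sum F c x)"
    using insert by (simp add: fourier_sum_def fun_eq_iff Re_character Im_character)
  moreover have "g (\<lambda>x. 1 * ?c x + 1 * fourier_sum F c x) = 1 * g ?c + 1 * g (fourier_sum F c)"
    by (rule distribution_linear[OF g C_per_linear[OF cos_C_per sin_C_per] fourier_sum_C_per])
  moreover have "g ?c = Re (cnj (c \<xi>) * fourier_coeff g \<xi>)"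
    unfolding distribution_linear[OF g cos_C_per sin_C_per] by (simp add: fourier_coeff_def)
  ultimately show ?case using insert by simp
qed

lemma distribution_fourier_zero:
  assumes g: "g \<in> distributions" and zero: "\<And>\<xi>. fourier_coeff g \<xi> = 0" and \<phi>: "\<phi> \<in> C_per"
  shows "g \<phi> = 0"
proof -
  obtain C m where C: "\<And>\<phi>. \<phi> \<in> C_per \<Longrightarrow> \<bar>g \<phi>\<bar> \<le> C * C_norm m \<phi>"
    using g unfolding distributions_def by blast
  have "\<bar>g \<phi>\<bar> \<le> 0 + e" if "e > 0" for e
  proof -
    \<comment> \<open>The continuity constant \<open>C\<close> may be zero or negative, so the
      tolerance is divided by \<open>\<bar>C\<bar> + 1\<close>.\<close>
    have "e / (\<bar>C\<bar> + 1) > 0" using that by (intro divide_pos_pos) auto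
    from fourier_sum_C_norm_approx[OF \<phi> this, of m] obtain F where F: "finite F"
      "C_norm m (\<lambda>x. 1 * \<phi> x + (- 1) * fourier_sum F (real_fourier \<phi>) x) \<le> e / (\<bar>C\<bar> + 1)" by blast
    note lin = C_per_linear[OF \<phi> fourier_sum_C_per, of 1 "- 1" F "real_fourier \<phi>"]
    have "g \<phi> = g (\<lambda>x. 1 * \<phi> x + (- 1) * fourier_sum F (real_fourier \<phi>) x)"
      unfolding distribution_linear[OF g \<phi> fourier_sum_C_per] distribution_fourier_sum[OF g F(1)] by (simp add: zero)
    then have "\<bar>g \<phi>\<bar> \<le> C * C_norm m (\<lambda>x. 1 * \<phi> x + (- 1) * fourier_sum F (real_fourier \<phi>) x)"
      using C[OF lin] by simp
    also have "\<dots> \<le> (\<bar>C\<bar> + 1) * (e / (\<bar>C\<bar> + 1))"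
      by (intro mult_mono F C_norm_nonneg lin) auto
    also have "\<dots> = e" by simp
    finally show ?thesis by simp
  qed
  then have "\<bar>g \<phi>\<bar> \<le> 0" by (rule field_le_epsilon)
  then show ?thesis by simp
qed

section \<open>Operations on distributions and regular distributions\<close>

lemma distributionsI:
  assumes "\<And>\<phi> \<psi> a b. \<phi> \<in> C_per \<Longrightarrow> \<psi> \<in> C_per \<Longrightarrow> g (\<lambda>x. a * \<phi> x + b * \<psi> x) = a * g \<phi> + b * g \<psi>"
    and "\<And>\<phi>. \<phi> \<in> C_per \<Longrightarrow> \<bar>g \<phi>\<bar> \<le> C * C_norm m \<phi>"
  shows "g \<in> distributions"
proof -
  have "g (\<lambda>x. \<phi> x + \<psi> x) = g \<phi> + g \<psi>" if "\<phi> \<in> C_per" "\<psi> \<in> C_per" for \<phi> \<psi>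
    using assms(1)[OF that, of 1 1] by simp
  moreover have "g (\<lambda>x. c * \<phi> x) = c * g \<phi>" if "\<phi> \<in> C_per" for \<phi> c
    using assms(1)[OF that that, of c 0] by simp
  ultimately show ?thesis
    using assms(2) unfolding distributions_def by blast
qed

lemma distributions_linear:
  assumes "g \<in> distributions" "h \<in> distributions"
  shows "(\<lambda>\<phi>. a * g \<phi> + b * h \<phi>) \<in> distributions"
proof -
  obtain C m where C: "\<And>\<phi>. \<phi> \<in> C_per \<Longrightarrow> \<bar>g \<phi>\<bar> \<le> C * C_norm m \<phi>"
    using assms(1) unfolding distributions_def by blast
  obtain D l where D: "\<And>\<phi>. \<phi> \<in> C_per \<Longrightarrow> \<bar>h \<phi>\<bar> \<le> D * C_norm l \<phi>"
    using assms(2) unfolding distributions_def by blast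
  have "\<bar>a * g \<phi> + b * h \<phi>\<bar> \<le> (\<bar>a\<bar> * \<bar>C\<bar> + \<bar>b\<bar> * \<bar>D\<bar>) * C_norm (max m l) \<phi>" if \<phi>: "\<phi> \<in> C_per" for \<phi>
  proof -
    have "\<bar>g \<phi>\<bar> \<le> \<bar>C\<bar> * C_norm (max m l) \<phi>"
      using C[OF \<phi>] by (rule order_trans) (intro mult_mono C_norm_mono C_norm_nonneg \<phi>, auto)
    moreover have "\<bar>h \<phi>\<bar> \<le> \<bar>D\<bar> * C_norm (max m l) \<phi>"
      using D[OF \<phi>] by (rule order_trans) (intro mult_mono C_norm_mono C_norm_nonneg \<phi>, auto)
    ultimately have "\<bar>a\<bar> * \<bar>g \<phi>\<bar> + \<bar>b\<bar> * \<bar>h \<phi>\<bar> \<le> \<bar>a\<bar> * (\<bar>C\<bar> * C_norm (max m l) \<phi>) + \<bar>b\<bar> * (\<bar>D\<bar> * C_norm (max m l) \<phi>)"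
      by (intro add_mono mult_left_mono) auto
    then show ?thesis
      using abs_triangle_ineq[of "a * g \<phi>" "b * h \<phi>"] by (simp add: abs_mult algebra_simps)
  qed
  then show ?thesis
    by (rule distributionsI[rotated]) (simp_all add: distribution_linear assms algebra_simps)
qed

lemma dist_eq_fourier_coeff:
  assumes "g \<in> distributions" "h \<in> distributions" "\<And>\<xi>. fourier_coeff g \<xi> = fourier_coeff h \<xi>"
  shows "dist_eq g h"
  unfolding dist_eq_def
proof
  fix \<phi> :: "'a scalar" assume \<phi>: "\<phi> \<in> C_per"
  have "1 * g \<phi> + (- 1) * h \<phi> = 0"
    by (rule distribution_fourier_zero[OF distributions_linear[OF assms(1,2), of 1 "- 1"] _ \<phi>])
       (use assms(3) in \<open>simp add: fourier_coeff_def complex_eq_iff\<close>)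
  then show "g \<phi> = h \<phi>" by simp
qed

lemma zero_distributions: "(\<lambda>_. 0) \<in> distributions"
  by (rule distributionsI[of _ 0]) auto

lemma distributions_add:
  "g \<in> distributions \<Longrightarrow> h \<in> distributions \<Longrightarrow> (\<lambda>\<phi>. g \<phi> + h \<phi>) \<in> distributions"
  using distributions_linear[of g h 1 1] by simp

lemma distributions_cmult: "g \<in> distributions \<Longrightarrow> (\<lambda>\<phi>. a * g \<phi>) \<in> distributions"
  using distributions_linear[of g g a 0] by simp

lemma distributions_sum:
  "finite I \<Longrightarrow> (\<And>i. i \<in> I \<Longrightarrow> g i \<in> distributions) \<Longrightarrow> (\<lambda>\<phi>. \<Sum>i\<in>I. g i \<phi>) \<in> distributions"
  by (induction I rule: finite_induct) (auto intro: zero_distributions distributions_add)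

lemma distributions_deriv:
  assumes g: "g \<in> distributions"
  shows "dist_deriv j g \<in> distributions"
proof -
  obtain C m where C: "\<And>\<phi>. \<phi> \<in> C_per \<Longrightarrow> \<bar>g \<phi>\<bar> \<le> C * C_norm m \<phi>"
    using g unfolding distributions_def by blast
  have "\<bar>dist_deriv j g \<phi>\<bar> \<le> \<bar>C\<bar> * C_norm (Suc m) \<phi>" if \<phi>: "\<phi> \<in> C_per" for \<phi>
  proof -
    have "\<bar>g (partial_derivative j \<phi>)\<bar> \<le> C * C_norm m (partial_derivative j \<phi>)"
      by (rule C[OF C_per_partial_derivative[OF \<phi>]])
    also have "\<dots> \<le> \<bar>C\<bar> * C_norm (Suc m) \<phi>"
      by (intro mult_mono C_norm_partial_derivative C_norm_nonneg C_per_partial_derivative \<phi>) auto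
    finally show ?thesis by (simp add: dist_deriv_def)
  qed
  moreover have "dist_deriv j g (\<lambda>x. a * \<phi> x + b * \<psi> x) = a * dist_deriv j g \<phi> + b * dist_deriv j g \<psi>"
    if "\<phi> \<in> C_per" "\<psi> \<in> C_per" for \<phi> \<psi> a b
  proof -
    have "partial_derivative j (\<lambda>x. a * \<phi> x + b * \<psi> x) = (\<lambda>x. a * partial_derivative j \<phi> x + b * partial_derivative j \<psi> x)"
      using that by (intro ext partial_derivative_linear C_per_differentiable_at)
    then show ?thesis
      using that by (simp add: dist_deriv_def distribution_linear[OF g] C_per_partial_derivative)
  qed
  ultimately show ?thesis
    by (rule distributionsI[rotated])
qed

lemma fourier_coeff_linear:
  "fourier_coeff (\<lambda>\<phi>. a * g \<phi> + b * h \<phi>) \<xi> = of_real a * fourier_coeff g \<xi> + of_real b * fourier_coeff h \<xi>"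
  by (simp add: fourier_coeff_def complex_eq_iff)

lemma fourier_coeff_add: "fourier_coeff (\<lambda>\<phi>. g \<phi> + h \<phi>) \<xi> = fourier_coeff g \<xi> + fourier_coeff h \<xi>"
  and fourier_coeff_cmult: "fourier_coeff (\<lambda>\<phi>. a * g \<phi>) \<xi> = of_real a * fourier_coeff g \<xi>"
  and fourier_coeff_minus: "fourier_coeff (\<lambda>\<phi>. - g \<phi>) \<xi> = - fourier_coeff g \<xi>"
  and fourier_coeff_zero: "fourier_coeff (\<lambda>\<phi>. 0) \<xi> = 0"
  by (simp_all add: fourier_coeff_def complex_eq_iff)

lemma fourier_coeff_sum: "fourier_coeff (\<lambda>\<phi>. \<Sum>i\<in>I. g i \<phi>) \<xi> = (\<Sum>i\<in>I. fourier_coeff (g i) \<xi>)"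
  by (simp add: fourier_coeff_def complex_eq_iff sum_negf)

lemma fourier_coeff_deriv:
  assumes g: "g \<in> distributions"
  shows "fourier_coeff (dist_deriv j g) \<xi> = 2 * of_real pi * \<i> * of_real (lattice_vec \<xi> $ j) * fourier_coeff g \<xi>"
proof -
  let ?b = "2 * pi * lattice_vec \<xi> $ j"
  have "partial_derivative j (\<lambda>x. cos (2 * pi * (x \<bullet> lattice_vec \<xi>))) = (\<lambda>x. (- ?b) * sin (2 * pi * (x \<bullet> lattice_vec \<xi>)))"
    unfolding cos_eq_fourier_sum partial_derivative_fourier_sum by (simp add: fourier_sum_def fun_eq_iff Im_character Re_character)
  moreover have "partial_derivative j (\<lambda>x. sin (2 * pi * (x \<bullet> lattice_vec \<xi>))) = (\<lambda>x. ?b * cos (2 * pi * (x \<bullet> lattice_vec \<xi>)))"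
    unfolding sin_eq_fourier_sum partial_derivative_fourier_sum by (simp add: fourier_sum_def fun_eq_iff Im_character Re_character)
  ultimately show ?thesis
    unfolding fourier_coeff_def dist_deriv_def
    by (simp only: distribution_cmult[OF g sin_C_per] distribution_cmult[OF g cos_C_per]) (simp add: complex_eq_iff)
qed

lemma hermitian_fourier_coeff:
  assumes g: "g \<in> distributions"
  shows "hermitian (fourier_coeff g)"
  unfolding hermitian_def fourier_coeff_def
  using distribution_cmult[OF g sin_C_per, of "- 1"] by (simp add: complex_eq_iff)

lemma dist_of_eq: "dist_of a \<phi> = integral\<^sup>L torus_measure (\<lambda>x. a x * \<phi> x)"
  by (simp add: dist_of_def set_integral_torus)

lemma integrable_mult_C_per:
  assumes a: "integrable torus_measure a" and \<phi>: "\<phi> \<in> C_per"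
  shows "integrable torus_measure (\<lambda>x. a x * \<phi> x)"
proof -
  obtain B where B: "\<And>x. \<bar>\<phi> x\<bar> \<le> B" using C_per_bounded[OF \<phi>] by blast
  have "\<phi> \<in> borel_measurable torus_measure"
    by (intro continuous_measurable_torus C_per_continuous \<phi>)
  then show ?thesis
    using a B by (intro Bochner_Integration.integrable_bound[OF integrable_mult_left[of B, OF a]])
      (auto simp: abs_mult intro!: mult_left_mono order_trans[OF B abs_ge_self])
qed

lemma dist_of_distributions:
  assumes a: "integrable torus_measure a"
  shows "dist_of a \<in> distributions"
proof -
  have "\<bar>dist_of a \<phi>\<bar> \<le> integral\<^sup>L torus_measure (\<lambda>x. \<bar>a x\<bar>) * C_norm 0 \<phi>" if \<phi>: "\<phi> \<in> C_per" for \<phi>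
  proof -
    have "\<bar>dist_of a \<phi>\<bar> \<le> integral\<^sup>L torus_measure (\<lambda>x. \<bar>a x * \<phi> x\<bar>)"
      unfolding dist_of_eq by (rule integral_abs_bound)
    also have "\<dots> \<le> integral\<^sup>L torus_measure (\<lambda>x. \<bar>a x\<bar> * C_norm 0 \<phi>)"
      using a integrable_abs[OF integrable_mult_C_per[OF a \<phi>]] C_norm_upper[OF \<phi>, of "[]" 0]
      by (intro integral_mono) (auto simp: abs_mult intro!: mult_left_mono)
    also have "\<dots> = integral\<^sup>L torus_measure (\<lambda>x. \<bar>a x\<bar>) * C_norm 0 \<phi>" by simp
    finally show ?thesis .
  qed
  then show ?thesis
  proof (rule distributionsI[rotated])
    fix \<phi> \<psi> :: "'a scalar" and c d :: real assume C: "\<phi> \<in> C_per" "\<psi> \<in> C_per"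
    have "(\<lambda>x. a x * (c * \<phi> x + d * \<psi> x)) = (\<lambda>x. c * (a x * \<phi> x) + d * (a x * \<psi> x))"
      by (simp add: algebra_simps)
    then show "dist_of a (\<lambda>x. c * \<phi> x + d * \<psi> x) = c * dist_of a \<phi> + d * dist_of a \<psi>"
      using integrable_mult_C_per[OF a C(1)] integrable_mult_C_per[OF a C(2)] by (simp add: dist_of_eq)
  qed
qed

lemma fourier_coeff_dist_of:
  assumes a: "integrable torus_measure a"
  shows "fourier_coeff (dist_of a) \<xi> = real_fourier a \<xi>"
proof -
  have i: "integrable torus_measure (\<lambda>x. of_real (a x) * cnj (character \<xi> x))"
    by (rule integrable_mult_character[OF integrable_torus_of_real[OF a]])
  have "Re (real_fourier a \<xi>) = dist_of a (\<lambda>x. cos (2 * pi * (x \<bullet> lattice_vec \<xi>)))"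
    unfolding real_fourier_def fourier_def dist_of_eq integral_Re[OF i, symmetric] by (simp add: Re_character)
  moreover have "Im (real_fourier a \<xi>) = - dist_of a (\<lambda>x. sin (2 * pi * (x \<bullet> lattice_vec \<xi>)))"
    unfolding real_fourier_def fourier_def dist_of_eq integral_Im[OF i, symmetric] by (simp add: Im_character)
  ultimately show ?thesis by (simp add: fourier_coeff_def complex_eq_iff)
qed

subsection \<open>Square-integrable functions\<close>

lemma parseval_finite:
  assumes "finite F"
  shows "integral\<^sup>L torus_measure (\<lambda>x. (cmod (\<Sum>\<xi>\<in>F. c \<xi> * character \<xi> x))\<^sup>2) = (\<Sum>\<xi>\<in>F. (cmod (c \<xi>))\<^sup>2)"
proof -
  let ?S = "\<lambda>x. \<Sum>\<xi>\<in>F. c \<xi> * character \<xi> x"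
  have "of_real (integral\<^sup>L torus_measure (\<lambda>x. (cmod (?S x))\<^sup>2)) = integral\<^sup>L torus_measure (\<lambda>x. complex_of_real ((cmod (?S x))\<^sup>2))"
    by (rule integral_complex_of_real[symmetric])
  also have "\<dots> = integral\<^sup>L torus_measure (\<lambda>x. \<Sum>\<eta>\<in>F. cnj (c \<eta>) * (?S x * cnj (character \<eta> x)))"
    unfolding complex_norm_square by (simp add: sum_distrib_left mult_ac)
  also have "\<dots> = (\<Sum>\<eta>\<in>F. cnj (c \<eta>) * fourier ?S \<eta>)"
    unfolding fourier_def
    by (subst Bochner_Integration.integral_sum) (auto intro!: integrable_torus_continuous continuous_intros)
  also have "\<dots> = of_real (\<Sum>\<xi>\<in>F. (cmod (c \<xi>))\<^sup>2)"
    using assms unfolding of_real_sum complex_norm_square by (simp add: fourier_character_sum mult.commute)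
  finally show ?thesis using of_real_eq_iff by blast
qed

lemma fourier_sum_diff_square:
  assumes "finite F" "G \<subseteq> F"
  shows "integral\<^sup>L torus_measure (\<lambda>x. (fourier_sum F c x - fourier_sum G c x)\<^sup>2) \<le> (\<Sum>\<xi>\<in>F - G. (cmod (c \<xi>))\<^sup>2)"
proof -
  have "fourier_sum F c x - fourier_sum G c x = Re (\<Sum>\<xi>\<in>F - G. c \<xi> * character \<xi> x)" for x
    using assms by (simp add: fourier_sum_def sum_diff finite_subset)
  then have "(fourier_sum F c x - fourier_sum G c x)\<^sup>2 \<le> (cmod (\<Sum>\<xi>\<in>F - G. c \<xi> * character \<xi> x))\<^sup>2" for x
    by (simp add: abs_le_square_iff[symmetric] abs_Re_le_cmod del: sum.cong Re_sum)
  then have "integral\<^sup>L torus_measure (\<lambda>x. (fourier_sum F c x - fourier_sum G c x)\<^sup>2)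
      \<le> integral\<^sup>L torus_measure (\<lambda>x. (cmod (\<Sum>\<xi>\<in>F - G. c \<xi> * character \<xi> x))\<^sup>2)"
    by (intro integral_mono integrable_torus_continuous continuous_intros C_per_continuous fourier_sum_C_per)
  then show ?thesis using assms parseval_finite[of "F - G" c] by simp
qed

text \<open>The geometric rate buys almost everywhere convergence of the partial sums along
  \<open>r\<close>: it leaves room for a factor \<open>2 ^ k\<close> in front of the squared
  differences.\<close>

lemma fast_frequency_boxes:
  fixes c :: "int^'n::finite \<Rightarrow> complex"
  assumes "sobolev 0 c"
  obtains r :: "nat \<Rightarrow> nat" where "mono r" "\<And>k. k \<le> r k"
    "\<And>k F. finite F \<Longrightarrow> F \<inter> box_freqs (r k) = {} \<Longrightarrow> (\<Sum>\<xi>\<in>F. (cmod (c \<xi>))\<^sup>2) \<le> (1/4) ^ k"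
proof -
  let ?g = "\<lambda>\<xi>. (cmod (c \<xi>))\<^sup>2"
  have summ: "?g summable_on UNIV" using assms by (simp add: sobolev_def)
  have "\<exists>N. \<forall>F. finite F \<and> F \<inter> box_freqs N = {} \<longrightarrow> sum ?g F \<le> (1/4) ^ k" for k
  proof -
    obtain F0 where F0: "finite F0" "dist (sum ?g F0) (infsum ?g UNIV) \<le> (1/4) ^ k"
      using infsum_finite_approximation[OF summ, of "(1/4) ^ k"] by auto
    have "eventually (\<lambda>N. \<forall>\<xi>\<in>F0. \<xi> \<in> box_freqs N) sequentially"
      using F0(1) by (intro eventually_ball_finite ballI eventually_in_box_freqs) auto
    then obtain N where N: "F0 \<subseteq> box_freqs N" by (auto simp: eventually_sequentially)
    have "sum ?g F \<le> (1/4) ^ k" if F: "finite F" "F \<inter> box_freqs N = {}" for F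
    proof -
      have "sum ?g F0 + sum ?g F = sum ?g (F0 \<union> F)"
        using F F0 N by (intro sum.union_disjoint[symmetric]) auto
      also have "\<dots> \<le> infsum ?g UNIV"
        using F F0 by (intro finite_sum_le_infsum summ) auto
      finally show ?thesis using F0(2) by (simp add: dist_real_def)
    qed
    then show ?thesis by blast
  qed
  then obtain N where N: "\<And>k F. finite F \<Longrightarrow> F \<inter> box_freqs (N k) = {} \<Longrightarrow> sum ?g F \<le> (1/4) ^ k" by metis
  \<comment> \<open>Accumulating the \<open>N i\<close> makes \<open>r\<close> monotone and larger
    than each \<open>N k\<close>; the added 1 gives \<open>k \<le> r k\<close>.\<close>
  define r where "r = (\<lambda>k. \<Sum>i\<le>k. N i + 1)"
  show ?thesis
  proof (rule that[of r])
    show "mono r" unfolding r_def by (intro monoI sum_mono2) auto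
    show "k \<le> r k" for k
    proof -
      have "(\<Sum>i\<le>k. 1) \<le> r k" unfolding r_def by (intro sum_mono) simp
      then show ?thesis by simp
    qed
    fix k and F :: "(int^'n) set" assume F: "finite F" "F \<inter> box_freqs (r k) = {}"
    have "N k + 1 \<le> r k" unfolding r_def by (rule member_le_sum) auto
    then have "box_freqs (N k) \<subseteq> (box_freqs (r k) :: (int^'n) set)"
      by (intro box_freqs_mono) simp
    then show "sum ?g F \<le> (1/4) ^ k" using F by (intro N) auto
  qed
qed

text \<open>The squared differences of consecutive partial sums, weighted by \<open>2 ^ k\<close>,
  have a convergent sum of integrals, hence a finite sum at almost every point. Together with a
  geometric series this dominates the differences themselves, so the partial sums converge almost
  everywhere, and Fatou's lemma transfers the rate to the limit.\<close>

lemma riesz_fischer: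
  fixes c :: "int^'n::finite \<Rightarrow> complex"
  assumes "sobolev 0 c"
  obtains a r where "lattice_periodic a" "a \<in> borel_measurable torus_measure" "\<And>k::nat. k \<le> r k"
    "\<And>k. integrable torus_measure (\<lambda>x. (a x - fourier_sum (box_freqs (r k)) c x)\<^sup>2)"
    "\<And>k. integral\<^sup>L torus_measure (\<lambda>x. (a x - fourier_sum (box_freqs (r k)) c x)\<^sup>2) \<le> (1/4) ^ k"
proof -
  obtain r where r: "mono r" "\<And>k. k \<le> r k"
    "\<And>k F. finite F \<Longrightarrow> F \<inter> box_freqs (r k) = {} \<Longrightarrow> (\<Sum>\<xi>\<in>F. (cmod (c \<xi>))\<^sup>2) \<le> (1/4) ^ k"
    using fast_frequency_boxes[OF assms] by blast
  define S where "S = (\<lambda>k. fourier_sum (box_freqs (r k)) c)"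
  have contS: "continuous_on UNIV (S k)" for k
    unfolding S_def by (intro C_per_continuous fourier_sum_C_per)
  have measS [measurable]: "S k \<in> borel_measurable torus_measure" for k
    by (rule continuous_measurable_torus[OF contS])
  have diff: "integral\<^sup>L torus_measure (\<lambda>x. (S l x - S k x)\<^sup>2) \<le> (1/4) ^ k" if "k \<le> l" for k l
  proof -
    have "box_freqs (r k) \<subseteq> (box_freqs (r l) :: (int^'n) set)"
      using r(1) that by (intro box_freqs_mono) (simp add: monoD)
    from fourier_sum_diff_square[OF finite_box_freqs this, of c] show ?thesis
      unfolding S_def by (rule order_trans) (intro r(3) finite_Diff finite_box_freqs, auto)
  qed
  have nn_diff: "(\<integral>\<^sup>+x. ennreal ((S l x - S k x)\<^sup>2) \<partial>torus_measure) \<le> ennreal ((1/4) ^ k)" if "k \<le> l" for k l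
    using diff[OF that]
    by (subst nn_integral_eq_integral) (auto intro!: integrable_torus_continuous continuous_intros contS ennreal_leI)
  define d where "d = (\<lambda>k x. 2 ^ k * (S (Suc k) x - S k x)\<^sup>2)"
  have "(\<integral>\<^sup>+x. (suminf (\<lambda>k. ennreal (d k x))) \<partial>torus_measure) = suminf (\<lambda>k. \<integral>\<^sup>+x. ennreal (d k x) \<partial>torus_measure)"
    by (rule nn_integral_suminf) (simp add: d_def)
  also have "\<dots> \<le> suminf (\<lambda>k. ennreal ((1/2) ^ k))"
  proof (intro suminf_le allI)
    fix k
    have "(\<integral>\<^sup>+x. ennreal (d k x) \<partial>torus_measure) = ennreal (2 ^ k) * (\<integral>\<^sup>+x. ennreal ((S (Suc k) x - S k x)\<^sup>2) \<partial>torus_measure)"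
      unfolding d_def by (simp add: ennreal_mult nn_integral_cmult)
    also have "\<dots> \<le> ennreal (2 ^ k) * ennreal ((1/4) ^ k)"
      by (intro mult_left_mono nn_diff) auto
    also have "\<dots> = ennreal ((1/2) ^ k)"
      by (simp flip: ennreal_mult power_mult_distrib)
    finally show "(\<integral>\<^sup>+x. ennreal (d k x) \<partial>torus_measure) \<le> ennreal ((1/2) ^ k)" .
  qed auto
  also have "\<dots> = ennreal 2"
    using suminf_geometric[of "1/2::real"] by (subst suminf_ennreal_eq[OF _ summable_sums]) (auto intro: summable_geometric)
  finally have "(\<integral>\<^sup>+x. (suminf (\<lambda>k. ennreal (d k x))) \<partial>torus_measure) \<noteq> \<infinity>"
    using ennreal_less_top le_less_trans by (metis infinity_ennreal_def less_irrefl)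
  then have "AE x in torus_measure. (suminf (\<lambda>k. ennreal (d k x))) \<noteq> \<infinity>"
    by (intro nn_integral_PInf_AE) (simp_all add: d_def)
  then have conv: "AE x in torus_measure. convergent (\<lambda>k. S k x)"
  proof eventually_elim
    case (elim x)
    have "summable (\<lambda>k. d k x)"
      by (rule summable_suminf_not_top) (use elim in \<open>auto simp: d_def\<close>)
    then have "summable (\<lambda>k. (1/2) ^ k + d k x)"
      by (intro summable_add summable_geometric) auto
    then have "summable (\<lambda>k. S (Suc k) x - S k x)"
    proof (rule summable_comparison_test'[of _ 0])
      fix k :: nat
      let ?e = "\<bar>S (Suc k) x - S k x\<bar>"
      \<comment> \<open>AM--GM: \<open>2 e \<le> 2\<^sup>k e\<^sup>2 + 2\<^sup>-\<^sup>k\<close>\<close>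
      have p: "0 \<le> 2 ^ k * ?e" by simp
      have "2 * ((2 ^ k) * ?e * 1) \<le> (2 ^ k * ?e)\<^sup>2 + 1\<^sup>2"
        using sum_squares_bound[of "2 ^ k * ?e" 1] by simp
      also have "(2 ^ k * ?e)\<^sup>2 = 2 ^ k * d k x"
        by (simp add: d_def power2_eq_square)
      finally have "2 ^ k * ?e \<le> 2 ^ k * d k x + 1"
        using p unfolding one_power2 mult_1_right by linarith
      also have "\<dots> = 2 ^ k * ((1/2) ^ k + d k x)"
        by (simp add: distrib_left power_divide)
      finally show "norm (S (Suc k) x - S k x) \<le> (1/2) ^ k + d k x" by simp
    qed
    then have "(\<lambda>m. \<Sum>k<m. S (Suc k) x - S k x) \<longlonglongrightarrow> suminf (\<lambda>k. S (Suc k) x - S k x)"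
      by (rule summable_LIMSEQ)
    from tendsto_add[OF this tendsto_const[of "S 0 x"]]
    have "(\<lambda>m. S m x) \<longlonglongrightarrow> suminf (\<lambda>k. S (Suc k) x - S k x) + S 0 x"
      by (simp add: sum_lessThan_telescope[of "\<lambda>k. S k x"])
    then show ?case by (auto simp: convergent_def)
  qed
  \<comment> \<open>\<open>lim\<close> depends only on the sequence of values, and these are
    periodic in \<open>x\<close>; so \<open>a\<close> is periodic at every point, also where the
    sequence diverges.\<close>
  define a where "a = (\<lambda>x. lim (\<lambda>k. S k x))"
  have measa [measurable]: "a \<in> borel_measurable torus_measure"
    unfolding a_def by measurable
  \<comment> \<open>Fatou in the index \<open>l\<close>, with \<open>k\<close> fixed.\<close>
  have nn: "(\<integral>\<^sup>+x. ennreal ((a x - S k x)\<^sup>2) \<partial>torus_measure) \<le> ennreal ((1/4) ^ k)" for k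
  proof -
    have "(\<integral>\<^sup>+x. ennreal ((a x - S k x)\<^sup>2) \<partial>torus_measure) = (\<integral>\<^sup>+x. liminf (\<lambda>l. ennreal ((S l x - S k x)\<^sup>2)) \<partial>torus_measure)"
    proof (rule nn_integral_cong_AE)
      show "AE x in torus_measure. ennreal ((a x - S k x)\<^sup>2) = liminf (\<lambda>l. ennreal ((S l x - S k x)\<^sup>2))"
        using conv
      proof eventually_elim
        case (elim x)
        then have "(\<lambda>l. S l x) \<longlonglongrightarrow> a x" unfolding a_def convergent_LIMSEQ_iff .
        then have "(\<lambda>l. ennreal ((S l x - S k x)\<^sup>2)) \<longlonglongrightarrow> ennreal ((a x - S k x)\<^sup>2)"
          by (intro tendsto_intros)
        then show ?case by (rule lim_imp_Liminf[OF sequentially_bot, symmetric])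
      qed
    qed
    also have "\<dots> \<le> liminf (\<lambda>l. \<integral>\<^sup>+x. ennreal ((S l x - S k x)\<^sup>2) \<partial>torus_measure)"
      by (rule nn_integral_liminf) simp
    also have "\<dots> \<le> ennreal ((1/4) ^ k)"
      by (rule Liminf_le) (auto intro!: eventually_sequentiallyI[of k] nn_diff)
    finally show ?thesis .
  qed
  show ?thesis
  proof (rule that[of a r])
    show "lattice_periodic a"
      by (simp add: a_def S_def lattice_periodic_def C_per_periodic[OF fourier_sum_C_per, unfolded lattice_periodic_def, rule_format])
    show "k \<le> r k" for k by (rule r(2))
    have Sk: "fourier_sum (box_freqs (r k)) c = S k" for k by (simp add: S_def)
    show "integrable torus_measure (\<lambda>x. (a x - fourier_sum (box_freqs (r k)) c x)\<^sup>2)" for k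
      unfolding Sk
    proof (rule integrableI_bounded)
      show "(\<integral>\<^sup>+x. ennreal (norm ((a x - S k x)\<^sup>2)) \<partial>torus_measure) < \<infinity>"
        using le_less_trans[OF nn[of k] ennreal_less_top] by simp
    qed measurable
    show "integral\<^sup>L torus_measure (\<lambda>x. (a x - fourier_sum (box_freqs (r k)) c x)\<^sup>2) \<le> (1/4) ^ k" for k
      unfolding Sk using nn[of k] by (intro integral_real_bounded) auto
  qed (rule measa)
qed

lemma integrable_mult_square:
  fixes a b :: "'a \<Rightarrow> real"
  assumes [measurable]: "a \<in> borel_measurable M" "b \<in> borel_measurable M"
    and "integrable M (\<lambda>x. (a x)\<^sup>2)" "integrable M (\<lambda>x. (b x)\<^sup>2)"
  shows "integrable M (\<lambda>x. a x * b x)"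
proof (rule Bochner_Integration.integrable_bound)
  show "integrable M (\<lambda>x. (a x)\<^sup>2 + (b x)\<^sup>2)" using assms by simp
  have "\<bar>a x * b x\<bar> \<le> (a x)\<^sup>2 + (b x)\<^sup>2" for x
  proof -
    have "2 * \<bar>a x * b x\<bar> \<le> (a x)\<^sup>2 + (b x)\<^sup>2"
      using sum_squares_bound[of "\<bar>a x\<bar>" "\<bar>b x\<bar>"] by (simp add: abs_mult)
    then show ?thesis using abs_ge_zero[of "a x * b x"] by linarith
  qed
  then show "AE x in M. norm (a x * b x) \<le> norm ((a x)\<^sup>2 + (b x)\<^sup>2)" by simp
qed measurable

text \<open>Under the reality condition and over a symmetric set of frequencies, the real part in
  \<open>fourier_sum\<close> discards nothing.\<close>

lemma fourier_sum_hermitian: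
  assumes c: "hermitian c" and F: "\<And>\<xi>. \<xi> \<in> F \<Longrightarrow> - \<xi> \<in> F"
  shows "complex_of_real (fourier_sum F c x) = (\<Sum>\<xi>\<in>F. c \<xi> * character \<xi> x)"
proof -
  have "cnj (\<Sum>\<xi>\<in>F. c \<xi> * character \<xi> x) = (\<Sum>\<xi>\<in>F. c (- \<xi>) * character (- \<xi>) x)"
    using c by (simp add: cnj_character hermitian_def)
  also have "\<dots> = (\<Sum>\<xi>\<in>F. c \<xi> * character \<xi> x)"
    by (rule sum.reindex_bij_witness[of _ uminus uminus]) (use F in auto)
  finally show ?thesis
    unfolding fourier_sum_def by (simp only: Reals_cnj_iff[symmetric] of_real_Re)
qed

lemma filterlim_box_freqs:
  assumes "\<And>k::nat. k \<le> r k"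
  shows "filterlim (\<lambda>k. box_freqs (r k) :: (int^'n::finite) set) (finite_subsets_at_top UNIV) sequentially"
  unfolding filterlim_finite_subsets_at_top
proof (intro allI impI)
  fix X :: "(int^'n) set" assume "finite X \<and> X \<subseteq> UNIV"
  then have "\<forall>\<^sub>F N in sequentially. \<forall>\<xi>\<in>X. \<xi> \<in> box_freqs N"
    by (intro eventually_ball_finite ballI eventually_in_box_freqs) auto
  then obtain N where "X \<subseteq> box_freqs N" by (auto simp: eventually_sequentially)
  then have "X \<subseteq> box_freqs (r k)" if "N \<le> k" for k
    using box_freqs_mono[of N "r k"] assms[of k] that by (meson order_trans subset_trans)
  then show "\<forall>\<^sub>F k in sequentially. finite (box_freqs (r k)) \<and> X \<subseteq> box_freqs (r k) \<and> box_freqs (r k) \<subseteq> UNIV"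
    by (auto simp: finite_box_freqs intro!: eventually_sequentiallyI[of N])
qed

text \<open>The convolution theorem for square-integrable functions. For a partial sum of
  \<open>a\<close> it is a finite computation; the error is small in mean square. The summability
  hypothesis lets the sum over boxes be read as an unordered sum.\<close>

lemma riesz_fischer_product:
  fixes c :: "int^'n::finite \<Rightarrow> complex"
  assumes c: "sobolev 0 c" "hermitian c"
  obtains a where "lattice_periodic a" "a \<in> borel_measurable torus_measure" "integrable torus_measure (\<lambda>x. (a x)\<^sup>2)"
    "\<And>b \<xi>. b \<in> borel_measurable torus_measure \<Longrightarrow> integrable torus_measure (\<lambda>x. (b x)\<^sup>2) \<Longrightarrow>
       (\<lambda>\<eta>. c \<eta> * real_fourier b (\<xi> - \<eta>)) summable_on UNIV \<Longrightarrow>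
       real_fourier (\<lambda>x. a x * b x) \<xi> = (\<Sum>\<^sub>\<infinity>\<eta>. c \<eta> * real_fourier b (\<xi> - \<eta>))"
proof -
  obtain a r where a: "lattice_periodic a" and [measurable]: "a \<in> borel_measurable torus_measure" and r: "\<And>k::nat. k \<le> r k"
    and int: "\<And>k. integrable torus_measure (\<lambda>x. (a x - fourier_sum (box_freqs (r k)) c x)\<^sup>2)"
    and le: "\<And>k. integral\<^sup>L torus_measure (\<lambda>x. (a x - fourier_sum (box_freqs (r k)) c x)\<^sup>2) \<le> (1/4) ^ k"
    using riesz_fischer[OF c(1)] by blast
  define S where "S = (\<lambda>k. fourier_sum (box_freqs (r k)) c)"
  have contS: "continuous_on UNIV (S k)" for k
    unfolding S_def by (intro C_per_continuous fourier_sum_C_per)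
  have [measurable]: "S k \<in> borel_measurable torus_measure" for k
    by (rule continuous_measurable_torus[OF contS])
  have sqS: "integrable torus_measure (\<lambda>x. (S k x)\<^sup>2)" for k
    by (intro integrable_torus_continuous continuous_intros contS)
  have int': "integrable torus_measure (\<lambda>x. (a x - S k x)\<^sup>2)" and le': "integral\<^sup>L torus_measure (\<lambda>x. (a x - S k x)\<^sup>2) \<le> (1/4) ^ k" for k
    using int[of k] le[of k] by (simp_all add: S_def)
  have sqa: "integrable torus_measure (\<lambda>x. (a x)\<^sup>2)"
  proof (rule Bochner_Integration.integrable_bound)
    show "integrable torus_measure (\<lambda>x. 2 * (a x - S 0 x)\<^sup>2 + 2 * (S 0 x)\<^sup>2)"
      using int' sqS by simp
    have "(a x)\<^sup>2 \<le> 2 * (a x - S 0 x)\<^sup>2 + 2 * (S 0 x)\<^sup>2" for x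
      using zero_le_power2[of "a x - 2 * S 0 x"] by (simp add: power2_eq_square algebra_simps)
    then show "AE x in torus_measure. norm ((a x)\<^sup>2) \<le> norm (2 * (a x - S 0 x)\<^sup>2 + 2 * (S 0 x)\<^sup>2)"
      by simp
  qed measurable
  show ?thesis
  proof (rule that[OF a _ sqa])
    fix b \<xi>
    assume [measurable]: "b \<in> borel_measurable torus_measure" and sqb: "integrable torus_measure (\<lambda>x. (b x)\<^sup>2)"
      and summ: "(\<lambda>\<eta>. c \<eta> * real_fourier b (\<xi> - \<eta>)) summable_on UNIV"
    have intb: "integrable torus_measure b"
      using integrable_mult_square[of b torus_measure "\<lambda>_. 1"] sqb by simp
    have intab: "integrable torus_measure (\<lambda>x. a x * b x)" and intSb: "integrable torus_measure (\<lambda>x. S k x * b x)" for k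
      by (intro integrable_mult_square sqa sqb sqS; measurable)+
    have coefS: "real_fourier (\<lambda>x. S k x * b x) \<xi> = (\<Sum>\<eta>\<in>box_freqs (r k). c \<eta> * real_fourier b (\<xi> - \<eta>))" for k
    proof -
      have "real_fourier (\<lambda>x. S k x * b x) \<xi> = integral\<^sup>L torus_measure (\<lambda>x. \<Sum>\<eta>\<in>box_freqs (r k). c \<eta> * (of_real (b x) * cnj (character (\<xi> - \<eta>) x)))"
        unfolding real_fourier_def fourier_def
      proof (intro Bochner_Integration.integral_cong refl)
        fix x
        have e: "cnj (character (\<xi> - \<eta>) x) = character \<eta> x * cnj (character \<xi> x)" for \<eta>
          by (simp add: cnj_character character_mult)
        have fs: "complex_of_real (S k x) = (\<Sum>\<eta>\<in>box_freqs (r k). c \<eta> * character \<eta> x)"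
          unfolding S_def by (rule fourier_sum_hermitian[OF c(2)]) (rule uminus_box_freqs)
        show "of_real (S k x * b x) * cnj (character \<xi> x) = (\<Sum>\<eta>\<in>box_freqs (r k). c \<eta> * (of_real (b x) * cnj (character (\<xi> - \<eta>) x)))"
          unfolding of_real_mult fs sum_distrib_right e by (simp add: mult_ac)
      qed
      also have "\<dots> = (\<Sum>\<eta>\<in>box_freqs (r k). c \<eta> * real_fourier b (\<xi> - \<eta>))"
        unfolding real_fourier_def fourier_def using integrable_mult_character[OF integrable_torus_of_real[OF intb]]
        by (subst Bochner_Integration.integral_sum) auto
      finally show ?thesis .
    qed
    have conv: "(\<lambda>k. real_fourier (\<lambda>x. S k x * b x) \<xi>) \<longlonglongrightarrow> real_fourier (\<lambda>x. a x * b x) \<xi>"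
    proof (rule Lim_null[THEN iffD2], rule Lim_null_comparison)
      define I where "I = integral\<^sup>L torus_measure (\<lambda>x. (b x)\<^sup>2)"
      show "\<forall>\<^sub>F k in sequentially. norm (real_fourier (\<lambda>x. S k x * b x) \<xi> - real_fourier (\<lambda>x. a x * b x) \<xi>) \<le> (1 + I) * (1/2) ^ k"
      proof (intro always_eventually allI)
        fix k
        have "real_fourier (\<lambda>x. S k x * b x) \<xi> - real_fourier (\<lambda>x. a x * b x) \<xi> = real_fourier (\<lambda>x. 1 * (S k x * b x) + (- 1) * (a x * b x)) \<xi>"
          using real_fourier_linear[OF intSb[of k] intab, of 1 "- 1" \<xi>] by simp
        also have "norm \<dots> \<le> integral\<^sup>L torus_measure (\<lambda>x. norm (of_real (1 * (S k x * b x) + (- 1) * (a x * b x)) * cnj (character \<xi> x)))"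
          unfolding real_fourier_def fourier_def by (rule integral_norm_bound)
        also have "\<dots> = integral\<^sup>L torus_measure (\<lambda>x. \<bar>(a x - S k x) * b x\<bar>)"
        proof (intro Bochner_Integration.integral_cong refl)
          fix x
          have "1 * (S k x * b x) + (- 1) * (a x * b x) = - ((a x - S k x) * b x)"
            by (simp add: algebra_simps)
          then show "norm (of_real (1 * (S k x * b x) + (- 1) * (a x * b x)) * cnj (character \<xi> x)) = \<bar>(a x - S k x) * b x\<bar>"
            by (simp only: norm_mult norm_of_real abs_minus_cancel complex_mod_cnj norm_character mult_1_right)
        qed
        \<comment> \<open>AM-GM with weight \<open>2 ^ k\<close>: the mean-square error
          \<open>(1/4) ^ k\<close> then still leaves \<open>(1/2) ^ k\<close>, and the fixed term
          with \<open>b\<close> is damped at the same rate.\<close>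
        also have "\<dots> \<le> integral\<^sup>L torus_measure (\<lambda>x. 2 ^ k * (a x - S k x)\<^sup>2 + (1/2) ^ k * (b x)\<^sup>2)"
        proof (rule integral_mono)
          show "integrable torus_measure (\<lambda>x. \<bar>(a x - S k x) * b x\<bar>)"
            by (intro integrable_abs integrable_mult_square int' sqb; measurable)
          show "integrable torus_measure (\<lambda>x. 2 ^ k * (a x - S k x)\<^sup>2 + (1/2) ^ k * (b x)\<^sup>2)"
            using int' sqb by simp
          fix x
          let ?e = "\<bar>a x - S k x\<bar>" and ?b = "\<bar>b x\<bar>"
          have "2 * (2 ^ k * (?e * ?b)) \<le> (2 ^ k * ?e)\<^sup>2 + ?b\<^sup>2"
            using sum_squares_bound[of "2 ^ k * ?e" ?b] by (simp add: mult_ac)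
          moreover have "0 \<le> 2 ^ k * (?e * ?b)" by simp
          ultimately have "2 ^ k * (?e * ?b) \<le> (2 ^ k * ?e)\<^sup>2 + ?b\<^sup>2" by linarith
          also have "\<dots> = 2 ^ k * (2 ^ k * (a x - S k x)\<^sup>2 + (1/2) ^ k * (b x)\<^sup>2)"
            by (simp add: power_mult_distrib distrib_left power_divide power2_eq_square)
          finally show "\<bar>(a x - S k x) * b x\<bar> \<le> 2 ^ k * (a x - S k x)\<^sup>2 + (1/2) ^ k * (b x)\<^sup>2"
            by (simp add: abs_mult)
        qed
        also have "\<dots> = 2 ^ k * integral\<^sup>L torus_measure (\<lambda>x. (a x - S k x)\<^sup>2) + (1/2) ^ k * I"
          using int' sqb by (simp add: I_def)
        also have "\<dots> \<le> 2 ^ k * (1/4) ^ k + (1/2) ^ k * I"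
          by (intro add_right_mono mult_left_mono le') simp
        also have "\<dots> = (1 + I) * (1/2) ^ k"
          by (simp add: algebra_simps flip: power_mult_distrib)
        finally show "norm (real_fourier (\<lambda>x. S k x * b x) \<xi> - real_fourier (\<lambda>x. a x * b x) \<xi>) \<le> (1 + I) * (1/2) ^ k" .
      qed
      show "(\<lambda>k. (1 + I) * (1/2) ^ k) \<longlonglongrightarrow> 0"
        by (intro tendsto_mult_right_zero LIMSEQ_realpow_zero) auto
    qed
    have "(\<lambda>k. \<Sum>\<eta>\<in>box_freqs (r k). c \<eta> * real_fourier b (\<xi> - \<eta>)) \<longlonglongrightarrow> (\<Sum>\<^sub>\<infinity>\<eta>. c \<eta> * real_fourier b (\<xi> - \<eta>))"
      using filterlim_compose[OF infsum_tendsto[OF summ] filterlim_box_freqs[OF r]] .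
    with conv show "real_fourier (\<lambda>x. a x * b x) \<xi> = (\<Sum>\<^sub>\<infinity>\<eta>. c \<eta> * real_fourier b (\<xi> - \<eta>))"
      unfolding coefS using LIMSEQ_unique by blast
  qed measurable
qed

section \<open>Fourier series with rapidly decaying coefficients\<close>

text \<open>AM-GM against the family \<open>weight \<xi> powr - n\<close>, which is summable because
  \<open>n > n / 2\<close>.\<close>

lemma sobolev_summable:
  fixes c :: "int^'n::finite \<Rightarrow> complex"
  assumes "sobolev (real CARD('n)) c"
  shows "(\<lambda>\<xi>. cmod (c \<xi>)) summable_on UNIV"
proof (rule summable_on_comparison_test)
  show "(\<lambda>\<xi>. weight \<xi> powr real CARD('n) * (cmod (c \<xi>))\<^sup>2 + weight \<xi> powr - real CARD('n)) summable_on UNIV"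
    using assms unfolding sobolev_def by (intro summable_on_add summable_on_weight) auto
  fix \<xi> :: "int^'n"
  let ?w = "weight \<xi> powr real CARD('n)"
  have w: "?w > 0" by simp
  have "2 * (?w * cmod (c \<xi>)) \<le> (?w * cmod (c \<xi>))\<^sup>2 + 1"
    using sum_squares_bound[of "?w * cmod (c \<xi>)" 1] by simp
  moreover have "0 \<le> ?w * cmod (c \<xi>)" by simp
  ultimately have "?w * cmod (c \<xi>) \<le> (?w * cmod (c \<xi>))\<^sup>2 + 1" by linarith
  also have "\<dots> = ?w * (?w * (cmod (c \<xi>))\<^sup>2 + weight \<xi> powr - real CARD('n))"
    using w by (simp add: powr_minus power2_eq_square distrib_left)
  finally show "cmod (c \<xi>) \<le> ?w * (cmod (c \<xi>))\<^sup>2 + weight \<xi> powr - real CARD('n)"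
    using w by simp
qed simp

definition fourier_series :: "(int^'n::finite \<Rightarrow> complex) \<Rightarrow> real^'n \<Rightarrow> real" where
  "fourier_series c x = Re (\<Sum>\<^sub>\<infinity>\<xi>. c \<xi> * character \<xi> x)"

definition diff_coeff :: "'n::finite \<Rightarrow> (int^'n \<Rightarrow> complex) \<Rightarrow> int^'n \<Rightarrow> complex" where
  "diff_coeff j c \<xi> = 2 * of_real pi * \<i> * of_real (lattice_vec \<xi> $ j) * c \<xi>"

lemma sobolev_diff_coeff:
  assumes "sobolev s c"
  shows "sobolev (s - 1) (diff_coeff j c)"
proof (rule sobolev_bound)
  show "sobolev (s - 1) (\<lambda>\<xi>. weight \<xi> powr (1/2) * norm (c \<xi>))"
    by (rule sobolev_weight_mult[OF assms]) simp
  fix \<xi>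
  have "norm (diff_coeff j c \<xi>) = 2 * pi * (\<bar>lattice_vec \<xi> $ j\<bar> * norm (c \<xi>))"
    by (simp add: diff_coeff_def norm_mult)
  also have "\<dots> \<le> 2 * pi * (weight \<xi> powr (1/2) * norm (c \<xi>))"
    by (intro mult_left_mono mult_right_mono order_trans[OF component_le_norm_cart norm_lattice_vec_le_weight]) auto
  finally show "norm (diff_coeff j c \<xi>) \<le> 2 * pi * (weight \<xi> powr (1/2) * norm (c \<xi>))" .
qed

lemma fourier_sum_derivative_expand:
  "Re (\<Sum>\<xi>\<in>F. c \<xi> * (2 * of_real pi * \<i> * of_real (h \<bullet> lattice_vec \<xi>) * character \<xi> x))
    = (\<Sum>j\<in>UNIV. h $ j * fourier_sum F (diff_coeff j c) x)"
proof -
  have "(\<Sum>\<xi>\<in>F. c \<xi> * (2 * of_real pi * \<i> * of_real (h \<bullet> lattice_vec \<xi>) * character \<xi> x))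
    = (\<Sum>\<xi>\<in>F. \<Sum>j\<in>UNIV. of_real (h $ j) * (diff_coeff j c \<xi> * character \<xi> x))"
    by (intro sum.cong refl) (simp add: inner_vec_def diff_coeff_def sum_distrib_left sum_distrib_right mult_ac)
  also have "\<dots> = (\<Sum>j\<in>UNIV. of_real (h $ j) * (\<Sum>\<xi>\<in>F. diff_coeff j c \<xi> * character \<xi> x))"
    by (subst sum.swap) (simp add: sum_distrib_left)
  finally show ?thesis by (simp add: fourier_sum_def)
qed

lemma fourier_series_uniform:
  assumes "(\<lambda>\<xi>. cmod (c \<xi>)) summable_on UNIV" and "\<epsilon> > 0"
  shows "\<forall>\<^sub>F N in sequentially. \<forall>x. \<bar>fourier_sum (box_freqs N) c x - fourier_series c x\<bar> < \<epsilon>"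
proof -
  from uniform_limitD[OF abs_fourier_series(1)[OF assms(1)] assms(2)]
  have "\<forall>\<^sub>F N in sequentially. \<forall>x\<in>UNIV. dist (\<Sum>\<xi>\<in>box_freqs N. c \<xi> * character \<xi> x) (\<Sum>\<^sub>\<infinity>\<xi>. c \<xi> * character \<xi> x) < \<epsilon>"
    by (rule eventually_compose_filterlim) (rule filterlim_box_freqs, rule order_refl)
  then show ?thesis
  proof eventually_elim
    case (elim N)
    show ?case
    proof
      fix x
      have "\<bar>fourier_sum (box_freqs N) c x - fourier_series c x\<bar>
          \<le> cmod ((\<Sum>\<xi>\<in>box_freqs N. c \<xi> * character \<xi> x) - (\<Sum>\<^sub>\<infinity>\<xi>. c \<xi> * character \<xi> x))"
        unfolding fourier_sum_def fourier_series_def minus_complex.sel[symmetric] by (rule abs_Re_le_cmod)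
      then show "\<bar>fourier_sum (box_freqs N) c x - fourier_series c x\<bar> < \<epsilon>"
        using elim by (auto simp: dist_norm intro: le_less_trans)
    qed
  qed
qed

text \<open>Term-by-term differentiation: the coefficients multiplied by a frequency component
  remain absolutely summable, so the gradients of the partial sums converge uniformly.\<close>

lemma fourier_series_has_derivative:
  fixes c :: "int^'n::finite \<Rightarrow> complex"
  assumes "\<And>s. sobolev s c"
  shows "(fourier_series c has_derivative (\<lambda>h. \<Sum>j\<in>UNIV. h $ j * fourier_series (diff_coeff j c) x)) (at x)"
proof -
  have rapid: "(\<lambda>\<xi>. cmod (diff_coeff j c \<xi>)) summable_on UNIV" for j
    using sobolev_diff_coeff[OF assms, of "real CARD('n) + 1" j] by (intro sobolev_summable) simp
  have pw: "(\<lambda>N. fourier_sum (box_freqs N) c x) \<longlonglongrightarrow> fourier_series c x" for x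
  proof (rule tendstoI)
    fix e :: real assume "e > 0"
    from fourier_series_uniform[OF sobolev_summable[OF assms] this]
    show "\<forall>\<^sub>F N in sequentially. dist (fourier_sum (box_freqs N) c x) (fourier_series c x) < e"
      by eventually_elim (simp add: dist_real_def)
  qed
  have "\<exists>g. \<forall>x\<in>UNIV. (\<lambda>N. fourier_sum (box_freqs N) c x) \<longlonglongrightarrow> g x \<and>
      (g has_derivative (\<lambda>h. \<Sum>j\<in>UNIV. h $ j * fourier_series (diff_coeff j c) x)) (at x within UNIV)"
  proof (rule has_derivative_sequence[where f'="\<lambda>N x h. \<Sum>j\<in>UNIV. h $ j * fourier_sum (box_freqs N) (diff_coeff j c) x"])
    show "(fourier_sum (box_freqs N) c has_derivative (\<lambda>h. \<Sum>j\<in>UNIV. h $ j * fourier_sum (box_freqs N) (diff_coeff j c) x)) (at x within UNIV)" for N x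
      using fourier_sum_has_derivative[of "box_freqs N" c x] by (simp only: fourier_sum_derivative_expand)
    show "(\<lambda>N. fourier_sum (box_freqs N) c 0) \<longlonglongrightarrow> fourier_series c 0" by (rule pw)
    fix e :: real assume "e > 0"
    \<comment> \<open>Divided by the dimension, since the derivative in direction \<open>h\<close>
      adds up \<open>n\<close> partial derivatives.\<close>
    define \<epsilon> where "\<epsilon> = e / real CARD('n)"
    have "\<epsilon> > 0" using \<open>e > 0\<close> by (simp add: \<epsilon>_def)
    have "\<forall>\<^sub>F N in sequentially. \<forall>j\<in>UNIV. \<forall>x. \<bar>fourier_sum (box_freqs N) (diff_coeff j c) x - fourier_series (diff_coeff j c) x\<bar> < \<epsilon>"
      by (intro eventually_ball_finite ballI fourier_series_uniform rapid \<open>\<epsilon> > 0\<close>) simp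
    then show "\<forall>\<^sub>F N in sequentially. \<forall>x\<in>UNIV. \<forall>h. norm ((\<Sum>j\<in>UNIV. h $ j * fourier_sum (box_freqs N) (diff_coeff j c) x) - (\<Sum>j\<in>UNIV. h $ j * fourier_series (diff_coeff j c) x)) \<le> e * norm h"
    proof eventually_elim
      case (elim N)
      show ?case
      proof (intro ballI allI)
        fix x h :: "real^'n"
        have "norm ((\<Sum>j\<in>UNIV. h $ j * fourier_sum (box_freqs N) (diff_coeff j c) x) - (\<Sum>j\<in>UNIV. h $ j * fourier_series (diff_coeff j c) x))
          = norm (\<Sum>j\<in>UNIV. h $ j * (fourier_sum (box_freqs N) (diff_coeff j c) x - fourier_series (diff_coeff j c) x))"
          by (simp add: sum_subtractf right_diff_distrib)
        also have "\<dots> \<le> (\<Sum>j\<in>(UNIV::'n set). norm h * \<epsilon>)"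
        proof (rule sum_norm_le)
          fix j
          have "\<bar>fourier_sum (box_freqs N) (diff_coeff j c) x - fourier_series (diff_coeff j c) x\<bar> \<le> \<epsilon>"
            using elim by (auto intro: less_imp_le)
          then show "norm (h $ j * (fourier_sum (box_freqs N) (diff_coeff j c) x - fourier_series (diff_coeff j c) x)) \<le> norm h * \<epsilon>"
            unfolding real_norm_def abs_mult by (intro mult_mono component_le_norm_cart) auto
        qed
        also have "\<dots> = e * norm h" by (simp add: \<epsilon>_def)
        finally show "norm ((\<Sum>j\<in>UNIV. h $ j * fourier_sum (box_freqs N) (diff_coeff j c) x) - (\<Sum>j\<in>UNIV. h $ j * fourier_series (diff_coeff j c) x)) \<le> e * norm h" .
      qed
    qed
  qed auto
  then obtain g where g: "\<And>x. (\<lambda>N. fourier_sum (box_freqs N) c x) \<longlonglongrightarrow> g x"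
    "\<And>x. (g has_derivative (\<lambda>h. \<Sum>j\<in>UNIV. h $ j * fourier_series (diff_coeff j c) x)) (at x)" by auto
  have "g = fourier_series c" using LIMSEQ_unique[OF g(1) pw] by blast
  then show ?thesis using g(2) by simp
qed

lemma fourier_series_C_per:
  fixes c :: "int^'n::finite \<Rightarrow> complex"
  assumes "\<And>s. sobolev s c"
  shows "fourier_series c \<in> C_per"
proof -
  have "smooth (fourier_series c)"
  proof (rule smooth_coinduct[of _ "{fourier_series c |c. \<forall>s. sobolev s c}"])
    fix f :: "'n scalar" and j assume "f \<in> {fourier_series c |c. \<forall>s. sobolev s c}"
    then obtain c where c: "f = fourier_series c" "\<And>s. sobolev s c" by blast
    show "f differentiable_on UNIV"
      using fourier_series_has_derivative[OF c(2)] by (auto simp: c(1) differentiable_on_def differentiable_def)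
    have "partial_derivative j f = fourier_series (diff_coeff j c)"
    proof
      fix x
      show "partial_derivative j f x = fourier_series (diff_coeff j c) x"
        unfolding c(1) partial_derivative_eq[OF fourier_series_has_derivative[OF c(2)]]
        by (simp add: axis_def if_distrib[of "\<lambda>y. y * _"] cong: if_cong)
    qed
    moreover have "sobolev s (diff_coeff j c)" for s
      using sobolev_diff_coeff[OF c(2)[of "s + 1"]] by simp
    ultimately show "partial_derivative j f \<in> {fourier_series c |c. \<forall>s. sobolev s c}" by blast
  qed (use assms in blast)
  moreover have "periodic (fourier_series c)"
    by (simp add: periodic_def fourier_series_def character_periodic[unfolded lattice_periodic_def, rule_format])
  ultimately show ?thesis by (simp add: C_per_def)
qed

lemma real_fourier_fourier_series:
  assumes c: "\<And>s. sobolev s c" "hermitian c"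
  shows "real_fourier (fourier_series c) = c"
proof -
  have "cnj (\<Sum>\<^sub>\<infinity>\<xi>. c \<xi> * character \<xi> x) = (\<Sum>\<^sub>\<infinity>\<xi>. c \<xi> * character \<xi> x)" for x
  proof -
    have "cnj (\<Sum>\<^sub>\<infinity>\<xi>. c \<xi> * character \<xi> x) = (\<Sum>\<^sub>\<infinity>\<xi>. c (- \<xi>) * character (- \<xi>) x)"
      using c(2) by (simp add: cnj_character hermitian_def flip: infsum_cnj)
    also have "\<dots> = (\<Sum>\<^sub>\<infinity>\<xi>. c \<xi> * character \<xi> x)"
      by (rule infsum_reindex_bij_witness[of _ uminus uminus]) auto
    finally show ?thesis .
  qed
  then have "complex_of_real (fourier_series c x) = (\<Sum>\<^sub>\<infinity>\<xi>. c \<xi> * character \<xi> x)" for x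
    unfolding fourier_series_def by (simp only: Reals_cnj_iff[symmetric] of_real_Re)
  then show ?thesis
    using abs_fourier_series(4)[OF sobolev_summable[OF c(1)]] by (simp add: real_fourier_def fun_eq_iff)
qed

lemma real_fourier_1: "real_fourier (\<lambda>_. 1) \<xi> = (if \<xi> = 0 then 1 else 0)"
  by (simp add: real_fourier_def fourier_def cnj_character integral_character)

text \<open>The choice \<open>b = 1\<close> in the convolution theorem recovers the coefficients of
  \<open>a\<close>, since the constant 1 has its only nonzero coefficient at frequency 0.\<close>

lemma riesz_fischer_coeff:
  fixes c :: "int^'n::finite \<Rightarrow> complex"
  assumes c: "sobolev 0 c" "hermitian c"
  obtains a where "lattice_periodic a" "a \<in> borel_measurable torus_measure" "integrable torus_measure (\<lambda>x. (a x)\<^sup>2)"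
    "integrable torus_measure a" "real_fourier a = c"
    "\<And>b \<xi>. b \<in> borel_measurable torus_measure \<Longrightarrow> integrable torus_measure (\<lambda>x. (b x)\<^sup>2) \<Longrightarrow>
       (\<lambda>\<eta>. c \<eta> * real_fourier b (\<xi> - \<eta>)) summable_on UNIV \<Longrightarrow>
       real_fourier (\<lambda>x. a x * b x) \<xi> = (\<Sum>\<^sub>\<infinity>\<eta>. c \<eta> * real_fourier b (\<xi> - \<eta>))"
proof -
  obtain a where a: "lattice_periodic a" "a \<in> borel_measurable torus_measure" "integrable torus_measure (\<lambda>x. (a x)\<^sup>2)"
    "\<And>b \<xi>. b \<in> borel_measurable torus_measure \<Longrightarrow> integrable torus_measure (\<lambda>x. (b x)\<^sup>2) \<Longrightarrow>
       (\<lambda>\<eta>. c \<eta> * real_fourier b (\<xi> - \<eta>)) summable_on UNIV \<Longrightarrow>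
       real_fourier (\<lambda>x. a x * b x) \<xi> = (\<Sum>\<^sub>\<infinity>\<eta>. c \<eta> * real_fourier b (\<xi> - \<eta>))"
    using riesz_fischer_product[OF c] by blast
  have "integrable torus_measure a"
    using integrable_mult_square[OF a(2) borel_measurable_const a(3), of 1] by simp
  moreover have "real_fourier a \<xi> = c \<xi>" for \<xi>
  proof -
    have s: "((\<lambda>\<eta>. c \<eta> * real_fourier (\<lambda>_. 1) (\<xi> - \<eta>)) has_sum c \<xi>) UNIV"
      by (rule has_sum_finite_neutralI[of "{\<xi>}"]) (auto simp: real_fourier_1)
    show ?thesis
      using a(4)[of "\<lambda>_. 1" \<xi>] infsumI[OF s] has_sum_imp_summable[OF s] by simp
  qed
  ultimately show ?thesis using that a by blast
qed

lemma representsI: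
  assumes "g \<in> distributions" "lattice_periodic a" "integrable torus_measure a" "real_fourier a = fourier_coeff g"
  shows "represents a g"
  unfolding represents_def
  using assms by (auto simp: periodic_iff_lattice_periodic set_integrable_torus fourier_coeff_dist_of
      intro!: dist_eq_fourier_coeff dist_of_distributions)

lemma summable_on_l2_convolution:
  fixes c d :: "int^'n::finite \<Rightarrow> complex"
  assumes "sobolev 0 c" "sobolev 0 d"
  shows "(\<lambda>\<eta>. c \<eta> * d (\<xi> - \<eta>)) summable_on UNIV"
proof (rule abs_summable_summable, rule summable_on_comparison_test)
  have "(\<lambda>\<eta>. (cmod (d (\<xi> - \<eta>)))\<^sup>2) summable_on UNIV \<longleftrightarrow> (\<lambda>\<eta>. (cmod (d \<eta>))\<^sup>2) summable_on UNIV"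
    by (rule summable_on_reindex_bij_witness[of _ "\<lambda>\<eta>. \<xi> - \<eta>" "\<lambda>\<eta>. \<xi> - \<eta>"]) auto
  then show "(\<lambda>\<eta>. (cmod (c \<eta>))\<^sup>2 + (cmod (d (\<xi> - \<eta>)))\<^sup>2) summable_on UNIV"
    using assms by (intro summable_on_add) (simp_all add: sobolev_def)
  fix \<eta>
  have "2 * cmod (c \<eta> * d (\<xi> - \<eta>)) \<le> (cmod (c \<eta>))\<^sup>2 + (cmod (d (\<xi> - \<eta>)))\<^sup>2"
    using sum_squares_bound[of "cmod (c \<eta>)" "cmod (d (\<xi> - \<eta>))"] by (simp add: norm_mult)
  then show "cmod (c \<eta> * d (\<xi> - \<eta>)) \<le> (cmod (c \<eta>))\<^sup>2 + (cmod (d (\<xi> - \<eta>)))\<^sup>2"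
    using norm_ge_zero[of "c \<eta> * d (\<xi> - \<eta>)"] by linarith
qed simp

text \<open>Both densities are square integrable, so their product is integrable and defines the
  distribution. The convolution theorem attached to the density of \<open>g\<close> is applied to
  the density of \<open>h\<close>.\<close>

lemma is_product_fourier:
  fixes g h :: "'n::finite functional"
  assumes g: "g \<in> distributions" "sobolev 0 (fourier_coeff g)" and h: "h \<in> distributions" "sobolev 0 (fourier_coeff h)"
  shows "\<exists>w\<in>distributions. is_product g h w \<and> (\<forall>\<xi>. fourier_coeff w \<xi> = (\<Sum>\<^sub>\<infinity>\<eta>. fourier_coeff g \<eta> * fourier_coeff h (\<xi> - \<eta>)))"
proof -
  obtain a where a: "lattice_periodic a" "a \<in> borel_measurable torus_measure" "integrable torus_measure (\<lambda>x. (a x)\<^sup>2)"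
    "integrable torus_measure a" "real_fourier a = fourier_coeff g"
    "\<And>b \<xi>. b \<in> borel_measurable torus_measure \<Longrightarrow> integrable torus_measure (\<lambda>x. (b x)\<^sup>2) \<Longrightarrow>
       (\<lambda>\<eta>. fourier_coeff g \<eta> * real_fourier b (\<xi> - \<eta>)) summable_on UNIV \<Longrightarrow>
       real_fourier (\<lambda>x. a x * b x) \<xi> = (\<Sum>\<^sub>\<infinity>\<eta>. fourier_coeff g \<eta> * real_fourier b (\<xi> - \<eta>))"
    by (rule riesz_fischer_coeff[OF g(2) hermitian_fourier_coeff[OF g(1)]]) (rule that, assumption+)
  obtain b where b: "lattice_periodic b" "b \<in> borel_measurable torus_measure" "integrable torus_measure (\<lambda>x. (b x)\<^sup>2)"
    "integrable torus_measure b" "real_fourier b = fourier_coeff h"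
    by (rule riesz_fischer_coeff[OF h(2) hermitian_fourier_coeff[OF h(1)]]) (rule that, assumption+)
  have ab: "integrable torus_measure (\<lambda>x. a x * b x)"
    by (rule integrable_mult_square[OF a(2) b(2) a(3) b(3)])
  let ?w = "dist_of (\<lambda>x. a x * b x)"
  have "represents (\<lambda>x. a x * b x) ?w"
    by (rule representsI) (use a(1) b(1) ab in \<open>auto simp: lattice_periodic_def fourier_coeff_dist_of intro: dist_of_distributions\<close>)
  then have "is_product g h ?w"
    unfolding is_product_def using representsI[OF g(1) a(1,4,5)] representsI[OF h(1) b(1,4,5)] by blast
  moreover have "fourier_coeff ?w \<xi> = (\<Sum>\<^sub>\<infinity>\<eta>. fourier_coeff g \<eta> * fourier_coeff h (\<xi> - \<eta>))" for \<xi>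
    using a(6)[OF b(2,3), of \<xi>] summable_on_l2_convolution[OF g(2) h(2)] b(5) by (simp add: fourier_coeff_dist_of[OF ab])
  ultimately show ?thesis using dist_of_distributions[OF ab] by blast
qed

subsection \<open>The Navier--Stokes equation for distributions\<close>

lemma mem_H_per_dot_iff: "g \<in> H_per_dot s \<longleftrightarrow> g \<in> distributions \<and> sobolev s (fourier_coeff g) \<and> fourier_coeff g 0 = 0"
  by (auto simp: H_per_dot_def H_per_def sobolev_def weight_def)

lemma divergence_zero:
  fixes u :: "'n::finite \<Rightarrow> 'n functional"
  assumes u: "\<And>k. u k \<in> distributions" and sol: "solenoidal (\<lambda>k. fourier_coeff (u k))"
  shows "dist_eq (divergence u) (\<lambda>\<phi>. 0)"
proof (rule dist_eq_fourier_coeff)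
  show "divergence u \<in> distributions"
    unfolding divergence_def by (intro distributions_sum distributions_deriv u) simp
  fix \<xi>
  have "fourier_coeff (divergence u) \<xi> = 2 * of_real pi * \<i> * (\<Sum>k\<in>UNIV. of_real (lattice_vec \<xi> $ k) * fourier_coeff (u k) \<xi>)"
    unfolding divergence_def fourier_coeff_sum by (simp add: fourier_coeff_deriv u sum_distrib_left mult_ac)
  then show "fourier_coeff (divergence u) \<xi> = fourier_coeff (\<lambda>\<phi>. 0) \<xi>"
    using sol by (simp add: solenoidal_def fourier_coeff_zero)
qed (rule zero_distributions)

lemma strain_distributions:
  assumes "\<And>k. u k \<in> distributions"
  shows "strain u j \<beta> \<in> distributions"
    and "fourier_coeff (strain u j \<beta>) \<xi> = of_real pi * \<i> * (of_real (lattice_vec \<xi> $ j) * fourier_coeff (u \<beta>) \<xi> + of_real (lattice_vec \<xi> $ \<beta>) * fourier_coeff (u j) \<xi>)"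
proof -
  have eq: "strain u j \<beta> = (\<lambda>\<phi>. (1/2) * dist_deriv j (u \<beta>) \<phi> + (1/2) * dist_deriv \<beta> (u j) \<phi>)"
    by (simp add: strain_def fun_eq_iff add_divide_distrib)
  show "strain u j \<beta> \<in> distributions"
    unfolding eq by (intro distributions_linear distributions_deriv assms)
  show "fourier_coeff (strain u j \<beta>) \<xi> = of_real pi * \<i> * (of_real (lattice_vec \<xi> $ j) * fourier_coeff (u \<beta>) \<xi> + of_real (lattice_vec \<xi> $ \<beta>) * fourier_coeff (u j) \<xi>)"
    unfolding eq fourier_coeff_linear by (simp add: fourier_coeff_deriv assms algebra_simps)
qed

text \<open>Exchanging \<open>j\<close> and \<open>\<beta>\<close> is a symmetry of
  \<open>A\<close>, so the two halves of the strain contribute equally and combine to the full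
  gradient that \<open>symbol\<close> uses.\<close>

lemma elliptic_operator_distributions:
  fixes u :: "'n::finite \<Rightarrow> 'n functional"
  assumes u: "\<And>k. u k \<in> distributions" and A: "tensor_symmetric A"
  shows "elliptic_operator A u k \<in> distributions"
    and "fourier_coeff (elliptic_operator A u k) \<xi> = - (4 * (of_real pi)\<^sup>2 * (\<Sum>j\<in>UNIV. of_real (symbol A k j \<xi>) * fourier_coeff (u j) \<xi>))"
proof -
  have sym2: "A k j \<alpha> \<beta> = A k \<beta> \<alpha> j" for k j \<alpha> \<beta>
    using A unfolding tensor_symmetric_def by blast
  let ?L = "\<lambda>i. complex_of_real (lattice_vec \<xi> $ i)" and ?u = "\<lambda>j. fourier_coeff (u j) \<xi>"
  have stress: "(\<lambda>\<psi>. \<Sum>j\<in>UNIV. \<Sum>\<beta>\<in>UNIV. A k j \<alpha> \<beta> * strain u j \<beta> \<psi>) \<in> distributions" for \<alpha>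
    by (intro distributions_sum distributions_cmult strain_distributions u finite)
  show "elliptic_operator A u k \<in> distributions"
    unfolding elliptic_operator_def by (rule distributions_sum[OF finite], rule distributions_deriv, rule stress)
  have coeff: "fourier_coeff (\<lambda>\<psi>. \<Sum>j\<in>UNIV. \<Sum>\<beta>\<in>UNIV. A k j \<alpha> \<beta> * strain u j \<beta> \<psi>) \<xi>
      = 2 * of_real pi * \<i> * (\<Sum>j\<in>UNIV. \<Sum>\<beta>\<in>UNIV. of_real (A k j \<alpha> \<beta>) * (?L \<beta> * ?u j))" for \<alpha>
  proof -
    have swap: "(\<Sum>j\<in>UNIV. \<Sum>\<beta>\<in>UNIV. of_real (A k j \<alpha> \<beta>) * (?L j * ?u \<beta>)) = (\<Sum>j\<in>UNIV. \<Sum>\<beta>\<in>UNIV. of_real (A k j \<alpha> \<beta>) * (?L \<beta> * ?u j))"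
      by (subst sum.swap) (intro sum.cong refl, metis sym2)
    have "fourier_coeff (\<lambda>\<psi>. \<Sum>j\<in>UNIV. \<Sum>\<beta>\<in>UNIV. A k j \<alpha> \<beta> * strain u j \<beta> \<psi>) \<xi>
      = (\<Sum>j\<in>UNIV. \<Sum>\<beta>\<in>UNIV. of_real pi * \<i> * (of_real (A k j \<alpha> \<beta>) * (?L j * ?u \<beta>)) + of_real pi * \<i> * (of_real (A k j \<alpha> \<beta>) * (?L \<beta> * ?u j)))"
      unfolding fourier_coeff_sum fourier_coeff_cmult strain_distributions(2)[OF u]
      by (intro sum.cong refl) (simp add: algebra_simps)
    also have "\<dots> = of_real pi * \<i> * (\<Sum>j\<in>UNIV. \<Sum>\<beta>\<in>UNIV. of_real (A k j \<alpha> \<beta>) * (?L j * ?u \<beta>))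
        + of_real pi * \<i> * (\<Sum>j\<in>UNIV. \<Sum>\<beta>\<in>UNIV. of_real (A k j \<alpha> \<beta>) * (?L \<beta> * ?u j))"
      by (simp only: sum.distrib sum_distrib_left)
    finally show ?thesis unfolding swap by simp
  qed
  have "fourier_coeff (elliptic_operator A u k) \<xi> = (\<Sum>\<alpha>\<in>UNIV. 2 * of_real pi * \<i> * ?L \<alpha> * (2 * of_real pi * \<i> * (\<Sum>j\<in>UNIV. \<Sum>\<beta>\<in>UNIV. of_real (A k j \<alpha> \<beta>) * (?L \<beta> * ?u j))))"
    unfolding elliptic_operator_def by (subst fourier_coeff_sum) (simp only: fourier_coeff_deriv[OF stress] coeff)
  also have "\<dots> = - (4 * (of_real pi)\<^sup>2) * (\<Sum>\<alpha>\<in>UNIV. \<Sum>j\<in>UNIV. \<Sum>\<beta>\<in>UNIV. of_real (A k j \<alpha> \<beta>) * ?L \<alpha> * ?L \<beta> * ?u j)"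
    unfolding sum_distrib_left by (intro sum.cong refl) (simp add: power2_eq_square)
  also have "(\<Sum>\<alpha>\<in>UNIV. \<Sum>j\<in>UNIV. \<Sum>\<beta>\<in>UNIV. of_real (A k j \<alpha> \<beta>) * ?L \<alpha> * ?L \<beta> * ?u j)
      = (\<Sum>j\<in>UNIV. of_real (symbol A k j \<xi>) * ?u j)"
    by (subst sum.swap) (simp add: symbol_def sum_distrib_right)
  finally show "fourier_coeff (elliptic_operator A u k) \<xi> = - (4 * (of_real pi)\<^sup>2 * (\<Sum>j\<in>UNIV. of_real (symbol A k j \<xi>) * ?u j))"
    by simp
qed

text \<open>Order 1 puts both \<open>u\<^sub>j\<close> and its partial derivatives into
  \<open>L\<^sup>2\<close>, so the products required by the definition exist as integrable
  functions. The rest is comparison of coefficients.\<close>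

lemma navier_stokes_solutionI:
  fixes u f :: "'n::finite \<Rightarrow> 'n functional"
  assumes A: "tensor_symmetric A"
    and dist: "\<And>k. u k \<in> distributions" "p \<in> distributions" "\<And>k. f k \<in> distributions"
    and sob: "\<And>k. sobolev 1 (fourier_coeff (u k))"
    and sol: "solenoidal (\<lambda>k. fourier_coeff (u k))"
    and ns: "ns_fourier A (\<lambda>k. fourier_coeff (f k)) (\<lambda>k. fourier_coeff (u k)) (fourier_coeff p)"
  shows "navier_stokes_solution A f u p"
proof -
  let ?u = "\<lambda>k. fourier_coeff (u k)"
  have du: "fourier_coeff (dist_deriv j (u k)) = diff_coeff j (?u k)" for j k
    by (simp add: fun_eq_iff fourier_coeff_deriv[OF dist(1)] diff_coeff_def)
  have u0: "sobolev 0 (?u k)" and du0: "sobolev 0 (diff_coeff j (?u k))" for j k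
    using sobolev_mono[OF sob, of 0] sobolev_diff_coeff[OF sob, of j] by simp_all
  have "\<forall>j k. \<exists>w\<in>distributions. is_product (u j) (dist_deriv j (u k)) w
      \<and> (\<forall>\<xi>. fourier_coeff w \<xi> = (\<Sum>\<^sub>\<infinity>\<eta>. ?u j \<eta> * diff_coeff j (?u k) (\<xi> - \<eta>)))"
    using is_product_fourier[OF dist(1) u0 distributions_deriv[OF dist(1)]] du du0 by metis
  then obtain N where N: "\<And>j k. N j k \<in> distributions" "\<And>j k. is_product (u j) (dist_deriv j (u k)) (N j k)"
    "\<And>j k \<xi>. fourier_coeff (N j k) \<xi> = (\<Sum>\<^sub>\<infinity>\<eta>. ?u j \<eta> * diff_coeff j (?u k) (\<xi> - \<eta>))"
    by metis
  \<comment> \<open>The products carry the convective form of the nonlinearity; solenoidality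
    identifies its convolution sum with the conservative one in \<open>ns_fourier\<close>.\<close>
  have conv: "(\<Sum>j\<in>UNIV. fourier_coeff (N j k) \<xi>) = (\<Sum>\<^sub>\<infinity>\<zeta>. advection ?u k \<xi> \<zeta>)" for k \<xi>
  proof -
    have "((\<lambda>\<zeta>. \<Sum>j\<in>UNIV. ?u j (\<xi> - \<zeta>) * diff_coeff j (?u k) \<zeta>) has_sum (\<Sum>j\<in>UNIV. fourier_coeff (N j k) \<xi>)) UNIV"
    proof (rule has_sum_sum)
      fix j
      have "((\<lambda>\<eta>. ?u j \<eta> * diff_coeff j (?u k) (\<xi> - \<eta>)) has_sum fourier_coeff (N j k) \<xi>) UNIV"
        unfolding N(3) by (intro has_sum_infsum summable_on_l2_convolution u0 du0)
      then show "((\<lambda>\<zeta>. ?u j (\<xi> - \<zeta>) * diff_coeff j (?u k) \<zeta>) has_sum fourier_coeff (N j k) \<xi>) UNIV"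
        by (subst has_sum_reindex_bij_witness[of _ "\<lambda>\<eta>. \<xi> - \<eta>" "\<lambda>\<eta>. \<xi> - \<eta>"]) auto
    qed simp
    moreover have "(\<Sum>j\<in>UNIV. ?u j (\<xi> - \<zeta>) * diff_coeff j (?u k) \<zeta>) = advection ?u k \<xi> \<zeta>" for \<zeta>
      unfolding advection_solenoidal[OF sol] by (simp add: diff_coeff_def sum_distrib_left sum_distrib_right mult_ac)
    ultimately show ?thesis by (simp add: infsumI)
  qed
  have "dist_eq (\<lambda>\<phi>. - elliptic_operator A u k \<phi> + dist_deriv k p \<phi> + (\<Sum>j\<in>UNIV. N j k \<phi>)) (f k)" for k
  proof (rule dist_eq_fourier_coeff)
    have "(\<lambda>\<phi>. - elliptic_operator A u k \<phi>) \<in> distributions"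
      using distributions_cmult[OF elliptic_operator_distributions(1)[where u=u and k=k, OF dist(1) A], of "- 1"] by simp
    then show "(\<lambda>\<phi>. - elliptic_operator A u k \<phi> + dist_deriv k p \<phi> + (\<Sum>j\<in>UNIV. N j k \<phi>)) \<in> distributions"
      by (intro distributions_add distributions_sum distributions_deriv dist N finite)
    fix \<xi>
    show "fourier_coeff (\<lambda>\<phi>. - elliptic_operator A u k \<phi> + dist_deriv k p \<phi> + (\<Sum>j\<in>UNIV. N j k \<phi>)) \<xi> = fourier_coeff (f k) \<xi>"
      unfolding fourier_coeff_add fourier_coeff_minus fourier_coeff_sum conv fourier_coeff_deriv[OF dist(2)]
        elliptic_operator_distributions(2)[where u=u, OF dist(1) A]
      using ns by (simp add: ns_fourier_def)
  qed (rule dist(3))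
  then show ?thesis
    unfolding navier_stokes_solution_def using N(2) by blast
qed

text \<open>The pair is chosen before the order \<open>s\<close>. For smooth data a single solution
  must have every order at once, which existence for each \<open>s\<close> separately would not
  give.\<close>

lemma ns_fourier_regular_solution:
  fixes A :: "'n::finite tensor4" and f :: "'n \<Rightarrow> int^'n \<Rightarrow> complex"
  assumes card: "CARD('n) \<le> 3" and A: "tensor_symmetric A" "relaxed_elliptic A"
    and f: "\<And>k. hermitian (f k)" "\<And>k. f k 0 = 0" "\<And>k. sobolev (- 1) (f k)"
  shows "\<exists>u p. (\<forall>k. hermitian (u k)) \<and> solenoidal u \<and> (\<forall>k. u k 0 = 0) \<and> hermitian p \<and> p 0 = 0 \<and> ns_fourier A f u p
    \<and> (\<forall>s. 1 \<le> s \<longrightarrow> (\<forall>k. sobolev (s - 2) (f k)) \<longrightarrow> (\<forall>k. sobolev s (u k)) \<and> sobolev (s - 1) p)"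
proof -
  obtain u p where up: "\<And>k. hermitian (u k)" "solenoidal u" "\<And>k. u k 0 = 0" "\<And>k. sobolev 1 (u k)"
    "hermitian p" "p 0 = 0" "ns_fourier A f u p"
    using ns_fourier_exists[where f=f, OF A f] by blast
  have reg: "sobolev s (u k)" if "1 \<le> s" "\<forall>k. sobolev (s - 2) (f k)" for s k
    by (rule ns_fourier_velocity_regular[OF card A up(7,2,3,4) that(2)[rule_format] that(1)])
  have "sobolev (s - 1) p" if "1 \<le> s" "\<forall>k. sobolev (s - 2) (f k)" for s
    by (rule ns_fourier_pressure_regular[OF card up(7) reg[OF that] up(6) that(2)[rule_format] that(1)])
  then show ?thesis using up reg by blast
qed

theorem theorem6p4:
  fixes A :: "'n::finite tensor4"
  assumes "CARD('n) \<in> {2, 3}"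
    and "tensor_symmetric A"
    and "relaxed_elliptic A"
  shows "(\<forall>(s::real) (f :: 'n \<Rightarrow> 'n functional).
            s \<ge> 1 \<and> (\<forall>k. f k \<in> H_per_dot (s - 2)) \<longrightarrow>
            (\<exists>u p. u \<in> H_per_dot_sol s \<and> p \<in> H_per_dot (s - 1) \<and>
                   navier_stokes_solution A f u p))
       \<and> (\<forall>f :: 'n \<Rightarrow> 'n scalar.
            (\<forall>k. f k \<in> C_per_dot) \<longrightarrow>
            (\<exists>(u :: 'n \<Rightarrow> 'n scalar) (p :: 'n scalar).
               (\<forall>k. u k \<in> C_per_dot) \<and> p \<in> C_per_dot \<and>
               dist_eq (divergence (\<lambda>k. dist_of (u k))) (\<lambda>\<phi>. 0) \<and>
               navier_stokes_solution A (\<lambda>k. dist_of (f k)) (\<lambda>k. dist_of (u k)) (dist_of p)))"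
proof (intro conjI allI impI)
  have card: "CARD('n) \<le> 3" using assms(1) by auto
  {
    fix s :: real and f :: "'n \<Rightarrow> 'n functional"
    assume "s \<ge> 1 \<and> (\<forall>k. f k \<in> H_per_dot (s - 2))"
    then have s: "1 \<le> s" and f: "\<And>k. f k \<in> distributions" "\<And>k. sobolev (s - 2) (fourier_coeff (f k))" "\<And>k. fourier_coeff (f k) 0 = 0"
      by (auto simp: mem_H_per_dot_iff)
    have "sobolev (- 1) (fourier_coeff (f k))" for k
      using sobolev_mono[OF f(2)] s by simp
    from ns_fourier_regular_solution[where f="\<lambda>k. fourier_coeff (f k)", OF card assms(2,3) hermitian_fourier_coeff[OF f(1)] f(3) this]
    obtain u p where up: "\<And>k. hermitian (u k)" "solenoidal u" "\<And>k. u k 0 = 0" "hermitian p" "p 0 = 0"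
      "ns_fourier A (\<lambda>k. fourier_coeff (f k)) u p"
      and reg: "\<forall>s. 1 \<le> s \<longrightarrow> (\<forall>k. sobolev (s - 2) (fourier_coeff (f k))) \<longrightarrow> (\<forall>k. sobolev s (u k)) \<and> sobolev (s - 1) p"
      by blast
    have us: "sobolev s (u k)" for k using reg s f(2) by blast
    have ps: "sobolev (s - 1) p" using reg s f(2) by blast
    \<comment> \<open>Since \<open>s \<ge> 1\<close>, the velocity and even the pressure, of order
      \<open>s - 1 \<ge> 0\<close>, are square summable, so both are coefficient families of
      functions and thereby of distributions.\<close>
    have "\<exists>a. integrable torus_measure a \<and> real_fourier a = u k" for k
    proof -
      have "sobolev 0 (u k)" using sobolev_mono[OF us, of 0] s by simp
      then show ?thesis by (rule riesz_fischer_coeff[OF _ up(1)]) blast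
    qed
    then obtain a where a: "\<And>k. integrable torus_measure (a k)" "\<And>k. real_fourier (a k) = u k" by metis
    have "sobolev 0 p" using sobolev_mono[OF ps, of 0] s by simp
    then obtain q where q: "integrable torus_measure q" "real_fourier q = p"
      by (rule riesz_fischer_coeff[OF _ up(4)]) blast
    have fa: "fourier_coeff (dist_of (a k)) = u k" and fq: "fourier_coeff (dist_of q) = p" for k
      using fourier_coeff_dist_of[OF a(1)] fourier_coeff_dist_of[OF q(1)] a(2) q(2) by auto
    have da: "dist_of (a k) \<in> distributions" and dq: "dist_of q \<in> distributions" for k
      using dist_of_distributions a q by auto
    show "\<exists>u p. u \<in> H_per_dot_sol s \<and> p \<in> H_per_dot (s - 1) \<and> navier_stokes_solution A f u p"
    proof (intro exI conjI)
      show "(\<lambda>k. dist_of (a k)) \<in> H_per_dot_sol s"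
        using divergence_zero[of "\<lambda>k. dist_of (a k)"] up(1-5) us da fa by (simp add: H_per_dot_sol_def mem_H_per_dot_iff)
      show "dist_of q \<in> H_per_dot (s - 1)"
        using up(5) ps dq fq by (simp add: mem_H_per_dot_iff)
      show "navier_stokes_solution A f (\<lambda>k. dist_of (a k)) (dist_of q)"
        by (rule navier_stokes_solutionI[OF assms(2) da dq f(1)]) (use up(1-6) fa fq sobolev_mono[OF us s] in simp_all)
    qed
  next
    fix f :: "'n \<Rightarrow> 'n scalar"
    assume "\<forall>k. f k \<in> C_per_dot"
    then have f: "\<And>k. f k \<in> C_per" and f0: "\<And>k. integral\<^sup>L torus_measure (f k) = 0"
      by (auto simp: C_per_dot_def set_integral_torus)
    have mean: "real_fourier g 0 = of_real (integral\<^sup>L torus_measure g)" for g :: "'n scalar"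
      by (simp add: real_fourier_def fourier_def)
    note fi = C_per_integrable[OF f]
    have "real_fourier (f k) 0 = 0" for k by (simp add: mean f0)
    from ns_fourier_regular_solution[where f="\<lambda>k. real_fourier (f k)", OF card assms(2,3) hermitian_real_fourier this sobolev_real_fourier[OF f]]
    obtain u p where up: "\<And>k. hermitian (u k)" "solenoidal u" "\<And>k. u k 0 = 0" "hermitian p" "p 0 = 0"
      "ns_fourier A (\<lambda>k. real_fourier (f k)) u p"
      and reg: "\<forall>s. 1 \<le> s \<longrightarrow> (\<forall>k. sobolev (s - 2) (real_fourier (f k))) \<longrightarrow> (\<forall>k. sobolev s (u k)) \<and> sobolev (s - 1) p"
      by blast
    have u1: "sobolev s (u k)" and p1: "sobolev (s - 1) p" if "1 \<le> s" for s k
      using reg that sobolev_real_fourier[OF f] by blast+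
    have u: "sobolev s (u k)" for s k
      by (rule sobolev_mono[OF u1[of "max 1 s"]]) auto
    have p: "sobolev s p" for s
      by (rule sobolev_mono[OF p1[of "max 1 (s + 1)"]]) auto
    define v where "v = (\<lambda>k. fourier_series (u k))"
    define q where "q = fourier_series p"
    have v: "v k \<in> C_per" "real_fourier (v k) = u k" for k
      unfolding v_def by (intro fourier_series_C_per real_fourier_fourier_series u up)+
    have q: "q \<in> C_per" "real_fourier q = p"
      unfolding q_def by (intro fourier_series_C_per real_fourier_fourier_series p up)+
    have coeff: "fourier_coeff (dist_of (v k)) = u k" "fourier_coeff (dist_of q) = p" "fourier_coeff (dist_of (f k)) = real_fourier (f k)" for k
      using fourier_coeff_dist_of[OF C_per_integrable[OF v(1)]] fourier_coeff_dist_of[OF C_per_integrable[OF q(1)]] fourier_coeff_dist_of[OF fi] v(2) q(2) by auto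
    have dist: "dist_of (v k) \<in> distributions" "dist_of q \<in> distributions" "dist_of (f k) \<in> distributions" for k
      by (intro dist_of_distributions C_per_integrable v q f)+
    show "\<exists>(u :: 'n \<Rightarrow> 'n scalar) (p :: 'n scalar).
               (\<forall>k. u k \<in> C_per_dot) \<and> p \<in> C_per_dot \<and>
               dist_eq (divergence (\<lambda>k. dist_of (u k))) (\<lambda>\<phi>. 0) \<and>
               navier_stokes_solution A (\<lambda>k. dist_of (f k)) (\<lambda>k. dist_of (u k)) (dist_of p)"
    proof (intro exI conjI allI)
      show "v k \<in> C_per_dot" for k
        using v[of k] mean[of "v k"] up(3) by (simp add: C_per_dot_def set_integral_torus)
      show "q \<in> C_per_dot"
        using q mean[of q] up(5) by (simp add: C_per_dot_def set_integral_torus)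
      show "dist_eq (divergence (\<lambda>k. dist_of (v k))) (\<lambda>\<phi>. 0)"
        by (rule divergence_zero) (use dist coeff up(1-6) in simp_all)
      show "navier_stokes_solution A (\<lambda>k. dist_of (f k)) (\<lambda>k. dist_of (v k)) (dist_of q)"
        by (rule navier_stokes_solutionI[OF assms(2) dist]) (use up(1-6) u coeff in simp_all)
    qed
  }
qed

end
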